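(* Let $f=F'$ be differentiable with $\max_{\phi\in\mathbf{R}}|f'(\phi)|\le L$ for a non-negative constant $L$. Let $\varepsilon,\gamma,\tau>0$, and let $\phi^0,\phi^1$ be given with $$\frac{1}{|\Omega|}\int_\Omega \phi^1\,dx=\frac{1}{|\Omega|}\int_\Omega \phi^0\,dx=m_0 .$$ Let $(\phi^{n+1},\mu^{n+1})$, $n\ge1$, be generated by the SL-BDF2 scheme $$\frac{3\phi^{n+1}-4\phi^{n}+\phi^{n-1}}{2\tau}=\gamma\Delta \mu^{n+1},$$ $$\mu^{n+1}=-\varepsilon \Delta \phi^{n+1}+\frac{1}{\varepsilon}f(2\phi^{n}-\phi^{n-1})-A\tau \Delta \delta_{t}\phi^{n+1}+B\,\delta_{tt}\phi^{n+1},$$ where $A,B$ are non-negative constants. If $$B\geq\frac{L}{\varepsilon},\qquad A\geq\frac{\gamma}{\alpha_2}\frac{L^{2}}{16\varepsilon^{2}}-\alpha_1\frac{\varepsilon}{2\tau},\qquad 0\le\alpha_1\le 1,\qquad 0<\alpha_2\le1,$$ then for all $n\ge1$ $$\begin{aligned}E_{B}^{n+1}\leq{}& E_{B}^{n}-\frac{1}{4\tau\gamma}\|\delta_{tt}\phi^{n+1}\|_{-1}^{2}-(1-\alpha_1)\frac{\varepsilon}{2}\|\nabla\delta_{t}\phi^{n+1}\|^{2}-(1-\alpha_2)\frac{1}{\tau\gamma}\|\delta_{t}\phi^{n+1}\|^{2}_{-1}\\&-\left(2\sqrt{\frac{\alpha_2}{\gamma}\Big(A+\frac{\alpha_1\varepsilon}{2\tau}\Big)}-\frac{L}{2\varepsilon}\right)\|\delta_{t}\phi^{n+1}\|^{2}-\Big(\frac{B}{2}-\frac{L}{2\varepsilon}\Big)\|\delta_{tt}\phi^{n+1}\|^{2},\end{aligned}$$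 where $$E_{B}^{n+1}=E_{\varepsilon}(\phi^{n+1})+\frac{1}{4\tau\gamma}\|\delta_{t}\phi^{n+1}\|_{-1}^{2}+\Big(\frac{L}{2\varepsilon}+\frac{B}{2}\Big)\|\delta_{t}\phi^{n+1}\|^{2}.$$
   Context: $\Omega\subset\mathbf{R}^d$, $d=2,3$, is a bounded domain with locally Lipschitz boundary and outward normal $n$. The scheme discretizes in time the Cahn-Hilliard equation $\phi_t=\gamma\Delta\mu$, $\mu=-\varepsilon\Delta\phi+\frac1\varepsilon f(\phi)$ in $\Omega\times(0,T]$, $\phi|_{t=0}=\phi_0$, with homogeneous Neumann boundary conditions $\partial_n\phi=0$, $\partial_n\mu=0$ on $\partial\Omega$; the time-discrete functions $\phi^k$ and $\mu^k$ satisfy the same homogeneous Neumann conditions and are assumed regular enough for the scheme to make sense. Here $f=F'$, where $F$ is a given potential, $\tau$ is the time step, $\phi^0=\phi_0$ and $\phi^1\approx\phi(\cdot,\tau)$ are given, and $n$ ranges over the steps $n=1,2,\dots,N=T/\tau-1$ of the scheme. Notation: $\|\cdot\|$ is the $L^2(\Omega)$ norm and $(\cdot,\cdot)$ the $L^2$ inner product; $\delta_t\phi^{n+1}=\phi^{n+1}-\phi^n$; $\delta_{tt}\phi^{n+1}=\phi^{n+1}-2\phi^n+\phi^{n-1}$; $L^2_0(\Omega)$ is the space of $L^2$ functions with zero mean. For $v\in L_0^2(\Omega)$, $-\Delta^{-1}v:=v_1\in H^1(\Omega)\cap L^2_0(\Omega)$ is the solution of $-\Delta v_1=v$ in $\Omega$,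 $\partial_n v_1=0$ on $\partial\Omega$, and $\|v\|_{-1}:=\sqrt{(v,-\Delta^{-1}v)}$. The free energy is $$E_{\varepsilon}(\phi)=\int_{\Omega}\Big(\frac{\varepsilon}{2}|\nabla \phi|^{2}+\frac{1}{\varepsilon}F(\phi)\Big)dx .$$ *)

theory Defs
  imports "HOL-Analysis.Analysis"
begin

section \<open>Bounded Lipschitz domains\<close>

text \<open>
  Near each boundary point the set is, in a rotated coordinate system with last axis \<open>e\<close>,
  the part of a ball lying strictly below the graph of a Lipschitz function on the hyperplane
  orthogonal to \<open>e\<close>; the point \<open>x - (x \<bullet> e) *\<^sub>R e\<close> is the projection of \<open>x\<close> to this hyperplane.
\<close>

definition lipschitz_boundary :: "'a::euclidean_space set \<Rightarrow> bool" where
  "lipschitz_boundary \<Omega> \<longleftrightarrow>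
     (\<forall>p \<in> frontier \<Omega>. \<exists>e r C g. norm e = 1 \<and> 0 < r \<and>
        C-lipschitz_on {y. y \<bullet> e = 0} (g :: 'a \<Rightarrow> real) \<and>
        \<Omega> \<inter> ball p r = {x \<in> ball p r. x \<bullet> e < g (x - (x \<bullet> e) *\<^sub>R e)})"

definition lipschitz_domain :: "'a::euclidean_space set \<Rightarrow> bool" where
  "lipschitz_domain \<Omega> \<longleftrightarrow>
     open \<Omega> \<and> connected \<Omega> \<and> \<Omega> \<noteq> {} \<and> bounded \<Omega> \<and> lipschitz_boundary \<Omega>"

section \<open>Lebesgue and Sobolev spaces\<close>

text \<open>
  Elements of \<open>L\<^sup>2\<close> and \<open>H\<^sup>1\<close> are represented by functions on the whole space, of which only the
  values on \<open>\<Omega>\<close> up to null sets matter.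
\<close>

definition L2 :: "'a::euclidean_space set \<Rightarrow> ('a \<Rightarrow> 'b::euclidean_space) set" where
  "L2 \<Omega> = {u \<in> borel_measurable (lebesgue_on \<Omega>).
             integrable (lebesgue_on \<Omega>) (\<lambda>x. (norm (u x))\<^sup>2)}"

definition L2_inner ::
    "'a::euclidean_space set \<Rightarrow> ('a \<Rightarrow> 'b::euclidean_space) \<Rightarrow> ('a \<Rightarrow> 'b) \<Rightarrow> real" where
  "L2_inner \<Omega> u v = (\<integral>x. u x \<bullet> v x \<partial>lebesgue_on \<Omega>)"

definition L2_norm :: "'a::euclidean_space set \<Rightarrow> ('a \<Rightarrow> 'b::euclidean_space) \<Rightarrow> real" where
  "L2_norm \<Omega> u = sqrt (L2_inner \<Omega> u u)"

definition average :: "'a::euclidean_space set \<Rightarrow> ('a \<Rightarrow> real) \<Rightarrow> real" where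
  "average \<Omega> u = 1 / measure lebesgue \<Omega> * (\<integral>x. u x \<partial>lebesgue_on \<Omega>)"

definition L2_0 :: "'a::euclidean_space set \<Rightarrow> ('a \<Rightarrow> real) set" where
  "L2_0 \<Omega> = {u \<in> L2 \<Omega>. average \<Omega> u = 0}"

text \<open>
  For first-order weak derivatives, compactly supported \<open>C\<^sup>1\<close> test functions give the same notion
  as compactly supported smooth ones.
\<close>

definition test_function ::
    "'a::euclidean_space set \<Rightarrow> ('a \<Rightarrow> real) \<Rightarrow> ('a \<Rightarrow> 'a) \<Rightarrow> bool" where
  "test_function \<Omega> \<psi> D\<psi> \<longleftrightarrow>
     (\<forall>x. GDERIV \<psi> x :> D\<psi> x) \<and> continuous_on UNIV D\<psi> \<and>
     compact (closure {x. \<psi> x \<noteq> 0}) \<and> closure {x. \<psi> x \<noteq> 0} \<subseteq> \<Omega>"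

definition has_weak_gradient ::
    "'a::euclidean_space set \<Rightarrow> ('a \<Rightarrow> real) \<Rightarrow> ('a \<Rightarrow> 'a) \<Rightarrow> bool" where
  "has_weak_gradient \<Omega> u g \<longleftrightarrow>
     (\<forall>\<psi> D\<psi>. test_function \<Omega> \<psi> D\<psi> \<longrightarrow>
        (\<integral>x. u x *\<^sub>R D\<psi> x \<partial>lebesgue_on \<Omega>) = - (\<integral>x. \<psi> x *\<^sub>R g x \<partial>lebesgue_on \<Omega>))"

definition H1 :: "'a::euclidean_space set \<Rightarrow> ('a \<Rightarrow> real) set" where
  "H1 \<Omega> = {u \<in> L2 \<Omega>. \<exists>g \<in> L2 \<Omega>. has_weak_gradient \<Omega> u g}"

text \<open>The weak gradient is unique up to null sets; one representative is chosen.\<close>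

definition weak_gradient :: "'a::euclidean_space set \<Rightarrow> ('a \<Rightarrow> real) \<Rightarrow> 'a \<Rightarrow> 'a" where
  "weak_gradient \<Omega> u = (SOME g. g \<in> L2 \<Omega> \<and> has_weak_gradient \<Omega> u g)"

section \<open>The Neumann Laplacian and the negative norm\<close>

text \<open>
  The Laplacian with homogeneous Neumann condition is the functional
  \<open>\<langle>\<Delta>u, z\<rangle> = - (\<nabla>u, \<nabla>z)\<close> on \<open>H\<^sup>1\<close>. If \<open>\<Delta>u\<close> is in \<open>L\<^sup>2\<close> and \<open>\<partial>\<^sub>n u = 0\<close>, Green's formula identifies
  this functional with \<open>z \<mapsto> (\<Delta>u, z)\<close>. An equation for \<open>\<Delta>u\<close> with this boundary condition is read
  as an equation between functionals on \<open>H\<^sup>1\<close>, where \<open>v\<close> in \<open>L\<^sup>2\<close> acts as \<open>z \<mapsto> (v, z)\<close>.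
\<close>

definition neumann_laplacian ::
    "'a::euclidean_space set \<Rightarrow> ('a \<Rightarrow> real) \<Rightarrow> ('a \<Rightarrow> real) \<Rightarrow> real" where
  "neumann_laplacian \<Omega> u z = - L2_inner \<Omega> (weak_gradient \<Omega> u) (weak_gradient \<Omega> z)"

text \<open>
  \<open>neg_inv_laplacian \<Omega> v\<close> is \<open>-\<Delta>\<^sup>-\<^sup>1 v\<close>; for \<open>v\<close> in \<open>L2_0 \<Omega>\<close> on a bounded Lipschitz domain the
  solution exists and is unique up to null sets.
\<close>

definition neg_inv_laplacian ::
    "'a::euclidean_space set \<Rightarrow> ('a \<Rightarrow> real) \<Rightarrow> 'a \<Rightarrow> real" where
  "neg_inv_laplacian \<Omega> v =
     (SOME w. w \<in> H1 \<Omega> \<inter> L2_0 \<Omega> \<and>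
        (\<forall>z \<in> H1 \<Omega>. - neumann_laplacian \<Omega> w z = L2_inner \<Omega> v z))"

definition neg_norm :: "'a::euclidean_space set \<Rightarrow> ('a \<Rightarrow> real) \<Rightarrow> real" where
  "neg_norm \<Omega> v = sqrt (L2_inner \<Omega> v (neg_inv_laplacian \<Omega> v))"

section \<open>The SL-BDF2 scheme\<close>

text \<open>\<open>delta_t \<phi> k\<close> is used for \<open>k \<ge> 1\<close> and \<open>delta_tt \<phi> k\<close> for \<open>k \<ge> 2\<close> only.\<close>

definition delta_t :: "(nat \<Rightarrow> 'a \<Rightarrow> real) \<Rightarrow> nat \<Rightarrow> 'a \<Rightarrow> real" where
  "delta_t \<phi> k = (\<lambda>x. \<phi> k x - \<phi> (k - 1) x)"

definition delta_tt :: "(nat \<Rightarrow> 'a \<Rightarrow> real) \<Rightarrow> nat \<Rightarrow> 'a \<Rightarrow> real" where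
  "delta_tt \<phi> k = (\<lambda>x. \<phi> k x - 2 * \<phi> (k - 1) x + \<phi> (k - 2) x)"

definition sl_bdf2_step ::
    "'a::euclidean_space set \<Rightarrow> (real \<Rightarrow> real) \<Rightarrow> real \<Rightarrow> real \<Rightarrow> real \<Rightarrow> real \<Rightarrow> real \<Rightarrow>
     (nat \<Rightarrow> 'a \<Rightarrow> real) \<Rightarrow> (nat \<Rightarrow> 'a \<Rightarrow> real) \<Rightarrow> nat \<Rightarrow> bool" where
  "sl_bdf2_step \<Omega> f \<epsilon> \<gamma> \<tau> A B \<phi> \<mu> n \<longleftrightarrow>
     (\<forall>z \<in> H1 \<Omega>.
        L2_inner \<Omega> (\<lambda>x. (3 * \<phi> (n + 1) x - 4 * \<phi> n x + \<phi> (n - 1) x) / (2 * \<tau>)) z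
          = \<gamma> * neumann_laplacian \<Omega> (\<mu> (n + 1)) z) \<and>
     (\<forall>z \<in> H1 \<Omega>.
        L2_inner \<Omega> (\<mu> (n + 1)) z
          = - \<epsilon> * neumann_laplacian \<Omega> (\<phi> (n + 1)) z
            + 1 / \<epsilon> * L2_inner \<Omega> (\<lambda>x. f (2 * \<phi> n x - \<phi> (n - 1) x)) z
            - A * \<tau> * neumann_laplacian \<Omega> (delta_t \<phi> (n + 1)) z
            + B * L2_inner \<Omega> (delta_tt \<phi> (n + 1)) z)"

definition energy ::
    "'a::euclidean_space set \<Rightarrow> (real \<Rightarrow> real) \<Rightarrow> real \<Rightarrow> ('a \<Rightarrow> real) \<Rightarrow> real" where
  "energy \<Omega> F \<epsilon> u =
     (\<integral>x. \<epsilon> / 2 * (norm (weak_gradient \<Omega> u x))\<^sup>2 + 1 / \<epsilon> * F (u x) \<partial>lebesgue_on \<Omega>)"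

definition energy_B ::
    "'a::euclidean_space set \<Rightarrow> (real \<Rightarrow> real) \<Rightarrow> real \<Rightarrow> real \<Rightarrow> real \<Rightarrow> real \<Rightarrow> real \<Rightarrow>
     (nat \<Rightarrow> 'a \<Rightarrow> real) \<Rightarrow> nat \<Rightarrow> real" where
  "energy_B \<Omega> F \<epsilon> \<gamma> \<tau> L B \<phi> k =
     energy \<Omega> F \<epsilon> (\<phi> k)
     + 1 / (4 * \<tau> * \<gamma>) * (neg_norm \<Omega> (delta_t \<phi> k))\<^sup>2
     + (L / (2 * \<epsilon>) + B / 2) * (L2_norm \<Omega> (delta_t \<phi> k))\<^sup>2"

end

theory Submission
  imports Defs
begin

text \<open>
  The energy law is obtained by testing the two equations of the scheme with two functions. Write
  \<open>D = \<phi>\<^sup>n\<^sup>+\<^sup>1 - \<phi>\<^sup>n\<close>, \<open>d = \<phi>\<^sup>n - \<phi>\<^sup>n\<^sup>-\<^sup>1\<close> and \<open>S = D - d\<close>. The first equation is tested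
  with \<open>-\<Delta>\<^sup>-\<^sup>1 D\<close>, the second with \<open>D\<close>, and \<open>(\<mu>\<^sup>n\<^sup>+\<^sup>1, D)\<close> is eliminated. As
  \<open>3\<phi>\<^sup>n\<^sup>+\<^sup>1 - 4\<phi>\<^sup>n + \<phi>\<^sup>n\<^sup>-\<^sup>1 = 3D - d\<close>, polarization turns all bilinear terms into differences of
  squares. The potential is expanded to second order about the extrapolated value
  \<open>2\<phi>\<^sup>n - \<phi>\<^sup>n\<^sup>-\<^sup>1\<close>, which differs from \<open>\<phi>\<^sup>n\<^sup>+\<^sup>1\<close> by \<open>S\<close> and from \<open>\<phi>\<^sup>n\<close> by \<open>d\<close>
  (\<open>potential_difference\<close>). The square root in the claim comes from the interpolation inequality
  \<open>\<parallel>D\<parallel>\<^sup>2 \<le> \<parallel>D\<parallel>\<^sub>-\<^sub>1 \<parallel>\<nabla>D\<parallel>\<close> and the inequality of arithmetic and geometric means; \<open>energy_balance\<close>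
  collects these facts. Testing the first equation with a constant shows that the mean of \<open>\<phi>\<^sup>k\<close> is
  conserved, so that \<open>D\<close>, \<open>d\<close> and \<open>S\<close> lie in the domain of \<open>\<Delta>\<^sup>-\<^sup>1\<close>.
  
  The analytic substance is that \<open>\<Delta>\<^sup>-\<^sup>1\<close> exists on all square-integrable functions of mean zero; for
  the given increment \<open>\<phi>\<^sup>1 - \<phi>\<^sup>0\<close> no equation of the scheme provides this. The Neumann problem is
  solved by minimizing its Dirichlet energy (\<open>neumann_problem_solvable\<close>): a minimizing sequence is
  Cauchy by the Poincare inequality, and \<open>L\<^sup>2\<close> is complete (\<open>L2_cauchy_converges\<close>).
  
  The Poincare inequality follows from the bound of \<open>u(x + h) - u(x)\<close> by \<open>|h|\<close> times the norm of
  the gradient (\<open>translation_estimate\<close>). Averaging this bound gives the inequality on balls; a piece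
  of the domain at the boundary is pushed down into a ball, because the boundary is a Lipschitz graph;
  finitely many pieces are then chained together, because the domain is connected. Both the
  translation estimate and the uniqueness of weak gradients rest on one duality principle,
  \<open>L2_norm_le_by_duality\<close>: the \<open>L\<^sup>2\<close> norm of a function on an open set is controlled by its pairing
  with \<open>C\<^sup>1\<close> test functions.
\<close>

section \<open>Square-integrable functions\<close>

lemma L2_measurable: "u \<in> L2 Om \<Longrightarrow> u \<in> borel_measurable (lebesgue_on Om)"
  and L2_integrable_square: "u \<in> L2 Om \<Longrightarrow> integrable (lebesgue_on Om) (\<lambda>x. (norm (u x))\<^sup>2)"
  by (auto simp: L2_def)

lemma inner_le_half_sum_squares: "\<bar>a \<bullet> b\<bar> \<le> (norm a)\<^sup>2 / 2 + (norm b)\<^sup>2 / 2"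
proof -
  have "\<bar>a \<bullet> b\<bar> \<le> norm a * norm b" by (rule Cauchy_Schwarz_ineq2)
  moreover have "0 \<le> (norm a - norm b)\<^sup>2" by simp
  ultimately show ?thesis by (simp add: power2_diff)
qed

lemma L2_integrable_inner:
  assumes "u \<in> L2 Om" "v \<in> L2 Om"
  shows "integrable (lebesgue_on Om) (\<lambda>x. u x \<bullet> v x)"
proof (rule Bochner_Integration.integrable_bound)
  show "integrable (lebesgue_on Om) (\<lambda>x. (norm (u x))\<^sup>2 / 2 + (norm (v x))\<^sup>2 / 2)"
    using assms by (intro Bochner_Integration.integrable_add integrable_divide_zero L2_integrable_square) auto
  show "(\<lambda>x. u x \<bullet> v x) \<in> borel_measurable (lebesgue_on Om)"
    using assms by (intro borel_measurable_inner L2_measurable)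
  show "AE x in lebesgue_on Om. norm (u x \<bullet> v x) \<le> norm ((norm (u x))\<^sup>2 / 2 + (norm (v x))\<^sup>2 / 2)"
    by (intro AE_I2) (use inner_le_half_sum_squares in \<open>auto intro: order_trans\<close>)
qed

lemma L2_add:
  assumes "u \<in> L2 Om" "v \<in> L2 Om"
  shows "(\<lambda>x. u x + v x) \<in> L2 Om"
proof -
  have "integrable (lebesgue_on Om) (\<lambda>x. (norm (u x))\<^sup>2 + 2 * (u x \<bullet> v x) + (norm (v x))\<^sup>2)"
    using assms by (intro Bochner_Integration.integrable_add integrable_mult_right L2_integrable_square L2_integrable_inner) auto
  moreover have "(norm (u x + v x))\<^sup>2 = (norm (u x))\<^sup>2 + 2 * (u x \<bullet> v x) + (norm (v x))\<^sup>2" for x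
    by (simp add: power2_norm_eq_inner inner_add_left inner_add_right inner_commute)
  ultimately show ?thesis
    using assms by (simp add: L2_def borel_measurable_add)
qed

lemma L2_scaleR:
  assumes "u \<in> L2 Om"
  shows "(\<lambda>x. c *\<^sub>R u x) \<in> L2 Om"
  using assms by (auto simp: L2_def power_mult_distrib)

lemma L2_mult: "u \<in> L2 Om \<Longrightarrow> (\<lambda>x. c * u x :: real) \<in> L2 Om"
  using L2_scaleR[of u Om c] by simp

lemma L2_diff:
  assumes "u \<in> L2 Om" "v \<in> L2 Om"
  shows "(\<lambda>x. u x - v x) \<in> L2 Om"
  using L2_add[OF assms(1) L2_scaleR[OF assms(2), of "-1"]] by simp

lemma L2_inner_commute: "L2_inner Om u v = L2_inner Om v u"
  by (simp add: L2_inner_def inner_commute)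

lemma L2_inner_add_left:
  assumes "u \<in> L2 Om" "v \<in> L2 Om" "w \<in> L2 Om"
  shows "L2_inner Om (\<lambda>x. u x + v x) w = L2_inner Om u w + L2_inner Om v w"
  using assms by (simp add: L2_inner_def inner_add_left L2_integrable_inner)

lemma L2_inner_diff_left:
  assumes "u \<in> L2 Om" "v \<in> L2 Om" "w \<in> L2 Om"
  shows "L2_inner Om (\<lambda>x. u x - v x) w = L2_inner Om u w - L2_inner Om v w"
  using assms by (simp add: L2_inner_def inner_diff_left L2_integrable_inner)

lemma L2_inner_scaleR_left: "L2_inner Om (\<lambda>x. c *\<^sub>R u x) w = c * L2_inner Om u w"
  by (simp add: L2_inner_def)

lemma L2_inner_mult_left: "L2_inner Om (\<lambda>x. c * u x) w = c * L2_inner Om u (w :: _ \<Rightarrow> real)"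
  using L2_inner_scaleR_left[of Om c u w] by simp

lemma L2_inner_add_right:
  assumes "u \<in> L2 Om" "v \<in> L2 Om" "w \<in> L2 Om"
  shows "L2_inner Om w (\<lambda>x. u x + v x) = L2_inner Om w u + L2_inner Om w v"
  using L2_inner_add_left[OF assms] by (simp add: L2_inner_commute)

lemma L2_inner_diff_right:
  assumes "u \<in> L2 Om" "v \<in> L2 Om" "w \<in> L2 Om"
  shows "L2_inner Om w (\<lambda>x. u x - v x) = L2_inner Om w u - L2_inner Om w v"
  using L2_inner_diff_left[OF assms] by (simp add: L2_inner_commute)

lemma L2_inner_scaleR_right: "L2_inner Om w (\<lambda>x. c *\<^sub>R u x) = c * L2_inner Om w u"
  using L2_inner_scaleR_left[of Om c u w] by (simp add: L2_inner_commute)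

lemma L2_inner_cong_AE:
  assumes "AE x in lebesgue_on Om. u x = u' x" "AE x in lebesgue_on Om. v x = v' x"
    and "u \<in> L2 Om" "u' \<in> L2 Om" "v \<in> L2 Om" "v' \<in> L2 Om"
  shows "L2_inner Om u v = L2_inner Om u' v'"
  unfolding L2_inner_def
proof (rule integral_cong_AE)
  show "AE x in lebesgue_on Om. u x \<bullet> v x = u' x \<bullet> v' x"
    using assms(1,2) by eventually_elim simp
qed (use assms in \<open>blast intro: borel_measurable_inner L2_measurable\<close>)+

lemma L2_inner_self_nonneg: "0 \<le> L2_inner Om u u"
  by (simp add: L2_inner_def)

lemma L2_norm_square: "(L2_norm Om u)\<^sup>2 = L2_inner Om u u"
  by (simp add: L2_norm_def L2_inner_self_nonneg)

lemma L2_norm_nonneg: "0 \<le> L2_norm Om u"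
  by (simp add: L2_norm_def L2_inner_self_nonneg)

text \<open>
  Besides the Cauchy-Schwarz inequality this gives first-order optimality conditions: for \<open>a = 0\<close> it
  forces the linear coefficient to vanish.
\<close>

lemma nonneg_quadratic_discriminant:
  fixes a b c :: real
  assumes "\<And>t. 0 \<le> a + 2 * t * b + t\<^sup>2 * c" and "0 \<le> a" "0 \<le> c"
  shows "b\<^sup>2 \<le> a * c"
proof (cases "c = 0")
  case True
  have "b = 0"
  proof (rule ccontr)
    assume "b \<noteq> 0"
    with assms(1)[of "-(a + 1) / (2 * b)"] True show False by (simp add: field_simps)
  qed
  with True show ?thesis by simp
next
  case False
  with assms(1)[of "- b / c"] assms(3) show ?thesis
    by (simp add: field_simps power2_eq_square)
qed

lemma L2_inner_expand:
  assumes "u \<in> L2 Om" "v \<in> L2 Om"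
  shows "L2_inner Om (\<lambda>x. u x + t *\<^sub>R v x) (\<lambda>x. u x + t *\<^sub>R v x)
    = L2_inner Om u u + 2 * t * L2_inner Om u v + t\<^sup>2 * L2_inner Om v v"
proof -
  have tv: "(\<lambda>x. t *\<^sub>R v x) \<in> L2 Om" by (rule L2_scaleR[OF assms(2)])
  show ?thesis
    by (simp add: L2_inner_add_left L2_inner_add_right L2_add assms tv L2_inner_scaleR_left
        L2_inner_scaleR_right L2_inner_commute[of _ v u] power2_eq_square algebra_simps)
qed

lemma L2_Cauchy_Schwarz_square:
  assumes "u \<in> L2 Om" "v \<in> L2 Om"
  shows "(L2_inner Om u v)\<^sup>2 \<le> L2_inner Om u u * L2_inner Om v v"
  by (rule nonneg_quadratic_discriminant)
    (use L2_inner_self_nonneg L2_inner_expand[OF assms, symmetric] in auto)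

lemma L2_Cauchy_Schwarz:
  assumes "u \<in> L2 Om" "v \<in> L2 Om"
  shows "\<bar>L2_inner Om u v\<bar> \<le> L2_norm Om u * L2_norm Om v"
  using L2_Cauchy_Schwarz_square[OF assms]
  by (metis L2_norm_def real_sqrt_abs real_sqrt_le_iff real_sqrt_mult)

lemma L2_const:
  fixes c :: "'b::euclidean_space"
  assumes "open Om" "bounded Om"
  shows "(\<lambda>x::'a::euclidean_space. c) \<in> L2 Om"
proof -
  interpret finite_measure "lebesgue_on Om"
    using assms by (intro finite_measure_lebesgue_on lmeasurable_open)
  show ?thesis by (simp add: L2_def)
qed

lemma L2_integrable:
  assumes "open Om" "bounded Om" "u \<in> L2 Om"
  shows "integrable (lebesgue_on Om) u"
proof -
  interpret finite_measure "lebesgue_on Om"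
    using assms by (intro finite_measure_lebesgue_on lmeasurable_open)
  show ?thesis
  proof (rule Bochner_Integration.integrable_bound)
    show "integrable (lebesgue_on Om) (\<lambda>x. 1 + (norm (u x))\<^sup>2)"
      using assms by (intro Bochner_Integration.integrable_add L2_integrable_square) auto
    have "norm y \<le> 1 + (norm y)\<^sup>2" for y :: 'b
    proof -
      have "norm y \<le> (norm y)\<^sup>2 / 2 + 1 / 2"
        using inner_le_half_sum_squares[of "norm y" 1] by simp
      moreover have "0 \<le> (norm y)\<^sup>2" by simp
      ultimately show ?thesis by linarith
    qed
    then show "AE x in lebesgue_on Om. norm (u x) \<le> norm (1 + (norm (u x))\<^sup>2)"
      by simp
  qed (use assms L2_measurable in auto)
qed

text \<open>
  The theorem of Riesz and Fischer. On a set of finite measure the \<open>L\<^sup>2\<close> norm dominates the \<open>L\<^sup>1\<close>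
  norm, so along a fast subsequence the increments are absolutely summable almost everywhere. Fatou's
  lemma shows that the whole sequence tends to this pointwise limit in norm.
\<close>

lemma L2_cauchy_converges:
  fixes u :: "nat \<Rightarrow> 'a::euclidean_space \<Rightarrow> 'b::euclidean_space"
  assumes Om: "open Om" "bounded Om" and u: "\<And>n. u n \<in> L2 Om"
    and cauchy: "\<And>e. 0 < e \<Longrightarrow> \<exists>N. \<forall>m\<ge>N. \<forall>n\<ge>N. L2_norm Om (\<lambda>x. u m x - u n x) < e"
  shows "\<exists>w \<in> L2 Om. (\<lambda>n. L2_norm Om (\<lambda>x. u n x - w x)) \<longlonglongrightarrow> 0"
proof -
  let ?M = "lebesgue_on Om"
  interpret finite_measure ?M
    using Om by (intro finite_measure_lebesgue_on lmeasurable_open)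
  note [measurable] = L2_measurable[OF u]
  define K where "K e = (SOME N. \<forall>m\<ge>N. \<forall>n\<ge>N. L2_norm Om (\<lambda>x. u m x - u n x) < e)" for e
  have K: "L2_norm Om (\<lambda>x. u m x - u n x) < e" if "0 < e" "m \<ge> K e" "n \<ge> K e" for m n e
    using someI_ex[OF cauchy[OF \<open>0 < e\<close>]] that unfolding K_def by blast
  \<comment> \<open>The summand \<open>k\<close> makes \<open>s\<close> tend to infinity even if the sum of the \<open>K\<close> stays bounded.\<close>
  define s where "s k = (\<Sum>i\<le>k. K ((1/2)^i)) + k" for k :: nat
  have s_ge: "K ((1/2)^k) \<le> s k" for k
  proof -
    have "K ((1/2)^k) \<le> (\<Sum>i\<le>k. K ((1/2)^i))" by (rule member_le_sum) auto
    then show ?thesis by (simp add: s_def)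
  qed
  have s_suc: "s k \<le> s (Suc k)" for k by (simp add: s_def)
  define d where "d k x = u (s (Suc k)) x - u (s k) x" for k x
  have d_L2: "d k \<in> L2 Om" for k unfolding d_def by (intro L2_diff u)
  have dn_L2: "(\<lambda>x. norm (d k x)) \<in> L2 Om" for k
    using d_L2[of k] by (auto simp: L2_def)
  define c where "c = L2_norm Om (\<lambda>x::'a. 1::real)"
  have d_int: "(\<integral>x. norm (d k x) \<partial>?M) \<le> c * (1/2)^k" for k
  proof -
    have "(\<integral>x. norm (d k x) \<partial>?M) = L2_inner Om (\<lambda>x. norm (d k x)) (\<lambda>x. 1)"
      by (simp add: L2_inner_def)
    also have "\<dots> \<le> L2_norm Om (\<lambda>x. norm (d k x)) * c"
      unfolding c_def using L2_Cauchy_Schwarz[OF dn_L2 L2_const[OF Om]] by (rule abs_le_D1)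
    also have "L2_norm Om (\<lambda>x. norm (d k x)) = L2_norm Om (d k)"
      by (simp add: L2_norm_def L2_inner_def power2_norm_eq_inner flip: power2_eq_square)
    also have "\<dots> \<le> (1/2)^k"
      unfolding d_def using K[of "(1/2)^k" "s (Suc k)" "s k"] s_ge[of k] s_suc[of k] by fastforce
    finally show ?thesis by (simp add: mult.commute c_def L2_norm_nonneg mult_left_mono mult_right_mono)
  qed
  have "(\<integral>\<^sup>+x. (\<Sum>k. ennreal (norm (d k x))) \<partial>?M) = (\<Sum>k. \<integral>\<^sup>+x. ennreal (norm (d k x)) \<partial>?M)"
    unfolding d_def by (intro nn_integral_suminf) simp
  also have "\<dots> \<le> (\<Sum>k. ennreal (c * (1/2)^k))"
  proof (rule suminf_le)
    show "(\<integral>\<^sup>+x. ennreal (norm (d k x)) \<partial>?M) \<le> ennreal (c * (1/2)^k)" for k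
      using d_int[of k] L2_integrable[OF Om dn_L2[of k]]
      by (simp add: nn_integral_eq_integral ennreal_leI)
  qed auto
  also have "\<dots> < \<infinity>"
    by (subst suminf_ennreal2) (auto simp: c_def L2_norm_nonneg intro!: summable_mult summable_geometric)
  finally have "AE x in ?M. (\<Sum>k. ennreal (norm (d k x))) \<noteq> \<infinity>"
    by (intro nn_integral_PInf_AE) (auto simp: d_def)
  then have conv: "AE x in ?M. convergent (\<lambda>k. u (s k) x)"
  proof eventually_elim
    case (elim x)
    then have "summable (\<lambda>k. norm (d k x))"
      using summable_suminf_not_top[of "\<lambda>k. norm (d k x)"] by auto
    then have "summable (\<lambda>k. d k x)" by (rule summable_norm_cancel)
    then have "convergent (\<lambda>n. \<Sum>k<n. d k x)" by (simp add: summable_iff_convergent)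
    moreover have "(\<Sum>k<n. d k x) = u (s n) x - u (s 0) x" for n
      unfolding d_def by (rule sum_lessThan_telescope)
    ultimately have "convergent (\<lambda>n. u (s n) x - u (s 0) x)" by simp
    from convergent_add[OF this convergent_const[of "u (s 0) x"]] show ?case by simp
  qed
  define w where "w x = lim (\<lambda>k. u (s k) x)" for x
  have w_meas[measurable]: "w \<in> borel_measurable ?M"
    unfolding w_def by measurable
  have w_lim: "AE x in ?M. (\<lambda>k. u (s k) x) \<longlonglongrightarrow> w x"
    using conv by eventually_elim (simp add: w_def convergent_LIMSEQ_iff)
  have nn_eq: "(\<integral>\<^sup>+x. ennreal ((norm (v x))\<^sup>2) \<partial>?M) = ennreal ((L2_norm Om v)\<^sup>2)"
    if "v \<in> L2 Om" for v :: "'a \<Rightarrow> 'b"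
    unfolding L2_norm_square L2_inner_def
    using L2_integrable_square[OF that]
    by (subst nn_integral_eq_integral) (auto simp: power2_norm_eq_inner)
  have close: "(\<integral>\<^sup>+x. ennreal ((norm (u n x - w x))\<^sup>2) \<partial>?M) \<le> ennreal (e\<^sup>2)"
    if "0 < e" "n \<ge> K e" for e n
  proof -
    have "(\<integral>\<^sup>+x. ennreal ((norm (u n x - w x))\<^sup>2) \<partial>?M)
        = (\<integral>\<^sup>+x. liminf (\<lambda>k. ennreal ((norm (u n x - u (s k) x))\<^sup>2)) \<partial>?M)"
    proof (rule nn_integral_cong_AE)
      show "AE x in ?M. ennreal ((norm (u n x - w x))\<^sup>2) = liminf (\<lambda>k. ennreal ((norm (u n x - u (s k) x))\<^sup>2))"
        using w_lim
      proof eventually_elim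
        case (elim x)
        then have "(\<lambda>k. ennreal ((norm (u n x - u (s k) x))\<^sup>2)) \<longlonglongrightarrow> ennreal ((norm (u n x - w x))\<^sup>2)"
          by (intro tendsto_ennrealI tendsto_intros)
        then show ?case by (intro lim_imp_Liminf[symmetric]) auto
      qed
    qed
    also have "\<dots> \<le> liminf (\<lambda>k. \<integral>\<^sup>+x. ennreal ((norm (u n x - u (s k) x))\<^sup>2) \<partial>?M)"
      by (intro nn_integral_liminf) simp
    also have "\<dots> \<le> ennreal (e\<^sup>2)"
    proof (rule Liminf_le)
      show "\<forall>\<^sub>F k in sequentially. (\<integral>\<^sup>+x. ennreal ((norm (u n x - u (s k) x))\<^sup>2) \<partial>?M) \<le> ennreal (e\<^sup>2)"
        using eventually_ge_at_top[of "K e"]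
      proof eventually_elim
        case (elim k)
        have "k \<le> s k" by (simp add: s_def)
        with elim have "L2_norm Om (\<lambda>x. u n x - u (s k) x) < e" by (intro K that) auto
        then show ?case
          using nn_eq[OF L2_diff[OF u u]] by (simp add: L2_norm_nonneg power_mono)
      qed
    qed simp
    finally show ?thesis .
  qed
  have diff_L2: "(\<lambda>x. u n x - w x) \<in> L2 Om" if "0 < e" "n \<ge> K e" for n e
  proof -
    have "(\<integral>\<^sup>+x. ennreal ((norm (u n x - w x))\<^sup>2) \<partial>?M) < \<infinity>"
      using close[OF that] by (rule order_le_less_trans) simp
    then show ?thesis by (simp add: L2_def integrable_iff_bounded)
  qed
  have w_L2: "w \<in> L2 Om"
    using L2_diff[OF u[of "K 1"] diff_L2[of 1 "K 1"]] by simp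
  have "(\<lambda>n. L2_norm Om (\<lambda>x. u n x - w x)) \<longlonglongrightarrow> 0"
  proof (rule LIMSEQ_I)
    fix e :: real assume "0 < e"
    then have e: "0 < e / 2" by simp
    show "\<exists>N. \<forall>n\<ge>N. norm (L2_norm Om (\<lambda>x. u n x - w x) - 0) < e"
    proof (intro exI allI impI)
      fix n assume n: "K (e/2) \<le> n"
      have "(L2_norm Om (\<lambda>x. u n x - w x))\<^sup>2 \<le> (e/2)\<^sup>2"
        using close[OF e n] unfolding nn_eq[OF diff_L2[OF e n]]
        by (subst (asm) ennreal_le_iff) (rule zero_le_power2)
      then have "L2_norm Om (\<lambda>x. u n x - w x) \<le> e/2"
        by (rule power2_le_imp_le) (use e in simp)
      with e show "norm (L2_norm Om (\<lambda>x. u n x - w x) - 0) < e"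
        by (simp add: L2_norm_nonneg)
    qed
  qed
  with w_L2 show ?thesis by blast
qed

lemma L2_inner_tendsto:
  assumes u: "\<And>n. u n \<in> L2 Om" "w \<in> L2 Om" "v \<in> L2 Om"
    and lim: "(\<lambda>n. L2_norm Om (\<lambda>x. u n x - w x)) \<longlonglongrightarrow> 0"
  shows "(\<lambda>n. L2_inner Om (u n) v) \<longlonglongrightarrow> L2_inner Om w v"
proof (rule LIM_zero_cancel, rule tendsto_0_le)
  show "(\<lambda>n. L2_norm Om (\<lambda>x. u n x - w x) * L2_norm Om v) \<longlonglongrightarrow> 0"
    using tendsto_mult_right[OF lim, of "L2_norm Om v"] by simp
  have "\<bar>L2_inner Om (u n) v - L2_inner Om w v\<bar> \<le> L2_norm Om (\<lambda>x. u n x - w x) * L2_norm Om v" for n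
    using L2_Cauchy_Schwarz[OF L2_diff[OF u(1,2)] u(3)] by (simp add: L2_inner_diff_left u)
  then show "\<forall>\<^sub>F n in sequentially. norm (L2_inner Om (u n) v - L2_inner Om w v)
      \<le> norm (L2_norm Om (\<lambda>x. u n x - w x) * L2_norm Om v) * 1"
    by (intro always_eventually allI) (simp add: L2_norm_nonneg)
qed

section \<open>Test functions\<close>

definition C1_function :: "('a::euclidean_space \<Rightarrow> real) \<Rightarrow> bool" where
  "C1_function \<psi> \<longleftrightarrow> (\<exists>D\<psi>. (\<forall>x. GDERIV \<psi> x :> D\<psi> x) \<and> continuous_on UNIV D\<psi>)"

lemma C1_functionI:
  "(\<And>x. GDERIV \<psi> x :> D\<psi> x) \<Longrightarrow> continuous_on UNIV D\<psi> \<Longrightarrow> C1_function \<psi>"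
  unfolding C1_function_def by blast

lemma GDERIV_continuous_on:
  assumes "\<And>x. GDERIV \<psi> x :> D\<psi> x"
  shows "continuous_on S \<psi>"
  using assms unfolding gderiv_def
  by (intro continuous_at_imp_continuous_on ballI) (blast intro: has_derivative_continuous)

lemma C1_function_continuous: "C1_function \<psi> \<Longrightarrow> continuous_on S \<psi>"
  unfolding C1_function_def by (blast intro: GDERIV_continuous_on)

lemma C1_function_const: "C1_function (\<lambda>x. c)"
  unfolding C1_function_def by (intro exI[of _ "\<lambda>x. 0"]) (auto intro: GDERIV_const)

lemma C1_function_add:
  assumes "C1_function f" "C1_function g" shows "C1_function (\<lambda>x. f x + g x)"
proof -
  obtain Df Dg where "\<And>x. GDERIV f x :> Df x" "continuous_on UNIV Df"
    "\<And>x. GDERIV g x :> Dg x" "continuous_on UNIV Dg"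
    using assms unfolding C1_function_def by blast
  then show ?thesis unfolding C1_function_def
    by (intro exI[of _ "\<lambda>x. Df x + Dg x"]) (auto intro: GDERIV_add continuous_intros)
qed

lemma C1_function_mult:
  assumes "C1_function f" "C1_function g" shows "C1_function (\<lambda>x. f x * g x)"
proof -
  obtain Df Dg where D: "\<And>x. GDERIV f x :> Df x" "continuous_on UNIV Df"
    "\<And>x. GDERIV g x :> Dg x" "continuous_on UNIV Dg"
    using assms unfolding C1_function_def by blast
  have "GDERIV (\<lambda>x. f x * g x) x :> f x *\<^sub>R Dg x + g x *\<^sub>R Df x" for x
    by (intro GDERIV_mult D)
  moreover have "continuous_on UNIV (\<lambda>x. f x *\<^sub>R Dg x + g x *\<^sub>R Df x)"
    by (intro continuous_intros D C1_function_continuous assms)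
  ultimately show ?thesis by (rule C1_functionI)
qed

lemma C1_function_sum:
  "finite I \<Longrightarrow> (\<And>i. i \<in> I \<Longrightarrow> C1_function (f i)) \<Longrightarrow> C1_function (\<lambda>x. \<Sum>i\<in>I. f i x)"
  by (induction I rule: finite_induct) (auto intro: C1_function_const C1_function_add)

lemma C1_function_compose:
  assumes f: "C1_function f" and g: "\<And>x. (g has_real_derivative g' (f x)) (at (f x))"
    and g': "continuous_on (range f) g'"
  shows "C1_function (\<lambda>x. g (f x))"
proof -
  obtain Df where D: "\<And>x. GDERIV f x :> Df x" "continuous_on UNIV Df"
    using f unfolding C1_function_def by blast
  have "GDERIV (\<lambda>x. g (f x)) x :> g' (f x) *\<^sub>R Df x" for x
    by (rule GDERIV_DERIV_compose[OF D(1) g])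
  moreover have "continuous_on UNIV (\<lambda>x. g' (f x) *\<^sub>R Df x)"
    by (intro continuous_intros D continuous_on_compose2[OF g'] C1_function_continuous f) auto
  ultimately show ?thesis by (rule C1_functionI)
qed

lemma C1_function_polynomial:
  fixes p :: "'a::euclidean_space \<Rightarrow> real"
  shows "real_polynomial_function p \<Longrightarrow> C1_function p"
proof (induction rule: real_polynomial_function.induct)
  case (linear f)
  have "f h = h \<bullet> adjoint f 1" for h
    using adjoint_works[OF bounded_linear.linear[OF linear], of h 1] by simp
  then have "f = (\<lambda>h. h \<bullet> adjoint f 1)" by blast
  then have "GDERIV f x :> adjoint f 1" for x
    using bounded_linear_imp_has_derivative[OF linear, of "at x"] unfolding gderiv_def by simp
  then show ?case unfolding C1_function_def by (intro exI[of _ "\<lambda>_. adjoint f 1"]) auto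
qed (auto intro: C1_function_const C1_function_add C1_function_mult)

text \<open>
  Squaring smooths the corner of the positive part: the derivative is continuous, which makes \<open>bump\<close>
  below a function of class \<open>C\<^sup>1\<close>.
\<close>

lemma has_derivative_max_0_square:
  "((\<lambda>s::real. (max 0 s)\<^sup>2) has_real_derivative 2 * max 0 s) (at s)"
proof -
  consider "s < 0" | "s = 0" | "0 < s" by linarith
  then show ?thesis
  proof cases
    case 1
    have "((\<lambda>s::real. (max 0 s)\<^sup>2) has_real_derivative 0) (at s)"
      by (rule has_field_derivative_transform_within_open[where f = "\<lambda>_. 0" and S = "{..<0}"])
        (use 1 in auto)
    with 1 show ?thesis by simp
  next
    case 2
    have "(\<lambda>h::real. ((max 0 (0 + h))\<^sup>2 - (max 0 0)\<^sup>2) / h) \<midarrow>0\<rightarrow> 0"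
    proof (rule tendsto_0_le[where K = 1])
      show "((\<lambda>h::real. h) \<longlongrightarrow> 0) (at 0)" by (rule tendsto_ident_at)
      show "\<forall>\<^sub>F h::real in at 0. norm (((max 0 (0 + h))\<^sup>2 - (max 0 0)\<^sup>2) / h) \<le> norm h * 1"
        by (intro always_eventually allI) (auto simp: max_def power2_eq_square)
    qed
    with 2 show ?thesis by (simp add: DERIV_def)
  next
    case 3
    have "((\<lambda>s::real. (max 0 s)\<^sup>2) has_real_derivative 2 * s) (at s)"
    proof (rule has_field_derivative_transform_within_open[where f = "\<lambda>s. s\<^sup>2" and S = "{0<..}"])
      show "((\<lambda>s::real. s\<^sup>2) has_real_derivative 2 * s) (at s)"
        by (auto intro!: derivative_eq_intros)
    qed (use 3 in auto)
    with 3 show ?thesis by simp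
  qed
qed

definition bump :: "'a::euclidean_space \<Rightarrow> real \<Rightarrow> 'a \<Rightarrow> real" where
  "bump c r x = (max 0 (r\<^sup>2 - (norm (x - c))\<^sup>2))\<^sup>2"

lemma bump_C1: "C1_function (bump c r)"
proof -
  have "GDERIV (\<lambda>x. r\<^sup>2 - (norm (x - c))\<^sup>2) x :> - (2 *\<^sub>R (x - c))" for x
    unfolding gderiv_def power2_norm_eq_inner
    by (auto intro!: derivative_eq_intros simp: inner_commute algebra_simps)
  then have "C1_function (\<lambda>x. r\<^sup>2 - (norm (x - c))\<^sup>2)"
    unfolding C1_function_def
    by (intro exI[of _ "\<lambda>x. - (2 *\<^sub>R (x - c))"]) (auto intro!: continuous_intros)
  then have "C1_function (\<lambda>x. (max 0 (r\<^sup>2 - (norm (x - c))\<^sup>2))\<^sup>2)"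
    by (rule C1_function_compose[where g = "\<lambda>s. (max 0 s)\<^sup>2" and g' = "\<lambda>s. 2 * max 0 s",
          OF _ has_derivative_max_0_square]) (intro continuous_intros)
  then show ?thesis unfolding bump_def .
qed

lemma bump_nonneg: "0 \<le> bump c r x"
  by (simp add: bump_def)

lemma bump_pos: "x \<in> ball c r \<Longrightarrow> 0 < bump c r x"
proof -
  assume "x \<in> ball c r"
  then have "(norm (x - c))\<^sup>2 < r\<^sup>2"
    by (intro power_strict_mono) (auto simp: dist_norm norm_minus_commute)
  then show ?thesis by (simp add: bump_def)
qed

lemma bump_zero: "0 \<le> r \<Longrightarrow> x \<notin> cball c r \<Longrightarrow> bump c r x = 0"
  by (auto simp: bump_def dist_norm norm_minus_commute max_def intro: power_mono)

lemma test_functionI: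
  assumes "\<And>x. GDERIV \<psi> x :> D\<psi> x" "continuous_on UNIV D\<psi>"
    and K: "compact K" "K \<subseteq> V" "\<And>x. x \<notin> K \<Longrightarrow> \<psi> x = 0"
  shows "test_function V \<psi> D\<psi>"
proof -
  have "{x. \<psi> x \<noteq> 0} \<subseteq> K" using K(3) by blast
  then have "closure {x. \<psi> x \<noteq> 0} \<subseteq> K" "bounded {x. \<psi> x \<noteq> 0}"
    using K(1) closure_minimal compact_imp_closed bounded_subset compact_imp_bounded by metis+
  with assms show ?thesis unfolding test_function_def by auto
qed

text \<open>
  If \<open>s m\<close> is the sum of the first \<open>m\<close> bumps over a countable cover of \<open>V\<close> by balls, every point of
  \<open>V\<close> is eventually in the support. The quotient \<open>m * s m / (1 + m * s m)\<close> has the same support,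
  values in the unit interval, and the limit 1 on \<open>V\<close>.
\<close>

lemma C1_exhaustion:
  fixes V :: "'a::euclidean_space set"
  assumes "open V"
  obtains \<eta> :: "nat \<Rightarrow> 'a \<Rightarrow> real" where
    "\<And>m. C1_function (\<eta> m)" "\<And>m. \<exists>K. compact K \<and> K \<subseteq> V \<and> (\<forall>x. x \<notin> K \<longrightarrow> \<eta> m x = 0)"
    "\<And>m x. 0 \<le> \<eta> m x" "\<And>m x. \<eta> m x \<le> 1" "\<And>x. x \<in> V \<Longrightarrow> (\<lambda>m. \<eta> m x) \<longlonglongrightarrow> 1"
proof (cases "V = {}")
  case True
  show ?thesis
    by (rule that[of "\<lambda>_ _. 0"]) (auto simp: True intro: C1_function_const)
next
  case False
  define \<F> where "\<F> = {B. \<exists>c r. 0 < r \<and> B = ball c r \<and> cball c r \<subseteq> V}"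
  have "open B" if "B \<in> \<F>" for B using that by (auto simp: \<F>_def)
  from Lindelof[OF this] obtain \<F>' where F': "\<F>' \<subseteq> \<F>" "countable \<F>'" "\<Union>\<F>' = \<Union>\<F>"
    by blast
  have "\<Union>\<F> = V"
  proof
    show "\<Union>\<F> \<subseteq> V" using ball_subset_cball by (fastforce simp: \<F>_def)
    show "V \<subseteq> \<Union>\<F>"
    proof
      fix x assume "x \<in> V"
      then obtain r where "0 < r" "cball x r \<subseteq> V"
        using \<open>open V\<close> open_contains_cball by blast
      then show "x \<in> \<Union>\<F>" unfolding \<F>_def by (auto intro!: exI[of _ "ball x r"])
    qed
  qed
  with F' False have ne: "\<F>' \<noteq> {}" by auto
  define B where "B = from_nat_into \<F>'"
  have range_B: "range B = \<F>'" unfolding B_def by (rule range_from_nat_into[OF ne F'(2)])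
  then have "\<forall>i. \<exists>c r. 0 < r \<and> B i = ball c r \<and> cball c r \<subseteq> V"
    using F'(1) unfolding \<F>_def by blast
  then obtain c r where cr: "\<And>i. 0 < r i" "\<And>i. B i = ball (c i) (r i)" "\<And>i. cball (c i) (r i) \<subseteq> V"
    by metis
  define s where "s m x = (\<Sum>i<m. bump (c i) (r i) x)" for m and x :: 'a
  have s_nonneg: "0 \<le> s m x" for m x unfolding s_def by (intro sum_nonneg bump_nonneg)
  have s_C1: "C1_function (s m)" for m unfolding s_def by (intro C1_function_sum bump_C1) simp
  have one_pos: "1 \<le> 1 + real m * s m x" for m x using s_nonneg by simp
  \<comment> \<open>This is \<open>m * s m x / (1 + m * s m x)\<close>.\<close>
  define \<eta> where "\<eta> m x = 1 + - 1 * inverse (1 + real m * s m x)" for m and x :: 'a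
  show ?thesis
  proof (rule that[of \<eta>])
    fix m
    have c1: "C1_function (\<lambda>x. 1 + real m * s m x)"
      by (intro C1_function_add C1_function_mult C1_function_const s_C1)
    have "C1_function (\<lambda>x. inverse (1 + real m * s m x))"
    proof (rule C1_function_compose[OF c1, of inverse "\<lambda>y. - (inverse y ^ Suc (Suc 0))"])
      have nz: "1 + real m * s m x \<noteq> 0" for x using one_pos[of m x] by linarith
      show "(inverse has_real_derivative - (inverse (1 + real m * s m x) ^ Suc (Suc 0))) (at (1 + real m * s m x))" for x
        by (rule DERIV_inverse[OF nz])
      show "continuous_on (range (\<lambda>x. 1 + real m * s m x)) (\<lambda>y. - (inverse y ^ Suc (Suc 0)))"
        using nz by (intro continuous_intros) auto
    qed
    then show "C1_function (\<eta> m)" unfolding \<eta>_def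
      by (intro C1_function_add C1_function_mult C1_function_const)
    have "compact (\<Union>i<m. cball (c i) (r i))" "(\<Union>i<m. cball (c i) (r i)) \<subseteq> V"
      using cr(3) by auto
    moreover have "\<eta> m x = 0" if "x \<notin> (\<Union>i<m. cball (c i) (r i))" for x
    proof -
      have "bump (c i) (r i) x = 0" if "i < m" for i
        using that \<open>x \<notin> _\<close> cr(1)[of i] by (intro bump_zero) auto
      then have "s m x = 0" by (simp add: s_def)
      then show ?thesis by (simp add: \<eta>_def)
    qed
    ultimately show "\<exists>K. compact K \<and> K \<subseteq> V \<and> (\<forall>x. x \<notin> K \<longrightarrow> \<eta> m x = 0)" by blast
    show "0 \<le> \<eta> m x" for x
      using one_pos[of m x] by (simp add: \<eta>_def inverse_le_1_iff)
    show "\<eta> m x \<le> 1" for x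
      using one_pos[of m x] by (simp add: \<eta>_def)
  next
    fix x assume "x \<in> V"
    then obtain i where "x \<in> B i"
      using \<open>\<Union>\<F> = V\<close> F'(3) range_B by blast
    then have pos: "0 < bump (c i) (r i) x" using cr(2) bump_pos by auto
    have "filterlim (\<lambda>m. 1 + real m * s m x) at_top sequentially"
    proof (rule filterlim_at_top_mono)
      show "filterlim (\<lambda>m. real m * bump (c i) (r i) x) at_top sequentially"
        by (intro filterlim_at_top_mult_tendsto_pos[OF tendsto_const pos] filterlim_real_sequentially)
      show "\<forall>\<^sub>F m in sequentially. real m * bump (c i) (r i) x \<le> 1 + real m * s m x"
        using eventually_gt_at_top[of i]
      proof eventually_elim
        case (elim m)
        have "bump (c i) (r i) x \<le> s m x"
          unfolding s_def using elim by (intro member_le_sum bump_nonneg) auto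
        then have "real m * bump (c i) (r i) x \<le> real m * s m x" by (simp add: mult_left_mono)
        then show ?case by linarith
      qed
    qed
    then have "(\<lambda>m. inverse (1 + real m * s m x)) \<longlonglongrightarrow> 0"
      by (rule filterlim_compose[OF tendsto_inverse_0_at_top[OF filterlim_ident]])
    from tendsto_add[OF tendsto_const tendsto_mult[OF tendsto_const this], of 1 "-1"]
    show "(\<lambda>m. \<eta> m x) \<longlonglongrightarrow> 1" unfolding \<eta>_def by simp
  qed
qed

section \<open>Norms by duality with test functions\<close>

definition clip :: "real \<Rightarrow> real \<Rightarrow> real" where
  "clip k y = max (- k) (min k y)"

lemma clip_measurable [measurable]: "clip k \<in> borel_measurable borel"
  unfolding clip_def by measurable

lemma square_le_mult_clip: "0 \<le> k \<Longrightarrow> (clip k y)\<^sup>2 \<le> y * clip k y"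
proof -
  assume k: "0 \<le> k"
  have "0 \<le> (y - clip k y) * clip k y"
    using k unfolding clip_def by (cases "y \<le> -k"; cases "y \<le> k") (auto simp: max_def min_def mult_nonpos_nonpos intro!: mult_nonpos_nonpos mult_nonneg_nonneg)
  then show ?thesis by (simp add: power2_eq_square algebra_simps)
qed

lemma integrable_indicator_compact:
  "compact K \<Longrightarrow> integrable lborel (indicator K :: 'a::euclidean_space \<Rightarrow> real)"
  using emeasure_compact_finite by (intro integrable_real_indicator) (auto simp: borel_compact)

lemma integrable_mult_bounded_support:
  fixes w :: "'a::euclidean_space \<Rightarrow> real"
  assumes [measurable]: "w \<in> borel_measurable borel" and "integrable lborel (\<lambda>x. (w x)\<^sup>2)"
    and "compact K"
  shows "integrable lborel (\<lambda>x. \<bar>w x\<bar> * (b * indicator K x))"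
proof (rule Bochner_Integration.integrable_bound)
  note integrable_indicator_compact[OF assms(3)]
  then show "integrable lborel (\<lambda>x. (w x)\<^sup>2 / 2 + b\<^sup>2 / 2 * indicator K x)"
    using assms(2) by auto
  show "(\<lambda>x. \<bar>w x\<bar> * (b * indicator K x)) \<in> borel_measurable lborel"
    using borel_compact[OF assms(3)] by measurable
  show "AE x in lborel. norm (\<bar>w x\<bar> * (b * indicator K x)) \<le> norm ((w x)\<^sup>2 / 2 + b\<^sup>2 / 2 * indicator K x)"
    using inner_le_half_sum_squares[of "w _" b]
    by (intro AE_I2) (auto simp: indicator_def abs_mult)
qed

text \<open>
  The best test function would be \<open>\<eta> * clip k w\<close>, which is merely measurable. Off a null set \<open>w\<close> is
  a limit of continuous functions, and on the support of \<open>\<eta>\<close> their truncations are uniformly close to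
  polynomials, so that \<open>\<eta>\<close> times these polynomials are admissible and converge boundedly. In the limit
  \<open>a = \<integral> \<eta> w clip k w\<close> satisfies \<open>a \<le> M * sqrt a\<close>, because \<open>(\<eta> * clip k w)\<^sup>2 \<le> \<eta> * w * clip k w\<close>.
\<close>

lemma duality_clipped:
  fixes w \<eta> :: "'a::euclidean_space \<Rightarrow> real"
  assumes w[measurable]: "w \<in> borel_measurable borel" and w2: "integrable lborel (\<lambda>x. (w x)\<^sup>2)"
    and M: "0 \<le> M" and k: "0 \<le> k"
    and bound: "\<And>\<psi> D\<psi>. test_function V \<psi> D\<psi> \<Longrightarrow>
      (\<integral>x. w x * \<psi> x \<partial>lborel) \<le> M * sqrt (\<integral>x. (\<psi> x)\<^sup>2 \<partial>lborel)"
    and \<eta>: "C1_function \<eta>" "\<And>x. 0 \<le> \<eta> x" "\<And>x. \<eta> x \<le> 1"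
    and K: "compact K" "K \<subseteq> V" "\<And>x. x \<notin> K \<Longrightarrow> \<eta> x = 0"
  shows "(\<integral>\<^sup>+x. ennreal (\<eta> x * (w x * clip k (w x))) \<partial>lborel) \<le> ennreal (M\<^sup>2)"
proof -
  have [measurable]: "\<eta> \<in> borel_measurable borel"
    by (intro borel_measurable_continuous_onI C1_function_continuous \<eta>)
  have [measurable]: "K \<in> sets borel" using K(1) by (rule borel_compact)
  have "w measurable_on UNIV"
    using w by (intro lebesgue_measurable_imp_measurable_on_real measurable_completion) auto
  then obtain Z g where Z: "negligible Z" and g: "\<And>n. continuous_on UNIV (g n)"
    and lim: "\<And>x. x \<notin> Z \<Longrightarrow> (\<lambda>n. g n x) \<longlonglongrightarrow> w x"
    unfolding measurable_on_def by auto
  have "\<exists>p. real_polynomial_function p \<and> (\<forall>x\<in>K. \<bar>clip k (g n x) - p x\<bar> < 1 / Suc n)" for n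
  proof -
    have "continuous_on K (\<lambda>x. clip k (g n x))"
      unfolding clip_def by (intro continuous_intros continuous_on_subset[OF g]) auto
    with K(1) show ?thesis
      by (rule Stone_Weierstrass_real_polynomial_function[where e = "1 / Suc n"]) auto
  qed
  then obtain p where p: "\<And>n. real_polynomial_function (p n)"
    and close: "\<And>n x. x \<in> K \<Longrightarrow> \<bar>clip k (g n x) - p n x\<bar> < 1 / Suc n"
    by metis
  define \<psi> where "\<psi> n x = \<eta> x * p n x" for n x
  have \<psi>_C1: "C1_function (\<psi> n)" for n
    unfolding \<psi>_def by (intro C1_function_mult \<eta> C1_function_polynomial p)
  then have [measurable]: "\<psi> n \<in> borel_measurable borel" for n
    by (intro borel_measurable_continuous_onI C1_function_continuous)
  have tests: "(\<integral>x. w x * \<psi> n x \<partial>lborel) \<le> M * sqrt (\<integral>x. (\<psi> n x)\<^sup>2 \<partial>lborel)" for n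
  proof -
    from \<psi>_C1[of n] obtain D\<psi> where "\<And>x. GDERIV (\<psi> n) x :> D\<psi> x" "continuous_on UNIV D\<psi>"
      unfolding C1_function_def by blast
    then have "test_function V (\<psi> n) D\<psi>"
      by (rule test_functionI[OF _ _ K(1,2)]) (simp add: \<psi>_def K(3))
    then show ?thesis by (rule bound)
  qed
  have \<psi>_bound: "\<bar>\<psi> n x\<bar> \<le> (k + 1) * indicator K x" for n x
  proof (cases "x \<in> K")
    case True
    have "\<bar>clip k (g n x)\<bar> \<le> k" using k by (auto simp: clip_def)
    moreover have "1 / real (Suc n) \<le> 1" by simp
    ultimately have "\<bar>p n x\<bar> \<le> k + 1" using close[OF True, of n] by linarith
    then have "\<bar>\<eta> x\<bar> * \<bar>p n x\<bar> \<le> 1 * (k + 1)"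
      using \<eta>(2,3)[of x] by (intro mult_mono) auto
    with True show ?thesis by (simp add: \<psi>_def abs_mult)
  qed (simp add: \<psi>_def K(3))
  have \<psi>_lim: "(\<lambda>n. \<psi> n x) \<longlonglongrightarrow> \<eta> x * clip k (w x)" if "x \<notin> Z" for x
  proof (cases "x \<in> K")
    case True
    have "(\<lambda>n. clip k (g n x)) \<longlonglongrightarrow> clip k (w x)"
      unfolding clip_def by (intro tendsto_intros lim that)
    moreover have "(\<lambda>n. clip k (g n x) - p n x) \<longlonglongrightarrow> 0"
    proof (rule tendsto_0_le[where K = 1])
      show "(\<lambda>n. 1 / real (Suc n)) \<longlonglongrightarrow> 0" by (rule LIMSEQ_inverse_real_of_nat[unfolded inverse_eq_divide])
      show "\<forall>\<^sub>F n in sequentially. norm (clip k (g n x) - p n x) \<le> norm (1 / real (Suc n)) * 1"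
        using close[OF True] by (intro always_eventually allI) (simp add: less_imp_le)
    qed
    ultimately have "(\<lambda>n. clip k (g n x) - (clip k (g n x) - p n x)) \<longlonglongrightarrow> clip k (w x) - 0"
      by (rule tendsto_diff)
    then have "(\<lambda>n. p n x) \<longlonglongrightarrow> clip k (w x)" by simp
    then show ?thesis unfolding \<psi>_def by (rule tendsto_mult_left)
  qed (simp add: \<psi>_def K(3))
  have AE_Z: "AE x in lborel. x \<notin> Z"
    using AE_not_in[OF Z[unfolded negligible_iff_null_sets]] unfolding AE_completion_iff .
  let ?\<theta> = "\<lambda>x. \<eta> x * clip k (w x)"
  have int1: "integrable lborel (\<lambda>x. \<bar>w x\<bar> * ((k + 1) * indicator K x))"
    by (rule integrable_mult_bounded_support[OF w w2 K(1)])
  have dom1: "AE x in lborel. norm (w x * \<psi> n x) \<le> \<bar>w x\<bar> * ((k + 1) * indicator K x)" for n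
    using \<psi>_bound by (intro AE_I2) (simp add: abs_mult mult_left_mono)
  have lim1: "AE x in lborel. (\<lambda>n. w x * \<psi> n x) \<longlonglongrightarrow> w x * ?\<theta> x"
    using AE_Z by eventually_elim (intro tendsto_mult_left \<psi>_lim)
  have conv1: "(\<lambda>n. \<integral>x. w x * \<psi> n x \<partial>lborel) \<longlonglongrightarrow> (\<integral>x. w x * ?\<theta> x \<partial>lborel)"
    by (rule integral_dominated_convergence[OF _ _ int1 lim1 dom1]) simp_all
  have intw: "integrable lborel (\<lambda>x. w x * ?\<theta> x)"
    by (rule integrable_dominated_convergence[OF _ _ int1 lim1 dom1]) simp_all
  have int2: "integrable lborel (\<lambda>x. (k + 1)\<^sup>2 * indicator K x :: real)"
    using integrable_indicator_compact[OF K(1)] by simp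
  have dom2: "AE x in lborel. norm ((\<psi> n x)\<^sup>2) \<le> (k + 1)\<^sup>2 * indicator K x" for n
  proof (intro AE_I2)
    fix x
    have "\<bar>\<psi> n x\<bar>\<^sup>2 \<le> ((k + 1) * indicator K x)\<^sup>2"
      using \<psi>_bound[of n x] by (intro power_mono) auto
    then show "norm ((\<psi> n x)\<^sup>2) \<le> (k + 1)\<^sup>2 * indicator K x"
      by (auto simp: indicator_def split: if_splits)
  qed
  have lim2: "AE x in lborel. (\<lambda>n. (\<psi> n x)\<^sup>2) \<longlonglongrightarrow> (?\<theta> x)\<^sup>2"
    using AE_Z by eventually_elim (intro tendsto_power \<psi>_lim)
  have conv2: "(\<lambda>n. \<integral>x. (\<psi> n x)\<^sup>2 \<partial>lborel) \<longlonglongrightarrow> (\<integral>x. (?\<theta> x)\<^sup>2 \<partial>lborel)"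
    by (rule integral_dominated_convergence[OF _ _ int2 lim2 dom2]) simp_all
  have int\<theta>: "integrable lborel (\<lambda>x. (?\<theta> x)\<^sup>2)"
    by (rule integrable_dominated_convergence[OF _ _ int2 lim2 dom2]) simp_all
  define a where "a = (\<integral>x. w x * ?\<theta> x \<partial>lborel)"
  have pointwise: "(?\<theta> x)\<^sup>2 \<le> w x * ?\<theta> x" for x
  proof -
    have "(?\<theta> x)\<^sup>2 = \<eta> x * (\<eta> x * (clip k (w x))\<^sup>2)"
      by (simp add: power2_eq_square)
    also have "\<dots> \<le> \<eta> x * (1 * (w x * clip k (w x)))"
      using \<eta>(2,3)[of x] square_le_mult_clip[OF k, of "w x"] by (intro mult_left_mono mult_mono) auto
    finally show ?thesis by (simp add: mult.left_commute)
  qed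
  have nn: "0 \<le> w x * ?\<theta> x" for x using pointwise[of x] zero_le_power2[of "?\<theta> x"] by linarith
  have a0: "0 \<le> a" unfolding a_def using nn by (intro integral_nonneg_AE) auto
  have "a \<le> M * sqrt (\<integral>x. (?\<theta> x)\<^sup>2 \<partial>lborel)"
    unfolding a_def
    by (rule LIMSEQ_le[OF conv1 tendsto_mult_left[OF tendsto_real_sqrt[OF conv2]]]) (use tests in blast)
  also have "\<dots> \<le> M * sqrt a"
    unfolding a_def using M
    by (intro mult_left_mono real_sqrt_le_mono integral_mono int\<theta> intw pointwise)
  finally have "a \<le> M * sqrt a" .
  then have le: "sqrt a * sqrt a \<le> M * sqrt a" using a0 by simp
  have "sqrt a \<le> M"
  proof (cases "a = 0")
    case False
    then have "0 < sqrt a" using a0 by simp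
    with le show ?thesis by (rule mult_right_le_imp_le)
  qed (simp add: M)
  then have "a \<le> M\<^sup>2" using a0 by (simp add: sqrt_le_D)
  moreover have "(\<integral>\<^sup>+x. ennreal (\<eta> x * (w x * clip k (w x))) \<partial>lborel) = ennreal a"
    unfolding a_def using nn intw
    by (subst nn_integral_eq_integral[symmetric]) (auto simp: mult.left_commute)
  ultimately show ?thesis by (simp add: ennreal_leI)
qed

text \<open>
  The cut-off and the truncation of the previous lemma are removed at the same time by Fatou's lemma.
  For \<open>M = 0\<close> this is the fundamental lemma of the calculus of variations.
\<close>

lemma L2_norm_le_by_duality:
  fixes w :: "'a::euclidean_space \<Rightarrow> real"
  assumes "open V"
    and w[measurable]: "w \<in> borel_measurable borel" and w2: "integrable lborel (\<lambda>x. (w x)\<^sup>2)"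
    and M: "0 \<le> M"
    and bound: "\<And>\<psi> D\<psi>. test_function V \<psi> D\<psi> \<Longrightarrow>
      (\<integral>x. w x * \<psi> x \<partial>lborel) \<le> M * sqrt (\<integral>x. (\<psi> x)\<^sup>2 \<partial>lborel)"
  shows "(\<integral>\<^sup>+x\<in>V. ennreal ((w x)\<^sup>2) \<partial>lborel) \<le> ennreal (M\<^sup>2)"
proof -
  obtain \<eta> :: "nat \<Rightarrow> 'a \<Rightarrow> real" where \<eta>: "\<And>m. C1_function (\<eta> m)"
      "\<And>m. \<exists>K. compact K \<and> K \<subseteq> V \<and> (\<forall>x. x \<notin> K \<longrightarrow> \<eta> m x = 0)"
      "\<And>m x. 0 \<le> \<eta> m x" "\<And>m x. \<eta> m x \<le> 1"
    and \<eta>_lim: "\<And>x. x \<in> V \<Longrightarrow> (\<lambda>m. \<eta> m x) \<longlonglongrightarrow> 1"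
    using C1_exhaustion[OF \<open>open V\<close>] by blast
  have [measurable]: "\<eta> m \<in> borel_measurable borel" for m
    by (intro borel_measurable_continuous_onI C1_function_continuous \<eta>)
  have [measurable]: "V \<in> sets borel" using \<open>open V\<close> by simp
  let ?f = "\<lambda>m x. ennreal (\<eta> m x * (w x * clip (real m) (w x)))"
  have "(\<integral>\<^sup>+x\<in>V. ennreal ((w x)\<^sup>2) \<partial>lborel) \<le> (\<integral>\<^sup>+x. liminf (\<lambda>m. ?f m x) \<partial>lborel)"
  proof (intro nn_integral_mono)
    fix x
    show "ennreal ((w x)\<^sup>2) * indicator V x \<le> liminf (\<lambda>m. ?f m x)"
    proof (cases "x \<in> V")
      case True
      have "\<forall>\<^sub>F m in sequentially. clip (real m) (w x) = w x"
        using eventually_ge_at_top[of "nat \<lceil>\<bar>w x\<bar>\<rceil>"]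
      proof eventually_elim
        case (elim m)
        then have "\<bar>w x\<bar> \<le> real m" by linarith
        then show ?case by (auto simp: clip_def)
      qed
      then have "(\<lambda>m. clip (real m) (w x)) \<longlonglongrightarrow> w x" by (rule tendsto_eventually)
      then have "(\<lambda>m. \<eta> m x * (w x * clip (real m) (w x))) \<longlonglongrightarrow> 1 * (w x * w x)"
        by (intro tendsto_mult \<eta>_lim True tendsto_const)
      then have "(\<lambda>m. ?f m x) \<longlonglongrightarrow> ennreal ((w x)\<^sup>2)"
        by (intro tendsto_ennrealI) (simp add: power2_eq_square)
      then have "liminf (\<lambda>m. ?f m x) = ennreal ((w x)\<^sup>2)"
        by (intro lim_imp_Liminf) auto
      with True show ?thesis by simp
    qed simp
  qed
  also have "\<dots> \<le> liminf (\<lambda>m. \<integral>\<^sup>+x. ?f m x \<partial>lborel)"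
    by (intro nn_integral_liminf) measurable
  also have "\<dots> \<le> ennreal (M\<^sup>2)"
  proof (rule Liminf_le)
    show "\<forall>\<^sub>F m in sequentially. (\<integral>\<^sup>+x. ?f m x \<partial>lborel) \<le> ennreal (M\<^sup>2)"
    proof (intro always_eventually allI)
      fix m
      obtain K where "compact K" "K \<subseteq> V" "\<And>x. x \<notin> K \<Longrightarrow> \<eta> m x = 0" using \<eta>(2) by blast
      then show "(\<integral>\<^sup>+x. ?f m x \<partial>lborel) \<le> ennreal (M\<^sup>2)"
        by (intro duality_clipped[OF w w2 M _ bound \<eta>(1,3,4)]) auto
    qed
  qed simp
  finally show ?thesis .
qed

section \<open>Weak gradients and translations\<close>

lemma integrable_lborel_shift:
  fixes f :: "'a::euclidean_space \<Rightarrow> 'b::{banach, second_countable_topology}"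
  assumes [measurable]: "f \<in> borel_measurable borel"
  shows "integrable lborel (\<lambda>x. f (c + x)) \<longleftrightarrow> integrable lborel f"
  using integrable_distr_eq[of "(+) c" lborel borel f] by (simp add: lborel_distr_plus)

lemma integral_lborel_shift:
  fixes f :: "'a::euclidean_space \<Rightarrow> 'b::{banach, second_countable_topology}"
  assumes [measurable]: "f \<in> borel_measurable borel"
  shows "(\<integral>x. f (c + x) \<partial>lborel) = (\<integral>x. f x \<partial>lborel)"
  using integral_distr[of "(+) c" lborel borel f] by (simp add: lborel_distr_plus)

lemma nn_integral_lborel_shift:
  fixes f :: "'a::euclidean_space \<Rightarrow> ennreal"
  assumes [measurable]: "f \<in> borel_measurable borel"
  shows "(\<integral>\<^sup>+x. f (c + x) \<partial>lborel) = (\<integral>\<^sup>+x. f x \<partial>lborel)"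
  using nn_integral_distr[of "(+) c" lborel borel f] by (simp add: lborel_distr_plus)

lemma lborel_Cauchy_Schwarz:
  fixes f g :: "'a::euclidean_space \<Rightarrow> real"
  assumes [measurable]: "f \<in> borel_measurable borel" "g \<in> borel_measurable borel"
    and "integrable lborel (\<lambda>x. (f x)\<^sup>2)" "integrable lborel (\<lambda>x. (g x)\<^sup>2)"
  shows "\<bar>\<integral>x. f x * g x \<partial>lborel\<bar> \<le> sqrt (\<integral>x. (f x)\<^sup>2 \<partial>lborel) * sqrt (\<integral>x. (g x)\<^sup>2 \<partial>lborel)"
proof -
  have L2: "f \<in> L2 UNIV" "g \<in> L2 UNIV"
    using assms by (simp_all add: L2_def lebesgue_on_UNIV_eq integrable_completion measurable_completion)
  have "L2_inner UNIV u v = (\<integral>x. u x * v x \<partial>lborel)"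
    if [measurable]: "u \<in> borel_measurable borel" "v \<in> borel_measurable borel" for u v :: "'a \<Rightarrow> real"
    by (simp add: L2_inner_def lebesgue_on_UNIV_eq integral_completion)
  with L2_Cauchy_Schwarz[OF L2] show ?thesis
    by (simp add: L2_norm_def power2_eq_square)
qed

lemma test_function_gradient_zero:
  assumes "test_function V \<psi> D\<psi>" "x \<notin> closure {x. \<psi> x \<noteq> 0}"
  shows "D\<psi> x = 0"
proof -
  have "((\<lambda>_. 0) has_derivative (\<lambda>h. h \<bullet> D\<psi> x)) (at x)"
  proof (rule has_derivative_transform_within_open[where f = \<psi> and s = "- closure {x. \<psi> x \<noteq> 0}"])
    show "(\<psi> has_derivative (\<lambda>h. h \<bullet> D\<psi> x)) (at x)"
      using assms(1) by (simp add: test_function_def gderiv_def)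
    show "\<psi> y = 0" if "y \<in> - closure {x. \<psi> x \<noteq> 0}" for y
      using that closure_subset[of "{x. \<psi> x \<noteq> 0}"] by blast
  qed (use assms(2) in auto)
  from has_derivative_unique[OF this has_derivative_const] have "D\<psi> x \<bullet> D\<psi> x = 0"
    by meson
  then show ?thesis by simp
qed

lemma bounded_of_compact_support:
  fixes g :: "'a::euclidean_space \<Rightarrow> 'b::real_normed_vector"
  assumes "continuous_on UNIV g" "compact K" "\<And>x. x \<notin> K \<Longrightarrow> g x = 0"
  obtains b where "0 < b" "\<And>x. norm (g x) \<le> b"
proof -
  have "compact (g ` K)" using assms continuous_on_subset by (intro compact_continuous_image) blast+
  then obtain b where b: "0 < b" "\<And>y. y \<in> g ` K \<Longrightarrow> norm y \<le> b"
    using compact_imp_bounded bounded_pos by metis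
  show ?thesis
  proof (rule that[OF b(1)])
    show "norm (g x) \<le> b" for x
      using assms(3)[of x] b by (cases "x \<in> K") auto
  qed
qed

lemma test_functionE:
  assumes "test_function V \<psi> D\<psi>"
  obtains K where "compact K" "K \<subseteq> V" "\<And>x. x \<notin> K \<Longrightarrow> \<psi> x = 0" "\<And>x. x \<notin> K \<Longrightarrow> D\<psi> x = 0"
    "\<And>x. GDERIV \<psi> x :> D\<psi> x" "continuous_on UNIV D\<psi>" "continuous_on UNIV \<psi>"
proof (rule that[of "closure {x. \<psi> x \<noteq> 0}"])
  show "compact (closure {x. \<psi> x \<noteq> 0})" "closure {x. \<psi> x \<noteq> 0} \<subseteq> V"
    "\<And>x. GDERIV \<psi> x :> D\<psi> x" "continuous_on UNIV D\<psi>"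
    using assms by (auto simp: test_function_def)
  then show "continuous_on UNIV \<psi>" by (intro GDERIV_continuous_on)
  show "\<psi> x = 0" if "x \<notin> closure {x. \<psi> x \<noteq> 0}" for x
    using that closure_subset[of "{x. \<psi> x \<noteq> 0}"] by blast
  show "D\<psi> x = 0" if "x \<notin> closure {x. \<psi> x \<noteq> 0}" for x
    using test_function_gradient_zero[OF assms that] .
qed

lemma integrable_mult_compact_support:
  fixes w g :: "'a::euclidean_space \<Rightarrow> real"
  assumes w[measurable]: "w \<in> borel_measurable borel" and w2: "integrable lborel (\<lambda>x. (w x)\<^sup>2)"
    and g: "continuous_on UNIV g" and K: "compact K" "\<And>x. x \<notin> K \<Longrightarrow> g x = 0"
  shows "integrable lborel (\<lambda>x. w x * g x)"
proof -
  obtain b where b: "\<And>x. norm (g x) \<le> b" using bounded_of_compact_support[OF g K] by blast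
  have [measurable]: "g \<in> borel_measurable borel" using g by (rule borel_measurable_continuous_onI)
  show ?thesis
  proof (rule Bochner_Integration.integrable_bound[OF integrable_mult_bounded_support[OF w w2 K(1), of b]])
    show "AE x in lborel. norm (w x * g x) \<le> norm (\<bar>w x\<bar> * (b * indicator K x))"
    proof (intro AE_I2)
      fix x
      have "\<bar>g x\<bar> \<le> \<bar>b\<bar>" using b[of x] by simp
      then show "norm (w x * g x) \<le> norm (\<bar>w x\<bar> * (b * indicator K x))"
        using K(2)[of x] by (cases "x \<in> K") (simp_all add: abs_mult mult_left_mono)
    qed
  qed simp
qed

lemma integrable_continuous_compact_support:
  fixes g :: "'a::euclidean_space \<Rightarrow> real"
  assumes g: "continuous_on UNIV g" and K: "compact K" "\<And>x. x \<notin> K \<Longrightarrow> g x = 0"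
  shows "integrable lborel g"
proof -
  have [measurable]: "K \<in> sets borel" using K(1) by (rule borel_compact)
  have "(indicat_real K x)\<^sup>2 = indicator K x" for x :: 'a by (simp add: indicator_def)
  then have "integrable lborel (\<lambda>x. indicator K x * g x)"
    by (intro integrable_mult_compact_support[OF _ _ g K]) (auto simp: integrable_indicator_compact K(1))
  moreover have "indicator K x * g x = g x" for x using K(2)[of x] by (cases "x \<in> K") auto
  ultimately show ?thesis by simp
qed

lemma bounded_gradient_Lipschitz:
  fixes \<psi> :: "'a::euclidean_space \<Rightarrow> real"
  assumes "\<And>x. GDERIV \<psi> x :> D\<psi> x" "\<And>x. norm (D\<psi> x) \<le> b"
  shows "\<bar>\<psi> x - \<psi> y\<bar> \<le> b * norm (x - y)"
proof -
  have "norm (\<psi> x - \<psi> y) \<le> b * norm (x - y)"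
  proof (rule differentiable_bound[where S = UNIV and f' = "\<lambda>x h. h \<bullet> D\<psi> x"])
    show "(\<psi> has_derivative (\<lambda>h. h \<bullet> D\<psi> x)) (at x within UNIV)" for x
      using assms(1)[of x] by (simp add: gderiv_def)
    show "onorm (\<lambda>h. h \<bullet> D\<psi> x) \<le> b" for x
    proof (rule onorm_le)
      show "norm (h \<bullet> D\<psi> x) \<le> b * norm h" for h
        using Cauchy_Schwarz_ineq2[of h "D\<psi> x"] mult_right_mono[OF assms(2)[of x] norm_ge_zero[of h]]
        by (simp add: mult.commute)
    qed
  qed auto
  then show ?thesis by simp
qed

text \<open>
  The derivative falls on the test function, so \<open>U\<close> may be rough. The difference quotients are bounded
  by the Lipschitz constant of \<open>\<psi>\<close> and vanish outside one common ball, which gives the dominating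
  function.
\<close>

lemma translated_pairing_derivative:
  fixes U :: "'a::euclidean_space \<Rightarrow> real"
  assumes U[measurable]: "U \<in> borel_measurable borel" and U2: "integrable lborel (\<lambda>x. (U x)\<^sup>2)"
    and test: "test_function V \<psi> D\<psi>"
  shows "((\<lambda>t. \<integral>y. U y * \<psi> (y - t *\<^sub>R h) \<partial>lborel) has_real_derivative
      - (\<integral>y. U y * (D\<psi> (y - t *\<^sub>R h) \<bullet> h) \<partial>lborel)) (at t)"
proof -
  obtain K where K: "compact K" "\<And>x. x \<notin> K \<Longrightarrow> \<psi> x = 0" "\<And>x. x \<notin> K \<Longrightarrow> D\<psi> x = 0"
    and D: "\<And>x. GDERIV \<psi> x :> D\<psi> x" "continuous_on UNIV D\<psi>" and cont: "continuous_on UNIV \<psi>"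
    using test_functionE[OF test] by metis
  have [measurable]: "\<psi> \<in> borel_measurable borel" "D\<psi> \<in> borel_measurable borel"
    using cont D(2) by (auto intro: borel_measurable_continuous_onI)
  obtain b where b: "0 < b" "\<And>x. norm (D\<psi> x) \<le> b"
    using bounded_of_compact_support[OF D(2) K(1,3)] by blast
  obtain R where R: "\<And>x. x \<in> K \<Longrightarrow> norm x \<le> R"
    using compact_imp_bounded[OF K(1)] unfolding bounded_iff by blast
  have int: "integrable lborel (\<lambda>y. U y * \<psi> (y - t *\<^sub>R h))" for t
  proof (rule integrable_mult_compact_support[OF U U2])
    show "continuous_on UNIV (\<lambda>y. \<psi> (y - t *\<^sub>R h))"
      by (intro continuous_on_compose2[OF cont] continuous_intros) auto
    show "compact ((+) (t *\<^sub>R h) ` K)" using K(1) by (rule compact_translation)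
    show "\<psi> (y - t *\<^sub>R h) = 0" if "y \<notin> (+) (t *\<^sub>R h) ` K" for y
    proof (rule K(2), rule)
      assume "y - t *\<^sub>R h \<in> K"
      then have "t *\<^sub>R h + (y - t *\<^sub>R h) \<in> (+) (t *\<^sub>R h) ` K" by (rule imageI)
      with that show False by simp
    qed
  qed
  let ?G = "\<lambda>t. \<integral>y. U y * \<psi> (y - t *\<^sub>R h) \<partial>lborel"
  have "(\<lambda>s. (?G (t + s) - ?G t) / s) \<midarrow>0\<rightarrow> - (\<integral>y. U y * (D\<psi> (y - t *\<^sub>R h) \<bullet> h) \<partial>lborel)"
  proof (subst LIMSEQ_SEQ_conv[symmetric], intro allI impI, elim conjE)
    fix S :: "nat \<Rightarrow> real" assume S: "\<forall>n. S n \<noteq> 0" "S \<longlonglongrightarrow> 0"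
    obtain B where B: "\<And>n. \<bar>S n\<bar> \<le> B"
      using convergent_imp_Bseq[OF convergentI[OF S(2)]] unfolding Bseq_def by auto
    define K' where "K' = cball (0::'a) (R + (\<bar>t\<bar> + B) * norm h)"
    let ?q = "\<lambda>n y. U y * ((\<psi> (y - (t + S n) *\<^sub>R h) - \<psi> (y - t *\<^sub>R h)) / S n)"
    have "(\<lambda>n. \<integral>y. ?q n y \<partial>lborel) \<longlonglongrightarrow> (\<integral>y. U y * - (D\<psi> (y - t *\<^sub>R h) \<bullet> h) \<partial>lborel)"
    proof (rule integral_dominated_convergence)
      show "integrable lborel (\<lambda>y. \<bar>U y\<bar> * ((b * norm h) * indicator K' y))"
        unfolding K'_def by (rule integrable_mult_bounded_support[OF U U2 compact_cball])
      show "AE y in lborel. norm (?q n y) \<le> \<bar>U y\<bar> * ((b * norm h) * indicator K' y)" for n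
      proof (intro AE_I2)
        fix y
        have "\<bar>(\<psi> (y - (t + S n) *\<^sub>R h) - \<psi> (y - t *\<^sub>R h)) / S n\<bar> \<le> (b * norm h) * indicator K' y"
        proof (cases "y \<in> K'")
          case True
          have "\<bar>\<psi> (y - (t + S n) *\<^sub>R h) - \<psi> (y - t *\<^sub>R h)\<bar>
              \<le> b * norm ((y - (t + S n) *\<^sub>R h) - (y - t *\<^sub>R h))"
            by (rule bounded_gradient_Lipschitz[OF D(1) b(2)])
          also have "(y - (t + S n) *\<^sub>R h) - (y - t *\<^sub>R h) = (- S n) *\<^sub>R h"
            by (simp add: algebra_simps)
          finally show ?thesis using S(1) True by (simp add: divide_le_eq mult_ac)
        next
          case False
          have "y - r *\<^sub>R h \<notin> K" if "\<bar>r\<bar> \<le> \<bar>t\<bar> + B" for r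
          proof
            assume "y - r *\<^sub>R h \<in> K"
            then have "norm (y - r *\<^sub>R h) \<le> R" by (rule R)
            moreover have "norm y \<le> norm (y - r *\<^sub>R h) + norm (r *\<^sub>R h)"
              by (metis diff_add_cancel norm_triangle_ineq)
            moreover have "norm (r *\<^sub>R h) \<le> (\<bar>t\<bar> + B) * norm h"
              using that by (simp add: mult_right_mono)
            ultimately show False using False by (simp add: K'_def)
          qed
          moreover have "\<bar>t + S n\<bar> \<le> \<bar>t\<bar> + B" "\<bar>t\<bar> \<le> \<bar>t\<bar> + B" using B[of n] by linarith+
          ultimately show ?thesis using False K(2) by simp
        qed
        then show "norm (?q n y) \<le> \<bar>U y\<bar> * ((b * norm h) * indicator K' y)"
          unfolding real_norm_def abs_mult[of "U y"] by (intro mult_left_mono) auto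
      qed
      show "AE y in lborel. (\<lambda>n. ?q n y) \<longlonglongrightarrow> U y * - (D\<psi> (y - t *\<^sub>R h) \<bullet> h)"
      proof (intro AE_I2 tendsto_mult_left)
        fix y
        have "((\<lambda>s. \<psi> (y - (t + s) *\<^sub>R h)) has_derivative (\<lambda>s. (- s *\<^sub>R h) \<bullet> D\<psi> (y - (t + 0) *\<^sub>R h))) (at 0)"
        proof (rule has_derivative_compose[where g = \<psi>])
          show "((\<lambda>s. y - (t + s) *\<^sub>R h) has_derivative (\<lambda>s. - s *\<^sub>R h)) (at 0)"
            by (auto intro!: derivative_eq_intros simp: algebra_simps)
          show "(\<psi> has_derivative (\<lambda>k. k \<bullet> D\<psi> (y - (t + 0) *\<^sub>R h))) (at (y - (t + 0) *\<^sub>R h))"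
            using D(1) by (simp add: gderiv_def)
        qed
        then have "((\<lambda>s. \<psi> (y - (t + s) *\<^sub>R h)) has_real_derivative - (D\<psi> (y - t *\<^sub>R h) \<bullet> h)) (at 0)"
          unfolding has_field_derivative_def
          by (rule has_derivative_eq_rhs) (auto simp: inner_commute)
        then have "(\<lambda>s. (\<psi> (y - (t + s) *\<^sub>R h) - \<psi> (y - t *\<^sub>R h)) / s) \<midarrow>0\<rightarrow> - (D\<psi> (y - t *\<^sub>R h) \<bullet> h)"
          by (simp add: DERIV_def)
        then show "(\<lambda>n. (\<psi> (y - (t + S n) *\<^sub>R h) - \<psi> (y - t *\<^sub>R h)) / S n) \<longlonglongrightarrow> - (D\<psi> (y - t *\<^sub>R h) \<bullet> h)"
          using S unfolding LIMSEQ_SEQ_conv[symmetric] by blast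
      qed
    qed simp_all
    moreover have "(\<integral>y. ?q n y \<partial>lborel) = (?G (t + S n) - ?G t) / S n" for n
      by (simp add: Bochner_Integration.integral_diff[OF int int, symmetric] right_diff_distrib
          diff_divide_distrib flip: integral_divide_zero)
    moreover have "(\<integral>y. U y * - (D\<psi> (y - t *\<^sub>R h) \<bullet> h) \<partial>lborel) = - (\<integral>y. U y * (D\<psi> (y - t *\<^sub>R h) \<bullet> h) \<partial>lborel)"
      by simp
    ultimately show "(\<lambda>n. (?G (t + S n) - ?G t) / S n) \<longlonglongrightarrow> - (\<integral>y. U y * (D\<psi> (y - t *\<^sub>R h) \<bullet> h) \<partial>lborel)"
      by (simp only:)
  qed
  then show ?thesis by (simp add: DERIV_def)
qed

text \<open>
  Weak gradients of Borel functions on the whole space, square-integrable for Lebesgue-Borel measure: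
  for these, translation and Tonelli's theorem are available. The pairing with a direction \<open>e\<close> keeps
  all integrands real.
\<close>

definition borel_weak_gradient ::
    "'a::euclidean_space set \<Rightarrow> ('a \<Rightarrow> real) \<Rightarrow> ('a \<Rightarrow> 'a) \<Rightarrow> bool" where
  "borel_weak_gradient Om U G \<longleftrightarrow>
     U \<in> borel_measurable borel \<and> G \<in> borel_measurable borel \<and>
     integrable lborel (\<lambda>x. (U x)\<^sup>2) \<and> integrable lborel (\<lambda>x. (norm (G x))\<^sup>2) \<and>
     (\<forall>\<psi> D\<psi> e. test_function Om \<psi> D\<psi> \<longrightarrow>
        (\<integral>x. U x * (D\<psi> x \<bullet> e) \<partial>lborel) = - (\<integral>x. \<psi> x * (G x \<bullet> e) \<partial>lborel))"

lemma test_function_shift: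
  assumes test: "test_function V \<psi> D\<psi>" and V: "\<And>x. x \<in> V \<Longrightarrow> x + c \<in> Om"
  shows "test_function Om (\<lambda>y. \<psi> (y - c)) (\<lambda>y. D\<psi> (y - c))"
proof -
  obtain K where K: "compact K" "K \<subseteq> V" "\<And>x. x \<notin> K \<Longrightarrow> \<psi> x = 0"
    and D: "\<And>x. GDERIV \<psi> x :> D\<psi> x" "continuous_on UNIV D\<psi>"
    using test_functionE[OF test] by metis
  show ?thesis
  proof (rule test_functionI)
    show "GDERIV (\<lambda>y. \<psi> (y - c)) x :> D\<psi> (x - c)" for x
    proof -
      have "((\<lambda>y. \<psi> (y - c)) has_derivative (\<lambda>h. h \<bullet> D\<psi> (x - c))) (at x)"
        by (rule has_derivative_compose[where g = \<psi> and f = "\<lambda>y. y - c"])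
          (use D(1) in \<open>auto intro!: derivative_eq_intros simp: gderiv_def\<close>)
      then show ?thesis by (simp add: gderiv_def)
    qed
    show "continuous_on UNIV (\<lambda>y. D\<psi> (y - c))"
      by (intro continuous_on_compose2[OF D(2)] continuous_intros) auto
    show "compact ((+) c ` K)" using K(1) by (rule compact_translation)
    show "(+) c ` K \<subseteq> Om" using K(2) V by (auto simp: add.commute)
    show "\<psi> (y - c) = 0" if "y \<notin> (+) c ` K" for y
    proof (rule K(3), rule)
      assume "y - c \<in> K"
      then have "c + (y - c) \<in> (+) c ` K" by (rule imageI)
      with that show False by simp
    qed
  qed
qed

text \<open>
  The pairing of \<open>U\<close> with the translates of a test function \<open>\<psi>\<close> has as its derivative the pairing of
  \<open>G\<close> with these translates, which are admissible on \<open>Om\<close> as long as the translated set stays in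
  \<open>Om\<close>. The mean value theorem bounds the pairing of \<open>U(x + h) - U(x)\<close> with \<open>\<psi>\<close>, and duality
  bounds the norm.
\<close>

lemma translation_estimate:
  fixes U :: "'a::euclidean_space \<Rightarrow> real"
  assumes wg: "borel_weak_gradient Om U G" and "open V"
    and path: "\<And>x t. x \<in> V \<Longrightarrow> 0 \<le> t \<Longrightarrow> t \<le> 1 \<Longrightarrow> x + t *\<^sub>R h \<in> Om"
  shows "(\<integral>\<^sup>+x\<in>V. ennreal ((U (x + h) - U x)\<^sup>2) \<partial>lborel)
    \<le> ennreal ((norm h)\<^sup>2 * (\<integral>x. (norm (G x))\<^sup>2 \<partial>lborel))"
proof -
  have U[measurable]: "U \<in> borel_measurable borel" and [measurable]: "G \<in> borel_measurable borel"
    and U2: "integrable lborel (\<lambda>x. (U x)\<^sup>2)" and G2: "integrable lborel (\<lambda>x. (norm (G x))\<^sup>2)"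
    and parts: "\<And>\<psi> D\<psi> e. test_function Om \<psi> D\<psi> \<Longrightarrow>
        (\<integral>x. U x * (D\<psi> x \<bullet> e) \<partial>lborel) = - (\<integral>x. \<psi> x * (G x \<bullet> e) \<partial>lborel)"
    using wg unfolding borel_weak_gradient_def by auto
  define M where "M = norm h * sqrt (\<integral>x. (norm (G x))\<^sup>2 \<partial>lborel)"
  have "(\<integral>\<^sup>+x\<in>V. ennreal ((U (x + h) - U x)\<^sup>2) \<partial>lborel) \<le> ennreal (M\<^sup>2)"
  proof (rule L2_norm_le_by_duality[OF \<open>open V\<close>])
    have shifted: "integrable lborel (\<lambda>x. (U (x + h))\<^sup>2)"
      using U2 integrable_lborel_shift[of "\<lambda>x. (U x)\<^sup>2" h] by (simp add: add.commute)
    show "integrable lborel (\<lambda>x. (U (x + h) - U x)\<^sup>2)"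
    proof (rule Bochner_Integration.integrable_bound)
      show "integrable lborel (\<lambda>x. 2 * (U (x + h))\<^sup>2 + 2 * (U x)\<^sup>2)"
        using shifted U2 by simp
      have "(a - b)\<^sup>2 \<le> 2 * a\<^sup>2 + 2 * b\<^sup>2" for a b :: real
        using zero_le_power2[of "a + b"] by (simp add: power2_eq_square algebra_simps)
      then show "AE x in lborel. norm ((U (x + h) - U x)\<^sup>2) \<le> norm (2 * (U (x + h))\<^sup>2 + 2 * (U x)\<^sup>2)"
        by (intro AE_I2) simp
    qed simp
    show "0 \<le> M" by (simp add: M_def)
    fix \<psi> D\<psi> assume test: "test_function V \<psi> D\<psi>"
    obtain K where K: "compact K" "\<And>x. x \<notin> K \<Longrightarrow> \<psi> x = 0" and cont: "continuous_on UNIV \<psi>"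
      using test_functionE[OF test] by metis
    have [measurable]: "\<psi> \<in> borel_measurable borel"
      using cont by (rule borel_measurable_continuous_onI)
    have \<psi>2: "integrable lborel (\<lambda>x. (\<psi> x)\<^sup>2)"
      using K by (intro integrable_continuous_compact_support[of _ K] continuous_intros cont) auto
    define P where "P t = (\<integral>y. U y * \<psi> (y - t *\<^sub>R h) \<partial>lborel)" for t
    define P' where "P' t = - (\<integral>y. U y * (D\<psi> (y - t *\<^sub>R h) \<bullet> h) \<partial>lborel)" for t
    have deriv: "(P has_real_derivative P' t) (at t)" for t
      unfolding P_def P'_def by (rule translated_pairing_derivative[OF U U2 test])
    have G_le: "sqrt (\<integral>y. (G y \<bullet> h)\<^sup>2 \<partial>lborel) \<le> M"
    proof -
      have "(\<integral>y. (G y \<bullet> h)\<^sup>2 \<partial>lborel) \<le> (\<integral>y. (norm h)\<^sup>2 * (norm (G y))\<^sup>2 \<partial>lborel)"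
        using G2 Cauchy_Schwarz_ineq[of "G _" h]
        by (intro integral_mono') (simp_all add: power2_norm_eq_inner mult.commute)
      then have "sqrt (\<integral>y. (G y \<bullet> h)\<^sup>2 \<partial>lborel) \<le> sqrt ((norm h)\<^sup>2 * (\<integral>y. (norm (G y))\<^sup>2 \<partial>lborel))"
        by simp
      also have "\<dots> = M" by (simp add: M_def real_sqrt_mult)
      finally show ?thesis .
    qed
    have P'_le: "P' t \<le> M * sqrt (\<integral>x. (\<psi> x)\<^sup>2 \<partial>lborel)" if "0 \<le> t" "t \<le> 1" for t
    proof -
      have "test_function Om (\<lambda>y. \<psi> (y - t *\<^sub>R h)) (\<lambda>y. D\<psi> (y - t *\<^sub>R h))"
        using path that by (intro test_function_shift[OF test]) auto
      from parts[OF this, of h] have "P' t = (\<integral>y. \<psi> (y - t *\<^sub>R h) * (G y \<bullet> h) \<partial>lborel)"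
        by (simp add: P'_def)
      also have "\<dots> \<le> sqrt (\<integral>y. (\<psi> (y - t *\<^sub>R h))\<^sup>2 \<partial>lborel) * sqrt (\<integral>y. (G y \<bullet> h)\<^sup>2 \<partial>lborel)"
      proof (rule abs_le_D1, rule lborel_Cauchy_Schwarz)
        show "integrable lborel (\<lambda>y. (\<psi> (y - t *\<^sub>R h))\<^sup>2)"
          using \<psi>2 integrable_lborel_shift[of "\<lambda>x. (\<psi> x)\<^sup>2" "- t *\<^sub>R h"] by (simp add: algebra_simps)
        show "integrable lborel (\<lambda>y. (G y \<bullet> h)\<^sup>2)"
        proof (rule Bochner_Integration.integrable_bound)
          show "integrable lborel (\<lambda>y. (norm (G y))\<^sup>2 * (norm h)\<^sup>2)" using G2 by simp
          show "AE y in lborel. norm ((G y \<bullet> h)\<^sup>2) \<le> norm ((norm (G y))\<^sup>2 * (norm h)\<^sup>2)"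
            by (intro AE_I2) (simp add: Cauchy_Schwarz_ineq power2_norm_eq_inner)
        qed simp
      qed simp_all
      also have "(\<integral>y. (\<psi> (y - t *\<^sub>R h))\<^sup>2 \<partial>lborel) = (\<integral>y. (\<psi> y)\<^sup>2 \<partial>lborel)"
        using integral_lborel_shift[of "\<lambda>x. (\<psi> x)\<^sup>2" "- t *\<^sub>R h"] by (simp add: algebra_simps)
      also have "sqrt (\<integral>y. (\<psi> y)\<^sup>2 \<partial>lborel) * sqrt (\<integral>y. (G y \<bullet> h)\<^sup>2 \<partial>lborel)
          \<le> sqrt (\<integral>y. (\<psi> y)\<^sup>2 \<partial>lborel) * M"
        by (rule mult_left_mono[OF G_le]) simp
      finally show ?thesis by (simp add: mult.commute)
    qed
    obtain z where z: "0 < z" "z < 1" "P 1 - P 0 = (1 - 0) * P' z"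
      using MVT2[of 0 1 P P'] deriv by auto
    have prod_int: "integrable lborel (\<lambda>y. U y * \<psi> y)"
      by (rule integrable_mult_compact_support[OF U U2 cont K])
    have prod_int': "integrable lborel (\<lambda>x. U (x + h) * \<psi> x)"
      by (rule integrable_mult_compact_support[OF _ shifted cont K]) simp
    have "(\<integral>x. U (x + h) * \<psi> x \<partial>lborel) = P 1"
      unfolding P_def using integral_lborel_shift[of "\<lambda>y. U y * \<psi> (y - 1 *\<^sub>R h)" h]
      by (simp add: algebra_simps)
    moreover have "(\<integral>x. U x * \<psi> x \<partial>lborel) = P 0" by (simp add: P_def)
    ultimately have "(\<integral>x. (U (x + h) - U x) * \<psi> x \<partial>lborel) = P' z"
      using z(3) prod_int prod_int' by (simp add: left_diff_distrib)
    also have "\<dots> \<le> M * sqrt (\<integral>x. (\<psi> x)\<^sup>2 \<partial>lborel)" using z by (intro P'_le) auto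
    finally show "(\<integral>x. (U (x + h) - U x) * \<psi> x \<partial>lborel) \<le> M * sqrt (\<integral>x. (\<psi> x)\<^sup>2 \<partial>lborel)" .
  qed simp
  also have "M\<^sup>2 = (norm h)\<^sup>2 * (\<integral>x. (norm (G x))\<^sup>2 \<partial>lborel)"
    by (simp add: M_def power_mult_distrib)
  finally show ?thesis .
qed

section \<open>The Poincare inequality on a Lipschitz domain\<close>

abbreviation deviation :: "'a::euclidean_space set \<Rightarrow> ('a \<Rightarrow> real) \<Rightarrow> real \<Rightarrow> ennreal" where
  "deviation S U c \<equiv> (\<integral>\<^sup>+x\<in>S. ennreal ((U x - c)\<^sup>2) \<partial>lborel)"

abbreviation square_norm :: "('a::euclidean_space \<Rightarrow> 'a) \<Rightarrow> real" where
  "square_norm G \<equiv> (\<integral>x. (norm (G x))\<^sup>2 \<partial>lborel)"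

text \<open>
  The gradient is measured on all of \<open>Om\<close> and each function has its own constant \<open>c\<close>. In this form the
  property passes to subsets and to unions of overlapping sets.
\<close>

definition poincare_on :: "'a::euclidean_space set \<Rightarrow> 'a set \<Rightarrow> bool" where
  "poincare_on Om S \<longleftrightarrow>
     (\<exists>C\<ge>0. \<forall>U G. borel_weak_gradient Om U G \<longrightarrow>
        (\<exists>c. deviation S U c \<le> ennreal (C * square_norm G)))"

lemma poincare_on_subset:
  assumes "poincare_on Om S" "S' \<subseteq> S"
  shows "poincare_on Om S'"
proof -
  have "deviation S' U c \<le> deviation S U c"
    for U :: "'a \<Rightarrow> real" and c
    using assms(2) by (intro nn_integral_mono) (auto simp: indicator_def)
  then show ?thesis
    using assms(1) unfolding poincare_on_def by (meson order_trans)
qed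

lemma square_diff_le_double: "(a - c)\<^sup>2 \<le> 2 * (a - b)\<^sup>2 + 2 * (b - c)\<^sup>2" for a b c :: real
  using zero_le_power2[of "(a - b) - (b - c)"] by (simp add: power2_eq_square algebra_simps)

lemma ennreal_square_diff_le_double:
  "ennreal ((a - c)\<^sup>2) \<le> 2 * ennreal ((a - b)\<^sup>2) + 2 * ennreal ((b - c)\<^sup>2)"
proof -
  have "ennreal ((a - c)\<^sup>2) \<le> ennreal (2 * (a - b)\<^sup>2 + 2 * (b - c)\<^sup>2)"
    by (intro ennreal_leI square_diff_le_double)
  then show ?thesis by (simp add: ennreal_plus ennreal_mult)
qed

lemma nn_integral_square_diff_le_double:
  fixes f g :: "'a::euclidean_space \<Rightarrow> real"
  assumes [measurable]: "f \<in> borel_measurable borel" "g \<in> borel_measurable borel" "S \<in> sets borel"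
  shows "(\<integral>\<^sup>+x\<in>S. ennreal ((f x - c)\<^sup>2) \<partial>lborel)
    \<le> 2 * (\<integral>\<^sup>+x\<in>S. ennreal ((f x - g x)\<^sup>2) \<partial>lborel) + 2 * (\<integral>\<^sup>+x\<in>S. ennreal ((g x - c)\<^sup>2) \<partial>lborel)"
proof -
  have "(\<integral>\<^sup>+x\<in>S. ennreal ((f x - c)\<^sup>2) \<partial>lborel)
      \<le> (\<integral>\<^sup>+x. 2 * (ennreal ((f x - g x)\<^sup>2) * indicator S x) + 2 * (ennreal ((g x - c)\<^sup>2) * indicator S x) \<partial>lborel)"
    using ennreal_square_diff_le_double by (intro nn_integral_mono) (auto simp: indicator_def)
  also have "\<dots> = 2 * (\<integral>\<^sup>+x\<in>S. ennreal ((f x - g x)\<^sup>2) \<partial>lborel) + 2 * (\<integral>\<^sup>+x\<in>S. ennreal ((g x - c)\<^sup>2) \<partial>lborel)"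
    by (simp add: nn_integral_add nn_integral_cmult)
  finally show ?thesis .
qed

lemma emeasure_open_pos:
  fixes S :: "'a::euclidean_space set"
  assumes "open S" "S \<noteq> {}"
  shows "0 < emeasure lborel S"
proof (rule ccontr)
  assume "\<not> ?thesis"
  then have "S \<in> null_sets lebesgue"
    using assms(1) by (intro null_sets_completionI) (simp add: null_sets_def)
  with open_not_negligible[OF assms] show False by (simp add: negligible_iff_null_sets)
qed

text \<open>
  Integrating the translation estimate over all \<open>h\<close> that join two points of the ball bounds the double
  integral of \<open>(U x - U y)\<^sup>2\<close>. Hence \<open>c = U y\<close> works for some \<open>y\<close> in the ball.
\<close>

lemma poincare_on_ball:
  fixes x0 :: "'a::euclidean_space"
  assumes r: "0 < r" and sub: "ball x0 (3 * r) \<subseteq> Om"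
  shows "poincare_on Om (ball x0 r)"
proof -
  define B where "B = ball x0 r"
  define m where "m = measure lborel B"
  define m2 where "m2 = measure lborel (ball (0::'a) (2 * r))"
  have [measurable]: "B \<in> sets borel" "ball (0::'a) (2 * r) \<in> sets borel" by (simp_all add: B_def)
  have fin: "emeasure lborel B = ennreal m" "emeasure lborel (ball (0::'a) (2 * r)) = ennreal m2"
    using emeasure_bounded_finite[of B] emeasure_bounded_finite[of "ball (0::'a) (2 * r)"]
    by (auto simp: B_def m_def m2_def intro!: emeasure_eq_ennreal_measure)
  have m: "0 < m" using fin(1) emeasure_open_pos[of B] r by (simp add: B_def)
  \<comment> \<open>Twice the average over \<open>y\<close>: not all \<open>y\<close> can exceed it unless the gradient vanishes, and then
    \<open>U\<close> is constant almost everywhere on the ball.\<close>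
  define C where "C = 2 * ((2 * r)\<^sup>2 * m2) / m"
  have "0 \<le> C" using m by (simp add: C_def m2_def)
  moreover have "\<exists>c. deviation B U c \<le> ennreal (C * square_norm G)"
    if wg: "borel_weak_gradient Om U G" for U G
  proof (rule ccontr)
    assume neg: "\<not> ?thesis"
    define K where "K = square_norm G"
    have K: "0 \<le> K" by (simp add: K_def)
    have [measurable]: "U \<in> borel_measurable borel" using wg by (simp add: borel_weak_gradient_def)
    let ?J = "\<lambda>y. \<integral>\<^sup>+x\<in>B. ennreal ((U x - U y)\<^sup>2) \<partial>lborel"
    have J: "ennreal (C * K) < ?J y" for y
      using neg by (simp add: K_def not_le)
    have "(\<integral>\<^sup>+y\<in>B. ?J y \<partial>lborel)
        = (\<integral>\<^sup>+y. \<integral>\<^sup>+x. ennreal ((U x - U y)\<^sup>2) * indicator B x * indicator B y \<partial>lborel \<partial>lborel)"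
      by (simp add: nn_integral_multc)
    also have "\<dots> = (\<integral>\<^sup>+x. \<integral>\<^sup>+y. ennreal ((U x - U y)\<^sup>2) * indicator B x * indicator B y \<partial>lborel \<partial>lborel)"
      by (rule lborel_pair.Fubini') simp
    also have "\<dots> = (\<integral>\<^sup>+x. \<integral>\<^sup>+h. ennreal ((U x - U (x + h))\<^sup>2) * indicator B x * indicator B (x + h) \<partial>lborel \<partial>lborel)"
      by (intro nn_integral_cong nn_integral_lborel_shift[symmetric]) simp
    also have "\<dots> \<le> (\<integral>\<^sup>+x. \<integral>\<^sup>+h. ennreal ((U (x + h) - U x)\<^sup>2) * indicator B x * indicator (ball 0 (2 * r)) h \<partial>lborel \<partial>lborel)"
    proof (intro nn_integral_mono)
      fix x h
      have "h \<in> ball 0 (2 * r)" if "x \<in> B" "x + h \<in> B"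
      proof -
        have "norm ((x + h - x0) - (x - x0)) \<le> norm (x + h - x0) + norm (x - x0)"
          by (rule norm_triangle_ineq4)
        also have "\<dots> < r + r"
          using that by (intro add_strict_mono) (auto simp: B_def dist_norm norm_minus_commute)
        finally show ?thesis by simp
      qed
      then show "ennreal ((U x - U (x + h))\<^sup>2) * indicator B x * indicator B (x + h)
          \<le> ennreal ((U (x + h) - U x)\<^sup>2) * indicator B x * indicator (ball 0 (2 * r)) h"
        by (auto simp: indicator_def power2_commute[of "U x"])
    qed
    also have "\<dots> = (\<integral>\<^sup>+h. \<integral>\<^sup>+x. ennreal ((U (x + h) - U x)\<^sup>2) * indicator B x * indicator (ball 0 (2 * r)) h \<partial>lborel \<partial>lborel)"
      by (rule lborel_pair.Fubini') measurable
    also have "\<dots> \<le> (\<integral>\<^sup>+h. ennreal ((2 * r)\<^sup>2 * K) * indicator (ball (0::'a) (2 * r)) h \<partial>lborel)"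
    proof (intro nn_integral_mono)
      fix h :: 'a
      show "(\<integral>\<^sup>+x. ennreal ((U (x + h) - U x)\<^sup>2) * indicator B x * indicator (ball 0 (2 * r)) h \<partial>lborel)
          \<le> ennreal ((2 * r)\<^sup>2 * K) * indicator (ball 0 (2 * r)) h"
      proof (cases "h \<in> ball 0 (2 * r)")
        case True
        have "(\<integral>\<^sup>+x\<in>B. ennreal ((U (x + h) - U x)\<^sup>2) \<partial>lborel) \<le> ennreal ((norm h)\<^sup>2 * K)"
          unfolding K_def
        proof (rule translation_estimate[OF wg])
          fix x and t :: real assume "x \<in> B" "0 \<le> t" "t \<le> 1"
          have "norm (x + t *\<^sub>R h - x0) \<le> norm (x - x0) + norm (t *\<^sub>R h)"
            by (metis add_diff_eq add_diff_add add.commute norm_triangle_ineq diff_add_eq)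
          also have "\<dots> < r + 2 * r"
          proof (rule add_less_le_mono)
            show "norm (x - x0) < r" using \<open>x \<in> B\<close> by (simp add: B_def dist_norm norm_minus_commute)
            have "norm (t *\<^sub>R h) \<le> 1 * norm h"
              using \<open>0 \<le> t\<close> \<open>t \<le> 1\<close> by (simp add: mult_left_le_one_le)
            then show "norm (t *\<^sub>R h) \<le> 2 * r" using True by simp
          qed
          finally show "x + t *\<^sub>R h \<in> Om"
            using sub by (auto simp: dist_norm norm_minus_commute)
        qed (simp add: B_def)
        also have "\<dots> \<le> ennreal ((2 * r)\<^sup>2 * K)"
          using True K by (intro ennreal_leI mult_right_mono power_mono) auto
        finally show ?thesis using True by simp
      qed simp
    qed
    also have "\<dots> = ennreal ((2 * r)\<^sup>2 * K * m2)"
      using K by (simp add: nn_integral_cmult_indicator fin(2) ennreal_mult'' m2_def)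
    finally have upper: "(\<integral>\<^sup>+y\<in>B. ?J y \<partial>lborel) \<le> ennreal ((2 * r)\<^sup>2 * K * m2)" .
    show False
    proof (cases "K = 0")
      case True
      with upper have "(\<integral>\<^sup>+y\<in>B. ?J y \<partial>lborel) = 0" by simp
      then have "AE y in lborel. ?J y * indicator B y = 0"
        by (subst (asm) nn_integral_0_iff_AE) auto
      then have "AE y in lborel. y \<notin> B"
      proof eventually_elim
        case (elim y)
        have "?J y \<noteq> 0" using J[of y] by (metis not_less_zero)
        with elim show ?case by (auto simp: indicator_def split: if_splits)
      qed
      then have "emeasure lborel B = 0"
        by (subst (asm) AE_iff_null_sets[symmetric]) (auto simp: null_sets_def)
      with fin(1) m show False by simp
    next
      case False
      with K have "0 < K" by simp
      have "(\<integral>\<^sup>+y. ennreal (C * K) * indicator B y \<partial>lborel) \<le> (\<integral>\<^sup>+y\<in>B. ?J y \<partial>lborel)"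
        using J by (intro nn_integral_mono mult_right_mono) (auto intro: less_imp_le)
      with upper have "ennreal (C * K * m) \<le> ennreal ((2 * r)\<^sup>2 * K * m2)"
        using \<open>0 \<le> C\<close> K m by (simp add: nn_integral_cmult_indicator fin(1) ennreal_mult'')
      then have "C * K * m \<le> (2 * r)\<^sup>2 * K * m2"
        using K by (subst (asm) ennreal_le_iff) (auto simp: m2_def)
      moreover have "C * K * m = 2 * ((2 * r)\<^sup>2 * K * m2)" using m by (simp add: C_def)
      moreover have "0 < (2 * r)\<^sup>2 * K * m2"
      proof -
        have "0 < m2" using fin(2) emeasure_open_pos[of "ball (0::'a) (2 * r)"] r by simp
        with r \<open>0 < K\<close> show ?thesis by simp
      qed
      ultimately show False by linarith
    qed
  qed
  ultimately show ?thesis unfolding poincare_on_def B_def by blast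
qed

text \<open>
  A set inherits the inequality from a set into which it can be pushed inside \<open>Om\<close>, because replacing
  \<open>U\<close> by its translate costs only a multiple of the norm of the gradient.
\<close>

lemma poincare_on_shift:
  fixes V :: "'a::euclidean_space set"
  assumes B: "poincare_on Om B" "B \<in> sets borel" and V: "open V" "\<And>x. x \<in> V \<Longrightarrow> x + h \<in> B"
    and path: "\<And>x t. x \<in> V \<Longrightarrow> 0 \<le> t \<Longrightarrow> t \<le> 1 \<Longrightarrow> x + t *\<^sub>R h \<in> Om"
  shows "poincare_on Om V"
proof -
  have [measurable]: "B \<in> sets borel" "V \<in> sets borel" using assms by auto
  obtain C where C: "0 \<le> C" and bound: "\<And>U G. borel_weak_gradient Om U G \<Longrightarrow>
      \<exists>c. deviation B U c \<le> ennreal (C * square_norm G)"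
    using B(1) unfolding poincare_on_def by auto
  have "\<exists>c. deviation V U c
      \<le> ennreal ((2 * (norm h)\<^sup>2 + 2 * C) * square_norm G)"
    if wg: "borel_weak_gradient Om U G" for U G
  proof -
    define K where "K = square_norm G"
    have K: "0 \<le> K" by (simp add: K_def)
    have [measurable]: "U \<in> borel_measurable borel" using wg by (simp add: borel_weak_gradient_def)
    obtain c where c: "deviation B U c \<le> ennreal (C * K)"
      using bound[OF wg] unfolding K_def by blast
    have "deviation V U c
        \<le> 2 * (\<integral>\<^sup>+x\<in>V. ennreal ((U x - U (x + h))\<^sup>2) \<partial>lborel) + 2 * (\<integral>\<^sup>+x\<in>V. ennreal ((U (x + h) - c)\<^sup>2) \<partial>lborel)"
      by (rule nn_integral_square_diff_le_double) auto
    also have "\<dots> \<le> 2 * ennreal ((norm h)\<^sup>2 * K) + 2 * ennreal (C * K)"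
    proof (intro add_mono mult_left_mono)
      show "(\<integral>\<^sup>+x\<in>V. ennreal ((U x - U (x + h))\<^sup>2) \<partial>lborel) \<le> ennreal ((norm h)\<^sup>2 * K)"
        using translation_estimate[OF wg V(1) path] by (simp add: K_def power2_commute[of "U _" "U (_ + _)"])
      have "(\<integral>\<^sup>+x\<in>V. ennreal ((U (x + h) - c)\<^sup>2) \<partial>lborel)
          \<le> (\<integral>\<^sup>+x. ennreal ((U (h + x) - c)\<^sup>2) * indicator B (h + x) \<partial>lborel)"
        using V(2) by (intro nn_integral_mono) (auto simp: indicator_def add.commute)
      also have "\<dots> = deviation B U c"
        by (rule nn_integral_lborel_shift) simp
      also have "\<dots> \<le> ennreal (C * K)" by (rule c)
      finally show "(\<integral>\<^sup>+x\<in>V. ennreal ((U (x + h) - c)\<^sup>2) \<partial>lborel) \<le> ennreal (C * K)" .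
    qed auto
    also have "\<dots> = ennreal ((2 * (norm h)\<^sup>2 + 2 * C) * K)"
      using C K by (simp add: ennreal_plus ennreal_mult algebra_simps)
    finally show ?thesis unfolding K_def by blast
  qed
  moreover have "0 \<le> 2 * (norm h)\<^sup>2 + 2 * C" using C by simp
  ultimately show ?thesis unfolding poincare_on_def by blast
qed

text \<open>
  On the overlap, which has positive measure, \<open>U\<close> is close to the constants of both sets, so these two
  constants are close to each other.
\<close>

lemma poincare_on_Un:
  fixes S T :: "'a::euclidean_space set"
  assumes S: "poincare_on Om S" "open S" "bounded S" and T: "poincare_on Om T" "open T" "bounded T"
    and ne: "S \<inter> T \<noteq> {}"
  shows "poincare_on Om (S \<union> T)"
proof -
  have [measurable]: "S \<in> sets borel" "T \<in> sets borel" using assms by auto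
  define m where "m = measure lborel (S \<inter> T)"
  define mT where "mT = measure lborel T"
  have fin: "emeasure lborel (S \<inter> T) = ennreal m" "emeasure lborel T = ennreal mT"
    using emeasure_bounded_finite[of "S \<inter> T"] emeasure_bounded_finite[of T] S(3) T(3)
    by (auto simp: m_def mT_def bounded_Int intro!: emeasure_eq_ennreal_measure)
  have "0 < emeasure lborel (S \<inter> T)"
    using ne S(2) T(2) by (intro emeasure_open_pos open_Int)
  then have m: "0 < m" using fin(1) by simp
  have mT: "0 \<le> mT" by (simp add: mT_def)
  obtain C where C: "0 \<le> C" and bound: "\<And>U G. borel_weak_gradient Om U G \<Longrightarrow>
      \<exists>c. deviation S U c \<le> ennreal (C * square_norm G)"
    using S(1) unfolding poincare_on_def by auto
  obtain D where D: "0 \<le> D" and bound': "\<And>U G. borel_weak_gradient Om U G \<Longrightarrow>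
      \<exists>c. deviation T U c \<le> ennreal (D * square_norm G)"
    using T(1) unfolding poincare_on_def by auto
  define E where "E = C + (2 * D + 2 * (2 * C + 2 * D) / m * mT)"
  have "\<exists>c. deviation (S \<union> T) U c \<le> ennreal (E * square_norm G)"
    if wg: "borel_weak_gradient Om U G" for U G
  proof -
    define K where "K = square_norm G"
    have K: "0 \<le> K" by (simp add: K_def)
    have [measurable]: "U \<in> borel_measurable borel" using wg by (simp add: borel_weak_gradient_def)
    obtain c where c: "deviation S U c \<le> ennreal (C * K)"
      using bound[OF wg] unfolding K_def by blast
    obtain d where d: "deviation T U d \<le> ennreal (D * K)"
      using bound'[OF wg] unfolding K_def by blast
    have "ennreal ((c - d)\<^sup>2 * m) = (\<integral>\<^sup>+x\<in>S \<inter> T. ennreal ((c - d)\<^sup>2) \<partial>lborel)"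
      using m by (simp add: nn_integral_cmult_indicator fin(1) ennreal_mult'')
    also have "\<dots> \<le> 2 * (\<integral>\<^sup>+x\<in>S \<inter> T. ennreal ((c - U x)\<^sup>2) \<partial>lborel) + 2 * deviation (S \<inter> T) U d"
      by (rule nn_integral_square_diff_le_double) auto
    also have "\<dots> \<le> 2 * ennreal (C * K) + 2 * ennreal (D * K)"
    proof (intro add_mono mult_left_mono)
      have "(\<integral>\<^sup>+x\<in>S \<inter> T. ennreal ((c - U x)\<^sup>2) \<partial>lborel) \<le> deviation S U c"
        by (intro nn_integral_mono) (auto simp: indicator_def power2_commute[of c])
      with c show "(\<integral>\<^sup>+x\<in>S \<inter> T. ennreal ((c - U x)\<^sup>2) \<partial>lborel) \<le> ennreal (C * K)" by (rule order_trans[rotated])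
      have "deviation (S \<inter> T) U d \<le> deviation T U d"
        by (intro nn_integral_mono) (auto simp: indicator_def)
      with d show "deviation (S \<inter> T) U d \<le> ennreal (D * K)" by (rule order_trans[rotated])
    qed auto
    also have "\<dots> = ennreal ((2 * C + 2 * D) * K)"
      using C D K by (simp add: ennreal_plus ennreal_mult algebra_simps)
    finally have "(c - d)\<^sup>2 * m \<le> (2 * C + 2 * D) * K"
      using C D K by (subst (asm) ennreal_le_iff) auto
    then have cd: "(c - d)\<^sup>2 \<le> (2 * C + 2 * D) / m * K"
      using m by (simp add: field_simps)
    have "deviation T U c
        \<le> 2 * deviation T U d + 2 * (\<integral>\<^sup>+x\<in>T. ennreal ((d - c)\<^sup>2) \<partial>lborel)"
      by (rule nn_integral_square_diff_le_double) auto
    also have "\<dots> \<le> 2 * ennreal (D * K) + 2 * ennreal ((2 * C + 2 * D) / m * K * mT)"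
    proof (intro add_mono mult_left_mono)
      have "(\<integral>\<^sup>+x\<in>T. ennreal ((d - c)\<^sup>2) \<partial>lborel) = ennreal ((c - d)\<^sup>2 * mT)"
        using mT by (simp add: nn_integral_cmult_indicator fin(2) ennreal_mult'' power2_commute)
      also have "\<dots> \<le> ennreal ((2 * C + 2 * D) / m * K * mT)"
        using cd mT by (intro ennreal_leI mult_right_mono)
      finally show "(\<integral>\<^sup>+x\<in>T. ennreal ((d - c)\<^sup>2) \<partial>lborel) \<le> ennreal ((2 * C + 2 * D) / m * K * mT)" .
    qed (use d in auto)
    finally have T_le: "deviation T U c
        \<le> 2 * ennreal (D * K) + 2 * ennreal ((2 * C + 2 * D) / m * K * mT)" .
    have "deviation (S \<union> T) U c
        \<le> (\<integral>\<^sup>+x. ennreal ((U x - c)\<^sup>2) * indicator S x + ennreal ((U x - c)\<^sup>2) * indicator T x \<partial>lborel)"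
      by (intro nn_integral_mono) (auto simp: indicator_def)
    also have "\<dots> = deviation S U c + deviation T U c"
      by (rule nn_integral_add) auto
    also have "\<dots> \<le> ennreal (C * K) + (2 * ennreal (D * K) + 2 * ennreal ((2 * C + 2 * D) / m * K * mT))"
      by (rule add_mono[OF c T_le])
    also have "\<dots> = ennreal (E * K)"
    proof -
      have "ennreal (x + (2 * y + 2 * z)) = ennreal x + (2 * ennreal y + 2 * ennreal z)"
        if "0 \<le> x" "0 \<le> y" "0 \<le> z" for x y z
        using that by (simp add: ennreal_plus ennreal_mult')
      moreover have "0 \<le> C * K" "0 \<le> D * K" "0 \<le> (2 * C + 2 * D) / m * K * mT"
        using C D K m mT by auto
      ultimately have "ennreal (C * K + (2 * (D * K) + 2 * ((2 * C + 2 * D) / m * K * mT)))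
          = ennreal (C * K) + (2 * ennreal (D * K) + 2 * ennreal ((2 * C + 2 * D) / m * K * mT))"
        by blast
      moreover have "E * K = C * K + (2 * (D * K) + 2 * ((2 * C + 2 * D) / m * K * mT))"
        by (simp add: E_def algebra_simps)
      ultimately show ?thesis by simp
    qed
    finally show ?thesis unfolding K_def by blast
  qed
  moreover have "0 \<le> E" using C D m mT by (simp add: E_def)
  ultimately show ?thesis unfolding poincare_on_def by blast
qed

text \<open>
  Take a maximal subfamily whose union satisfies \<open>Q\<close>. By connectedness its union meets one of the
  remaining sets, which could be added.
\<close>

lemma connected_finite_open_cover_induct:
  assumes "connected (\<Union>\<S>)" "finite \<S>" "\<S> \<noteq> {}"
    and ne: "\<And>S. S \<in> \<S> \<Longrightarrow> open S \<and> S \<noteq> {} \<and> Q S"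
    and union: "\<And>S T. open S \<Longrightarrow> open T \<Longrightarrow> Q S \<Longrightarrow> Q T \<Longrightarrow> S \<inter> T \<noteq> {} \<Longrightarrow> Q (S \<union> T)"
  shows "Q (\<Union>\<S>)"
proof -
  define \<J> where "\<J> = {J. J \<subseteq> \<S> \<and> J \<noteq> {} \<and> Q (\<Union>J)}"
  obtain S0 where "S0 \<in> \<S>" using assms(3) by blast
  then have "{S0} \<in> \<J>" using ne by (simp add: \<J>_def)
  moreover have "finite \<J>" using assms(2) by (auto simp: \<J>_def intro: finite_subset[of _ "Pow \<S>"])
  ultimately obtain J where J: "J \<in> \<J>" and max: "\<And>J'. J' \<in> \<J> \<Longrightarrow> J \<subseteq> J' \<Longrightarrow> J = J'"
    using finite_has_maximal[of \<J>] by blast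
  have "J = \<S>"
  proof (rule ccontr)
    assume "J \<noteq> \<S>"
    then obtain T where T: "T \<in> \<S>" "T \<notin> J" using J by (auto simp: \<J>_def)
    have "\<Union>J \<noteq> {}" using J ne by (auto simp: \<J>_def)
    moreover have "\<Union>(\<S> - J) \<noteq> {}" using T ne by fastforce
    moreover have op: "open (\<Union>J)" "open (\<Union>(\<S> - J))"
      using J ne by (auto simp: \<J>_def intro!: open_Union)
    moreover have "\<Union>\<S> \<subseteq> \<Union>J \<union> \<Union>(\<S> - J)" by auto
    ultimately have "\<Union>J \<inter> \<Union>(\<S> - J) \<noteq> {}"
      using connectedD[OF assms(1), of "\<Union>J" "\<Union>(\<S> - J)"] J by (auto simp: \<J>_def)
    then obtain S where S: "S \<in> \<S>" "S \<notin> J" "\<Union>J \<inter> S \<noteq> {}" by auto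
    have "Q (\<Union>J \<union> S)"
      using J S ne op(1) by (intro union) (auto simp: \<J>_def)
    then have "insert S J \<in> \<J>" using J S by (simp add: \<J>_def Un_commute)
    from max[OF this] S(2) show False by auto
  qed
  with J show ?thesis by (simp add: \<J>_def)
qed

text \<open>
  Near \<open>p\<close> the domain lies below a Lipschitz graph. Moving down by a large multiple of \<open>\<rho>\<close>, where
  large refers to the Lipschitz constant, takes \<open>Om \<inter> ball p \<rho>\<close> into a ball whose triple is still below
  the graph, along vertical segments that never leave the domain.
\<close>

lemma poincare_on_boundary:
  fixes Om :: "'a::euclidean_space set"
  assumes "open Om" "lipschitz_boundary Om" and p: "p \<in> frontier Om"
  shows "\<exists>\<rho>>0. poincare_on Om (Om \<inter> ball p \<rho>)"
proof -
  obtain e r C g where e: "norm e = 1" and r: "0 < r"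
    and lip: "C-lipschitz_on {y. y \<bullet> e = 0} (g :: 'a \<Rightarrow> real)"
    and graph: "Om \<inter> ball p r = {x \<in> ball p r. x \<bullet> e < g (x - (x \<bullet> e) *\<^sub>R e)}"
    using assms(2) p unfolding lipschitz_boundary_def by blast
  define \<pi> where "\<pi> x = x - (x \<bullet> e) *\<^sub>R e" for x
  have ee: "e \<bullet> e = 1" using e by (simp add: norm_eq_1)
  have \<pi>_shift: "\<pi> (x + s *\<^sub>R e) = \<pi> x" for x s
    by (simp add: \<pi>_def inner_add_left ee algebra_simps)
  have inner_shift: "(x + s *\<^sub>R e) \<bullet> e = x \<bullet> e + s" for x s
    by (simp add: inner_add_left ee)
  have C: "0 \<le> C" using lip by (simp add: lipschitz_on_def)
  have \<pi>_norm: "norm (\<pi> x - \<pi> y) \<le> norm (x - y)" for x y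
  proof -
    let ?z = "x - y"
    have "\<pi> x - \<pi> y = ?z - (?z \<bullet> e) *\<^sub>R e" by (simp add: \<pi>_def inner_diff_left algebra_simps)
    then have "(norm (\<pi> x - \<pi> y))\<^sup>2 = (norm ?z)\<^sup>2 - (?z \<bullet> e)\<^sup>2"
      by (simp only: power2_norm_eq_inner) (simp add: inner_diff_left inner_diff_right ee inner_commute power2_eq_square)
    then have "(norm (\<pi> x - \<pi> y))\<^sup>2 \<le> (norm ?z)\<^sup>2" by simp
    then show ?thesis by (rule power2_le_imp_le) simp
  qed
  have g\<pi>: "\<bar>g (\<pi> x) - g (\<pi> y)\<bar> \<le> C * norm (x - y)" for x y
  proof -
    have "\<pi> x \<in> {y. y \<bullet> e = 0}" "\<pi> y \<in> {y. y \<bullet> e = 0}"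
      by (simp_all add: \<pi>_def inner_diff_left ee)
    from lipschitz_onD[OF lip this] have "\<bar>g (\<pi> x) - g (\<pi> y)\<bar> \<le> C * norm (\<pi> x - \<pi> y)"
      by (simp add: dist_norm)
    also have "\<dots> \<le> C * norm (x - y)" by (rule mult_left_mono[OF \<pi>_norm C])
    finally show ?thesis .
  qed
  have below: "x \<in> Om \<longleftrightarrow> x \<bullet> e < g (\<pi> x)" if "x \<in> ball p r" for x
    using graph that unfolding \<pi>_def by blast
  \<comment> \<open>The descent \<open>s = D * \<rho>\<close> pays \<open>(C + 1) * \<rho>\<close> for the uncertainty in \<open>p_le\<close> and
    \<open>3 * (C + 1) * \<rho>\<close> for the ball of radius \<open>3 * \<rho>\<close>. The choice of \<open>\<rho>\<close> keeps everything
    in \<open>ball p r\<close>.\<close>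
  define D where "D = 4 * C + 4"
  define \<rho> where "\<rho> = r / (D + 4)"
  define s where "s = D * \<rho>"
  have D: "4 \<le> D" using C by (simp add: D_def)
  have \<rho>: "0 < \<rho>" using r D by (simp add: \<rho>_def)
  have s: "0 < s" using D \<rho> by (simp add: s_def)
  have "(D + 4) * \<rho> = r" using D by (simp add: \<rho>_def)
  then have fits: "s + 4 * \<rho> = r" by (simp add: s_def algebra_simps)
  have p_le: "p \<bullet> e \<le> g (\<pi> p) + (C + 1) * \<rho>"
  proof -
    have "p \<in> closure Om" using p by (simp add: frontier_def)
    then obtain x where x: "x \<in> Om" "dist x p < \<rho>"
      using \<rho> closure_approachable by blast
    moreover have "\<rho> < r" using fits s \<rho> by linarith
    ultimately have "x \<bullet> e < g (\<pi> x)" using below[of x] by (simp add: dist_commute)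
    moreover have "g (\<pi> x) \<le> g (\<pi> p) + C * \<rho>"
    proof -
      have "C * norm (x - p) \<le> C * \<rho>" using x C by (intro mult_left_mono) (auto simp: dist_norm)
      with g\<pi>[of x p] show ?thesis by linarith
    qed
    moreover have "p \<bullet> e - x \<bullet> e \<le> \<rho>"
    proof -
      have "\<bar>(p - x) \<bullet> e\<bar> \<le> norm (p - x) * norm e" by (rule Cauchy_Schwarz_ineq2)
      with x e show ?thesis by (simp add: dist_norm norm_minus_commute inner_diff_left)
    qed
    ultimately show ?thesis by (simp add: algebra_simps)
  qed
  define q where "q = p + (- s) *\<^sub>R e"
  have "ball q (3 * \<rho>) \<subseteq> Om"
  proof
    fix y assume "y \<in> ball q (3 * \<rho>)"
    then have y: "norm (y - q) < 3 * \<rho>" by (simp add: dist_norm norm_minus_commute)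
    have "norm (y - p) \<le> norm (y - q) + norm (q - p)"
      by (metis norm_triangle_ineq diff_add_cancel add_diff_eq)
    also have "norm (q - p) = s" using e s by (simp add: q_def)
    finally have "y \<in> ball p r" using y fits \<rho> by (simp add: dist_norm norm_minus_commute)
    moreover have "y \<bullet> e < g (\<pi> y)"
    proof -
      have "\<bar>(y - q) \<bullet> e\<bar> \<le> norm (y - q) * norm e" by (rule Cauchy_Schwarz_ineq2)
      then have "y \<bullet> e < q \<bullet> e + 3 * \<rho>" using y e by (simp add: inner_diff_left)
      moreover have "q \<bullet> e = p \<bullet> e - s" unfolding q_def inner_shift by simp
      moreover have "g (\<pi> p) \<le> g (\<pi> y) + C * (3 * \<rho>)"
      proof -
        have "C * norm (q - y) \<le> C * (3 * \<rho>)"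
          using y C by (intro mult_left_mono) (auto simp: norm_minus_commute)
        moreover have "\<pi> q = \<pi> p" unfolding q_def by (rule \<pi>_shift)
        ultimately show ?thesis using g\<pi>[of q y] by simp
      qed
      moreover have "s = 4 * C * \<rho> + 4 * \<rho>" by (simp add: s_def D_def algebra_simps)
      ultimately show ?thesis using p_le C \<rho> by (simp add: algebra_simps) 
    qed
    ultimately show "y \<in> Om" using below by blast
  qed
  then have q: "poincare_on Om (ball q \<rho>)" using \<rho> by (intro poincare_on_ball)
  have "poincare_on Om (Om \<inter> ball p \<rho>)"
  proof (rule poincare_on_shift[OF q, where h = "(- s) *\<^sub>R e"])
    show "open (Om \<inter> ball p \<rho>)" using assms(1) by auto
    fix x assume x: "x \<in> Om \<inter> ball p \<rho>"
    then show "x + (- s) *\<^sub>R e \<in> ball q \<rho>" by (simp add: q_def dist_norm algebra_simps)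
    fix t :: real assume t: "0 \<le> t" "t \<le> 1"
    have eq: "x + t *\<^sub>R (- s) *\<^sub>R e = x + (- (t * s)) *\<^sub>R e" by simp
    have "x \<in> ball p r" using x fits s \<rho> by auto
    then have "x \<bullet> e < g (\<pi> x)" using below x by blast
    moreover have "0 \<le> t * s" using t s by simp
    ultimately have "(x + (- (t * s)) *\<^sub>R e) \<bullet> e < g (\<pi> (x + (- (t * s)) *\<^sub>R e))"
      unfolding inner_shift \<pi>_shift by linarith
    moreover have "x + (- (t * s)) *\<^sub>R e \<in> ball p r"
    proof -
      have "norm (x + (- (t * s)) *\<^sub>R e - p) \<le> norm (x - p) + norm ((- (t * s)) *\<^sub>R e)"
        by (metis norm_triangle_ineq add.commute add_diff_eq)
      moreover have "norm ((- (t * s)) *\<^sub>R e) \<le> s"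
        using e t s by (simp add: abs_mult mult_left_le_one_le)
      moreover have "norm (x - p) < \<rho>" using x by (simp add: dist_norm norm_minus_commute)
      ultimately show ?thesis using fits \<rho> by (simp add: dist_norm norm_minus_commute)
    qed
    ultimately show "x + t *\<^sub>R (- s) *\<^sub>R e \<in> Om" using below eq by simp
  qed simp
  with \<rho> show ?thesis by blast
qed

lemma poincare_on_lipschitz_domain:
  fixes Om :: "'a::euclidean_space set"
  assumes "lipschitz_domain Om"
  shows "poincare_on Om Om"
proof -
  have Om: "open Om" "connected Om" "Om \<noteq> {}" "bounded Om" "lipschitz_boundary Om"
    using assms by (auto simp: lipschitz_domain_def)
  have "\<exists>\<rho>>0. poincare_on Om (Om \<inter> ball p \<rho>)" if "p \<in> closure Om" for p
  proof (cases "p \<in> Om")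
    case True
    then obtain r where r: "0 < r" "ball p r \<subseteq> Om" using Om(1) open_contains_ball by blast
    then have "poincare_on Om (ball p (r / 3))" by (intro poincare_on_ball) auto
    then have "poincare_on Om (Om \<inter> ball p (r / 3))" by (rule poincare_on_subset) auto
    with r show ?thesis by (intro exI[of _ "r / 3"]) auto
  next
    case False
    with that have "p \<in> frontier Om" using Om(1) by (simp add: frontier_def interior_open)
    then show ?thesis by (rule poincare_on_boundary[OF Om(1,5)])
  qed
  then obtain \<rho> where \<rho>: "\<And>p. p \<in> closure Om \<Longrightarrow> 0 < \<rho> p \<and> poincare_on Om (Om \<inter> ball p (\<rho> p))"
    by metis
  have "compact (closure Om)" using Om(4) by simp
  then obtain P where P: "P \<subseteq> closure Om" "finite P" "closure Om \<subseteq> (\<Union>p\<in>P. ball p (\<rho> p))"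
    by (rule compactE_image[of _ "closure Om" "\<lambda>p. ball p (\<rho> p)"]) (use \<rho> in force)+
  define \<S> where "\<S> = (\<lambda>p. Om \<inter> ball p (\<rho> p)) ` P"
  have cover: "\<Union>\<S> = Om" using P(3) closure_subset[of Om] unfolding \<S>_def by blast
  have "Om \<inter> ball p (\<rho> p) \<noteq> {}" if "p \<in> P" for p
  proof -
    have "p \<in> closure Om" "0 < \<rho> p" using that P(1) \<rho> by auto
    then obtain y where "y \<in> Om" "dist y p < \<rho> p" using closure_approachable by blast
    then show ?thesis by (auto simp: dist_commute)
  qed
  then have "open S \<and> S \<noteq> {} \<and> (bounded S \<and> poincare_on Om S)" if "S \<in> \<S>" for S
    using that P(1) \<rho> Om(1) unfolding \<S>_def by (auto intro: bounded_Int)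
  moreover have "\<S> \<noteq> {}" "finite \<S>" using cover Om(3) P(2) by (auto simp: \<S>_def)
  ultimately have "bounded (\<Union>\<S>) \<and> poincare_on Om (\<Union>\<S>)"
    using cover Om(2)
    by (intro connected_finite_open_cover_induct[where Q = "\<lambda>S. bounded S \<and> poincare_on Om S"])
      (auto intro: poincare_on_Un)
  with cover show ?thesis by simp
qed

section \<open>Weak gradients of functions on a domain\<close>

lemma integral_lebesgue_on_eq_lborel:
  fixes f :: "'a::euclidean_space \<Rightarrow> 'b::{banach, second_countable_topology}"
  assumes "open Om" "f \<in> borel_measurable borel" "\<And>x. x \<notin> Om \<Longrightarrow> f x = 0"
  shows "(\<integral>x. f x \<partial>lebesgue_on Om) = (\<integral>x. f x \<partial>lborel)"
    and "integrable (lebesgue_on Om) f \<longleftrightarrow> integrable lborel f"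
proof -
  have "(\<lambda>x. indicator Om x *\<^sub>R f x) = f" using assms(3) by (auto simp: indicator_def)
  moreover have "Om \<inter> space lebesgue \<in> sets lebesgue" using assms(1) by auto
  ultimately show "(\<integral>x. f x \<partial>lebesgue_on Om) = (\<integral>x. f x \<partial>lborel)"
      "integrable (lebesgue_on Om) f \<longleftrightarrow> integrable lborel f"
    using assms(2) by (simp_all add: integral_restrict_space integrable_restrict_space
        integral_completion integrable_completion)
qed

lemma L2_borel_representative:
  fixes u :: "'a::euclidean_space \<Rightarrow> 'b::euclidean_space"
  assumes Om: "open Om" and u: "u \<in> L2 Om"
  obtains U where "U \<in> borel_measurable borel" "\<And>x. x \<notin> Om \<Longrightarrow> U x = 0"
    "AE x in lebesgue_on Om. u x = U x" "U \<in> L2 Om" "integrable lborel (\<lambda>x. (norm (U x))\<^sup>2)"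
proof -
  have Om_sets: "Om \<inter> space lebesgue \<in> sets lebesgue" using Om by auto
  have [measurable]: "Om \<in> sets borel" using Om by simp
  have "\<exists>f'\<in>borel_measurable lborel. AE x in lborel. (if x \<in> Om then u x \<bullet> b else 0) = f' x" for b
  proof (rule completion_ex_borel_measurable_real)
    have "(\<lambda>x. u x \<bullet> b) \<in> borel_measurable (lebesgue_on Om)"
      using L2_measurable[OF u] by measurable
    then show "(\<lambda>x. if x \<in> Om then u x \<bullet> b else 0) \<in> borel_measurable lebesgue"
      by (subst (asm) measurable_restrict_space_iff[OF Om_sets]) auto
  qed
  then have "\<forall>b. \<exists>f'. f' \<in> borel_measurable borel \<and> (AE x in lborel. (if x \<in> Om then u x \<bullet> b else 0) = f' x)"
    by (simp add: Bex_def)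
  from choice[OF this] obtain f' where f'[measurable]: "\<And>b. f' b \<in> borel_measurable borel"
    and ae: "\<And>b. AE x in lborel. (if x \<in> Om then u x \<bullet> b else 0) = f' b x"
    by blast
  define U where "U x = (if x \<in> Om then \<Sum>b\<in>Basis. f' b x *\<^sub>R b else 0)" for x
  have U[measurable]: "U \<in> borel_measurable borel" unfolding U_def by measurable
  have zero: "U x = 0" if "x \<notin> Om" for x using that by (simp add: U_def)
  have "AE x in lborel. \<forall>b\<in>Basis. (if x \<in> Om then u x \<bullet> b else 0) = f' b x"
    by (intro AE_finite_allI ae) auto
  then have "AE x in lborel. x \<in> Om \<longrightarrow> u x = U x"
  proof eventually_elim
    case (elim x)
    show ?case
    proof
      assume "x \<in> Om"
      then have "U x = (\<Sum>b\<in>Basis. (u x \<bullet> b) *\<^sub>R b)"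
        using elim unfolding U_def by (auto intro!: sum.cong)
      then show "u x = U x" by (simp add: euclidean_representation)
    qed
  qed
  then have "AE x in lebesgue. x \<in> Om \<longrightarrow> u x = U x" by (rule AE_completion)
  then have eq: "AE x in lebesgue_on Om. u x = U x"
    by (subst AE_restrict_space_iff[OF Om_sets])
  have U_meas: "U \<in> borel_measurable (lebesgue_on Om)"
    using U by (intro measurable_restrict_space1 measurable_completion) simp
  have "integrable (lebesgue_on Om) (\<lambda>x. (norm (U x))\<^sup>2)"
  proof (rule integrable_cong_AE_imp[OF L2_integrable_square[OF u]])
    show "AE x in lebesgue_on Om. (norm (u x))\<^sup>2 = (norm (U x))\<^sup>2"
      using eq by eventually_elim simp
  qed (use U_meas in measurable)
  then have U_L2: "U \<in> L2 Om" "integrable lborel (\<lambda>x. (norm (U x))\<^sup>2)"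
    using U_meas integral_lebesgue_on_eq_lborel(2)[OF Om, of "\<lambda>x. (norm (U x))\<^sup>2"] zero
    by (simp_all add: L2_def)
  show ?thesis by (rule that[OF U zero eq U_L2])
qed

lemma L2_bounded:
  fixes u :: "'a::euclidean_space \<Rightarrow> 'b::euclidean_space"
  assumes Om: "open Om" "bounded Om" and u: "u \<in> borel_measurable (lebesgue_on Om)"
    and b: "\<And>x. norm (u x) \<le> b"
  shows "u \<in> L2 Om"
proof -
  interpret finite_measure "lebesgue_on Om"
    using Om by (intro finite_measure_lebesgue_on lmeasurable_open)
  have "integrable (lebesgue_on Om) (\<lambda>x. (norm (u x))\<^sup>2)"
  proof (rule integrable_const_bound[where B = "b\<^sup>2"])
    show "AE x in lebesgue_on Om. norm ((norm (u x))\<^sup>2) \<le> b\<^sup>2"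
      using b by (intro AE_I2) (simp add: power_mono)
  qed (use u in measurable)
  with u show ?thesis by (simp add: L2_def)
qed

lemma test_function_L2:
  fixes Om :: "'a::euclidean_space set"
  assumes Om: "open Om" "bounded Om" and test: "test_function Om \<psi> D\<psi>"
  shows "\<psi> \<in> L2 Om" "D\<psi> \<in> L2 Om"
proof -
  obtain K where K: "compact K" "\<And>x. x \<notin> K \<Longrightarrow> \<psi> x = 0" "\<And>x. x \<notin> K \<Longrightarrow> D\<psi> x = 0"
    and cont: "continuous_on UNIV \<psi>" "continuous_on UNIV D\<psi>"
    using test_functionE[OF test] by metis
  have meas: "f \<in> borel_measurable (lebesgue_on Om)" if "continuous_on UNIV f"
    for f :: "'a \<Rightarrow> 'c::euclidean_space"
    using borel_measurable_continuous_onI[OF that]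
    by (intro measurable_restrict_space1 measurable_completion) simp
  show "\<psi> \<in> L2 Om"
    using bounded_of_compact_support[OF cont(1) K(1,2)] L2_bounded[OF Om meas[OF cont(1)]] by metis
  show "D\<psi> \<in> L2 Om"
    using bounded_of_compact_support[OF cont(2) K(1,3)] L2_bounded[OF Om meas[OF cont(2)]] by metis
qed

lemma L2_norm_bound_mult:
  fixes f :: "'a::euclidean_space \<Rightarrow> 'b::euclidean_space" and g :: "'a \<Rightarrow> 'c::euclidean_space"
  assumes "f \<in> L2 Om" "g \<in> borel_measurable (lebesgue_on Om)" "\<And>x. norm (g x) \<le> norm (f x) * b"
  shows "g \<in> L2 Om"
proof -
  have "integrable (lebesgue_on Om) (\<lambda>x. (norm (g x))\<^sup>2)"
  proof (rule Bochner_Integration.integrable_bound)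
    show "integrable (lebesgue_on Om) (\<lambda>x. (norm (f x))\<^sup>2 * b\<^sup>2)"
      using L2_integrable_square[OF assms(1)] by simp
    show "AE x in lebesgue_on Om. norm ((norm (g x))\<^sup>2) \<le> norm ((norm (f x))\<^sup>2 * b\<^sup>2)"
    proof (intro AE_I2)
      fix x
      have "(norm (g x))\<^sup>2 \<le> (norm (f x) * b)\<^sup>2" by (intro power_mono assms(3)) simp
      then show "norm ((norm (g x))\<^sup>2) \<le> norm ((norm (f x))\<^sup>2 * b\<^sup>2)" by (simp add: power_mult_distrib)
    qed
  qed (use assms(2) in measurable)
  with assms(2) show ?thesis by (simp add: L2_def)
qed

lemma L2_inner_const:
  fixes g :: "'a::euclidean_space \<Rightarrow> 'b::euclidean_space"
  assumes "g \<in> L2 Om" shows "(\<lambda>x. g x \<bullet> e) \<in> L2 Om"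
  by (rule L2_norm_bound_mult[OF assms, of _ "norm e"])
    (use L2_measurable[OF assms] Cauchy_Schwarz_ineq2 in \<open>auto\<close>)

lemma L2_scaleR_const:
  fixes g :: "'a::euclidean_space \<Rightarrow> real" and e :: "'b::euclidean_space"
  assumes "g \<in> L2 Om" shows "(\<lambda>x. g x *\<^sub>R e) \<in> L2 Om"
  by (rule L2_norm_bound_mult[OF assms, of _ "norm e"]) (use L2_measurable[OF assms] in auto)

lemma L2_integrable_scaleR:
  fixes g :: "'a::euclidean_space \<Rightarrow> 'b::euclidean_space"
  assumes "u \<in> L2 Om" "g \<in> L2 Om"
  shows "integrable (lebesgue_on Om) (\<lambda>x. u x *\<^sub>R g x)"
proof (rule Bochner_Integration.integrable_bound)
  show "integrable (lebesgue_on Om) (\<lambda>x. (norm (u x))\<^sup>2 / 2 + (norm (g x))\<^sup>2 / 2)"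
    using assms by (intro Bochner_Integration.integrable_add integrable_divide_zero L2_integrable_square) auto
  show "(\<lambda>x. u x *\<^sub>R g x) \<in> borel_measurable (lebesgue_on Om)"
    using assms by (intro borel_measurable_scaleR L2_measurable)
  have "norm (u x *\<^sub>R g x) \<le> (norm (u x))\<^sup>2 / 2 + (norm (g x))\<^sup>2 / 2" for x
    using inner_le_half_sum_squares[of "norm (u x)" "norm (g x)"] by (simp add: abs_mult)
  then show "AE x in lebesgue_on Om. norm (u x *\<^sub>R g x) \<le> norm ((norm (u x))\<^sup>2 / 2 + (norm (g x))\<^sup>2 / 2)"
    by (intro AE_I2) (auto intro: order_trans)
qed

text \<open>
  In a fixed direction \<open>e\<close> the vector identity becomes one between inner products of \<open>L\<^sup>2\<close>, to which
  linearity and convergence in norm apply directly.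
\<close>

lemma has_weak_gradient_iff:
  fixes Om :: "'a::euclidean_space set"
  assumes Om: "open Om" "bounded Om" and u: "u \<in> L2 Om" "g \<in> L2 Om"
  shows "has_weak_gradient Om u g \<longleftrightarrow>
    (\<forall>\<psi> D\<psi> e. test_function Om \<psi> D\<psi> \<longrightarrow>
       L2_inner Om u (\<lambda>x. D\<psi> x \<bullet> e) = - L2_inner Om g (\<lambda>x. \<psi> x *\<^sub>R e))"
proof -
  have "(\<integral>x. u x *\<^sub>R D\<psi> x \<partial>lebesgue_on Om) = - (\<integral>x. \<psi> x *\<^sub>R g x \<partial>lebesgue_on Om) \<longleftrightarrow>
      (\<forall>e. L2_inner Om u (\<lambda>x. D\<psi> x \<bullet> e) = - L2_inner Om g (\<lambda>x. \<psi> x *\<^sub>R e))"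
    if test: "test_function Om \<psi> D\<psi>" for \<psi> D\<psi>
  proof -
    note L = test_function_L2[OF Om test]
    have "L2_inner Om u (\<lambda>x. D\<psi> x \<bullet> e) = (\<integral>x. u x *\<^sub>R D\<psi> x \<partial>lebesgue_on Om) \<bullet> e" for e
      using integral_inner_left[OF L2_integrable_scaleR[OF u(1) L(2)], of e]
      by (simp add: L2_inner_def)
    moreover have "L2_inner Om g (\<lambda>x. \<psi> x *\<^sub>R e) = (\<integral>x. \<psi> x *\<^sub>R g x \<partial>lebesgue_on Om) \<bullet> e" for e
      using integral_inner_left[OF L2_integrable_scaleR[OF L(1) u(2)], of e]
      by (simp add: L2_inner_def)
    ultimately show ?thesis
      by (simp only: inner_minus_left[symmetric] vector_eq_rdot)
  qed
  then show ?thesis unfolding has_weak_gradient_def by blast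
qed

lemma borel_weak_gradient_of_weak_gradient:
  fixes Om :: "'a::euclidean_space set"
  assumes Om: "open Om" "bounded Om" and u: "u \<in> L2 Om" "g \<in> L2 Om" "has_weak_gradient Om u g"
  obtains U G where "borel_weak_gradient Om U G"
    "U \<in> L2 Om" "G \<in> L2 Om" "\<forall>x. x \<notin> Om \<longrightarrow> G x = 0"
    "AE x in lebesgue_on Om. u x = U x" "AE x in lebesgue_on Om. g x = G x"
proof -
  obtain U where U[measurable]: "U \<in> borel_measurable borel" and U0: "\<And>x. x \<notin> Om \<Longrightarrow> U x = 0"
    and U_eq: "AE x in lebesgue_on Om. u x = U x" and U_L2: "U \<in> L2 Om"
    and U_int: "integrable lborel (\<lambda>x. (norm (U x))\<^sup>2)"
    using L2_borel_representative[OF Om(1) u(1)] by blast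
  obtain G where G[measurable]: "G \<in> borel_measurable borel" and G0: "\<And>x. x \<notin> Om \<Longrightarrow> G x = 0"
    and G_eq: "AE x in lebesgue_on Om. g x = G x" and G_L2: "G \<in> L2 Om"
    and G_int: "integrable lborel (\<lambda>x. (norm (G x))\<^sup>2)"
    using L2_borel_representative[OF Om(1) u(2)] by blast
  have "(\<integral>x. U x * (D\<psi> x \<bullet> e) \<partial>lborel) = - (\<integral>x. \<psi> x * (G x \<bullet> e) \<partial>lborel)"
    if test: "test_function Om \<psi> D\<psi>" for \<psi> D\<psi> e
  proof -
    obtain K where cont: "continuous_on UNIV \<psi>" "continuous_on UNIV D\<psi>"
      using test_functionE[OF test] by metis
    then have [measurable]: "\<psi> \<in> borel_measurable borel" "D\<psi> \<in> borel_measurable borel"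
      by (auto intro: borel_measurable_continuous_onI)
    note L = test_function_L2[OF Om test]
    have "(\<integral>x. U x * (D\<psi> x \<bullet> e) \<partial>lborel) = L2_inner Om U (\<lambda>x. D\<psi> x \<bullet> e)"
      unfolding L2_inner_def inner_real_def
      by (rule integral_lebesgue_on_eq_lborel(1)[symmetric, OF Om(1)]) (auto simp: U0)
    also have "\<dots> = L2_inner Om u (\<lambda>x. D\<psi> x \<bullet> e)"
      using U_eq by (intro L2_inner_cong_AE U_L2 u L2_inner_const L) (auto elim: AE_mp)
    also have "\<dots> = - L2_inner Om g (\<lambda>x. \<psi> x *\<^sub>R e)"
      using u(3) test unfolding has_weak_gradient_iff[OF Om u(1,2)] by blast
    also have "L2_inner Om g (\<lambda>x. \<psi> x *\<^sub>R e) = L2_inner Om G (\<lambda>x. \<psi> x *\<^sub>R e)"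
      using G_eq by (intro L2_inner_cong_AE G_L2 u L2_scaleR_const L) auto
    also have "\<dots> = (\<integral>x. \<psi> x * (G x \<bullet> e) \<partial>lebesgue_on Om)"
      by (simp add: L2_inner_def)
    also have "\<dots> = (\<integral>x. \<psi> x * (G x \<bullet> e) \<partial>lborel)"
      by (rule integral_lebesgue_on_eq_lborel(1)[OF Om(1)]) (auto simp: G0)
    finally show ?thesis .
  qed
  then have "borel_weak_gradient Om U G"
    unfolding borel_weak_gradient_def using U_int G_int by simp
  then show ?thesis using G0 by (intro that[OF _ U_L2 G_L2 _ U_eq G_eq]) auto
qed

text \<open>
  The difference of two weak gradients is orthogonal to all test functions, so it vanishes by duality
  with \<open>M = 0\<close>.
\<close>

lemma weak_gradient_unique:
  fixes Om :: "'a::euclidean_space set"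
  assumes Om: "open Om" "bounded Om" and u: "u \<in> L2 Om"
    and g: "g \<in> L2 Om" "has_weak_gradient Om u g" and g': "g' \<in> L2 Om" "has_weak_gradient Om u g'"
  shows "AE x in lebesgue_on Om. g x = g' x"
proof -
  have Om_sets: "Om \<inter> space lebesgue \<in> sets lebesgue" and [measurable]: "Om \<in> sets borel"
    using Om(1) by auto
  have d: "(\<lambda>x. g x - g' x) \<in> L2 Om" by (rule L2_diff[OF g(1) g'(1)])
  obtain D where D[measurable]: "D \<in> borel_measurable borel" and D0: "\<And>x. x \<notin> Om \<Longrightarrow> D x = 0"
    and D_eq: "AE x in lebesgue_on Om. g x - g' x = D x" and D_L2: "D \<in> L2 Om"
    and D_int: "integrable lborel (\<lambda>x. (norm (D x))\<^sup>2)"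
    using L2_borel_representative[OF Om(1) d] by blast
  have "AE x in lborel. x \<in> Om \<longrightarrow> D x \<bullet> b = 0" for b
  proof -
    have "(\<integral>\<^sup>+x\<in>Om. ennreal ((D x \<bullet> b)\<^sup>2) \<partial>lborel) \<le> ennreal (0\<^sup>2)"
    proof (rule L2_norm_le_by_duality[OF Om(1)])
      show "integrable lborel (\<lambda>x. (D x \<bullet> b)\<^sup>2)"
      proof (rule Bochner_Integration.integrable_bound)
        show "integrable lborel (\<lambda>x. (norm (D x))\<^sup>2 * (norm b)\<^sup>2)" using D_int by simp
        show "AE x in lborel. norm ((D x \<bullet> b)\<^sup>2) \<le> norm ((norm (D x))\<^sup>2 * (norm b)\<^sup>2)"
          by (intro AE_I2) (simp add: Cauchy_Schwarz_ineq power2_norm_eq_inner)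
      qed simp
      fix \<psi> D\<psi> assume test: "test_function Om \<psi> D\<psi>"
      then have [measurable]: "\<psi> \<in> borel_measurable borel"
        using test_functionE[OF test] borel_measurable_continuous_onI by metis
      note L = L2_scaleR_const[OF test_function_L2(1)[OF Om test], of b]
      have "(\<integral>x. (D x \<bullet> b) * \<psi> x \<partial>lborel) = L2_inner Om D (\<lambda>x. \<psi> x *\<^sub>R b)"
        unfolding L2_inner_def
        by (subst integral_lebesgue_on_eq_lborel(1)[OF Om(1)]) (auto simp: D0 mult.commute)
      also have "\<dots> = L2_inner Om (\<lambda>x. g x - g' x) (\<lambda>x. \<psi> x *\<^sub>R b)"
        using D_eq by (intro L2_inner_cong_AE D_L2 d L) auto
      also have "\<dots> = L2_inner Om g (\<lambda>x. \<psi> x *\<^sub>R b) - L2_inner Om g' (\<lambda>x. \<psi> x *\<^sub>R b)"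
        by (rule L2_inner_diff_left[OF g(1) g'(1) L])
      also have "\<dots> = 0"
      proof -
        have "L2_inner Om u (\<lambda>x. D\<psi> x \<bullet> b) = - L2_inner Om g (\<lambda>x. \<psi> x *\<^sub>R b)"
          using g(2) test unfolding has_weak_gradient_iff[OF Om u g(1)] by blast
        moreover have "L2_inner Om u (\<lambda>x. D\<psi> x \<bullet> b) = - L2_inner Om g' (\<lambda>x. \<psi> x *\<^sub>R b)"
          using g'(2) test unfolding has_weak_gradient_iff[OF Om u g'(1)] by blast
        ultimately show ?thesis by linarith
      qed
      finally show "(\<integral>x. (D x \<bullet> b) * \<psi> x \<partial>lborel) \<le> 0 * sqrt (\<integral>x. (\<psi> x)\<^sup>2 \<partial>lborel)" by simp
    qed auto
    then have "(\<integral>\<^sup>+x\<in>Om. ennreal ((D x \<bullet> b)\<^sup>2) \<partial>lborel) = 0" by simp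
    then have "AE x in lborel. ennreal ((D x \<bullet> b)\<^sup>2) * indicator Om x = 0"
      by (subst (asm) nn_integral_0_iff_AE) auto
    then show ?thesis by eventually_elim (auto simp: indicator_def split: if_splits)
  qed
  then have "AE x in lborel. \<forall>b\<in>Basis. x \<in> Om \<longrightarrow> D x \<bullet> b = 0"
    by (intro AE_finite_allI) auto
  then have "AE x in lborel. x \<in> Om \<longrightarrow> D x = 0"
    by eventually_elim (auto intro: euclidean_eqI)
  then have "AE x in lebesgue. x \<in> Om \<longrightarrow> D x = 0" by (rule AE_completion)
  then have "AE x in lebesgue_on Om. D x = 0"
    by (subst AE_restrict_space_iff[OF Om_sets])
  with D_eq show ?thesis by eventually_elim simp
qed

lemma H1_L2: "u \<in> H1 Om \<Longrightarrow> u \<in> L2 Om"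
  by (simp add: H1_def)

lemma weak_gradient_L2: "u \<in> H1 Om \<Longrightarrow> weak_gradient Om u \<in> L2 Om"
  and has_weak_gradient_weak_gradient: "u \<in> H1 Om \<Longrightarrow> has_weak_gradient Om u (weak_gradient Om u)"
proof -
  assume "u \<in> H1 Om"
  then have "\<exists>g. g \<in> L2 Om \<and> has_weak_gradient Om u g" by (auto simp: H1_def)
  from someI_ex[OF this] show "weak_gradient Om u \<in> L2 Om" "has_weak_gradient Om u (weak_gradient Om u)"
    by (simp_all add: weak_gradient_def)
qed

lemma H1I: "u \<in> L2 Om \<Longrightarrow> g \<in> L2 Om \<Longrightarrow> has_weak_gradient Om u g \<Longrightarrow> u \<in> H1 Om"
  by (auto simp: H1_def)

lemma weak_gradient_eq:
  assumes "open Om" "bounded Om" "u \<in> L2 Om" "g \<in> L2 Om" "has_weak_gradient Om u g"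
  shows "AE x in lebesgue_on Om. weak_gradient Om u x = g x"
  using assms by (intro weak_gradient_unique[of Om u] weak_gradient_L2 has_weak_gradient_weak_gradient H1I)

lemma has_weak_gradient_combine:
  fixes Om :: "'a::euclidean_space set"
  assumes Om: "open Om" "bounded Om"
    and u: "u \<in> L2 Om" "g \<in> L2 Om" "has_weak_gradient Om u g"
    and v: "v \<in> L2 Om" "g' \<in> L2 Om" "has_weak_gradient Om v g'"
  shows "has_weak_gradient Om (\<lambda>x. u x + c * v x) (\<lambda>x. g x + c *\<^sub>R g' x)"
proof -
  have L: "(\<lambda>x. c * v x) \<in> L2 Om" "(\<lambda>x. c *\<^sub>R g' x) \<in> L2 Om"
    using L2_mult[OF v(1)] L2_scaleR[OF v(2)] .
  show ?thesis
    using u(3) v(3)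
    unfolding has_weak_gradient_iff[OF Om u(1,2)] has_weak_gradient_iff[OF Om v(1,2)]
      has_weak_gradient_iff[OF Om L2_add[OF u(1) L(1)] L2_add[OF u(2) L(2)]]
    by (simp add: L2_inner_add_left u v L L2_inner_const L2_scaleR_const test_function_L2[OF Om]
        L2_inner_mult_left L2_inner_scaleR_left)
qed

lemma H1_combine:
  fixes Om :: "'a::euclidean_space set"
  assumes Om: "open Om" "bounded Om" and u: "u \<in> H1 Om" and v: "v \<in> H1 Om"
  shows "(\<lambda>x. u x + c * v x) \<in> H1 Om"
    and "AE x in lebesgue_on Om. weak_gradient Om (\<lambda>x. u x + c * v x) x
      = weak_gradient Om u x + c *\<^sub>R weak_gradient Om v x"
proof -
  note wg = has_weak_gradient_combine[OF Om H1_L2[OF u] weak_gradient_L2[OF u]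
      has_weak_gradient_weak_gradient[OF u] H1_L2[OF v] weak_gradient_L2[OF v]
      has_weak_gradient_weak_gradient[OF v], of c]
  have L: "(\<lambda>x. u x + c * v x) \<in> L2 Om" "(\<lambda>x. weak_gradient Om u x + c *\<^sub>R weak_gradient Om v x) \<in> L2 Om"
    using L2_add[OF H1_L2[OF u] L2_mult[OF H1_L2[OF v]]]
      L2_add[OF weak_gradient_L2[OF u] L2_scaleR[OF weak_gradient_L2[OF v]]] .
  show "(\<lambda>x. u x + c * v x) \<in> H1 Om" by (rule H1I[OF L wg])
  show "AE x in lebesgue_on Om. weak_gradient Om (\<lambda>x. u x + c * v x) x
      = weak_gradient Om u x + c *\<^sub>R weak_gradient Om v x"
    by (rule weak_gradient_eq[OF Om L wg])
qed

text \<open>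
  The integral of a translate of \<open>\<psi>\<close> does not depend on the translation; its derivative is the integral
  in question. The indicator \<open>U\<close> of a large ball makes the constant weight 1 square-integrable.
\<close>

lemma integral_test_gradient_zero:
  fixes Om :: "'a::euclidean_space set"
  assumes test: "test_function Om \<psi> D\<psi>"
  shows "(\<integral>x. D\<psi> x \<bullet> e \<partial>lborel) = 0"
proof -
  obtain K where K: "compact K" "\<And>x. x \<notin> K \<Longrightarrow> \<psi> x = 0" "\<And>x. x \<notin> K \<Longrightarrow> D\<psi> x = 0"
    and cont: "continuous_on UNIV \<psi>"
    using test_functionE[OF test] by metis
  have [measurable]: "\<psi> \<in> borel_measurable borel" using cont by (rule borel_measurable_continuous_onI)
  obtain R where R: "\<And>x. x \<in> K \<Longrightarrow> norm x \<le> R"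
    using compact_imp_bounded[OF K(1)] unfolding bounded_iff by blast
  define U :: "'a \<Rightarrow> real" where "U = indicator (cball 0 (R + norm e))"
  have U_one: "U x = 1" if "norm x \<le> R + norm e" for x using that by (simp add: U_def)
  have "(U x)\<^sup>2 = U x" for x by (simp add: U_def indicator_def)
  then have U: "U \<in> borel_measurable borel" "integrable lborel (\<lambda>x. (U x)\<^sup>2)"
    by (auto simp: U_def integrable_indicator_compact intro!: borel_measurable_indicator)
  let ?P = "\<lambda>t. \<integral>y. U y * \<psi> (y - t *\<^sub>R e) \<partial>lborel"
  have "?P t = (\<integral>y. \<psi> y \<partial>lborel)" if "\<bar>t\<bar> < 1" for t
  proof -
    have "U y * \<psi> (y - t *\<^sub>R e) = \<psi> (- t *\<^sub>R e + y)" for y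
    proof (cases "y - t *\<^sub>R e \<in> K")
      case True
      have "norm y \<le> norm (y - t *\<^sub>R e) + norm (t *\<^sub>R e)"
        by (metis diff_add_cancel norm_triangle_ineq)
      also have "norm (t *\<^sub>R e) \<le> 1 * norm e"
        unfolding norm_scaleR using that by (intro mult_right_mono) auto
      finally have "U y = 1" using R[OF True] by (intro U_one) linarith
      then show ?thesis by (simp add: algebra_simps)
    qed (simp add: K(2) algebra_simps)
    then have "?P t = (\<integral>y. \<psi> (- t *\<^sub>R e + y) \<partial>lborel)" by (simp only:)
    also have "\<dots> = (\<integral>y. \<psi> y \<partial>lborel)" by (rule integral_lborel_shift) simp
    finally show ?thesis .
  qed
  then have deriv_zero: "(?P has_real_derivative 0) (at 0)"
    by (intro has_field_derivative_transform_within_open[OF DERIV_const, of "{-1<..<1}"]) auto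
  have "(?P has_real_derivative - (\<integral>y. U y * (D\<psi> (y - 0 *\<^sub>R e) \<bullet> e) \<partial>lborel)) (at 0)"
    by (rule translated_pairing_derivative[OF U test])
  from DERIV_unique[OF deriv_zero this] have "(\<integral>y. U y * (D\<psi> y \<bullet> e) \<partial>lborel) = 0"
    by simp
  moreover have "U y * (D\<psi> y \<bullet> e) = D\<psi> y \<bullet> e" for y
  proof (cases "y \<in> K")
    case True
    then have "U y = 1" using R[OF True] norm_ge_zero[of e] by (intro U_one) linarith
    then show ?thesis by simp
  qed (simp add: K(3))
  ultimately show ?thesis by simp
qed

lemma has_weak_gradient_const:
  fixes Om :: "'a::euclidean_space set"
  assumes Om: "open Om" "bounded Om"
  shows "has_weak_gradient Om (\<lambda>x. c) (\<lambda>x. 0)"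
proof -
  have "L2_inner Om (\<lambda>x. c) (\<lambda>x. D\<psi> x \<bullet> e) = 0" if test: "test_function Om \<psi> D\<psi>" for \<psi> D\<psi> e
  proof -
    obtain K where K: "K \<subseteq> Om" "\<And>x. x \<notin> K \<Longrightarrow> D\<psi> x = 0" and cont: "continuous_on UNIV D\<psi>"
      using test_functionE[OF test] by metis
    have [measurable]: "D\<psi> \<in> borel_measurable borel" using cont by (rule borel_measurable_continuous_onI)
    have "(\<integral>x. D\<psi> x \<bullet> e \<partial>lebesgue_on Om) = (\<integral>x. D\<psi> x \<bullet> e \<partial>lborel)"
    proof (rule integral_lebesgue_on_eq_lborel(1)[OF Om(1)])
      show "D\<psi> x \<bullet> e = 0" if "x \<notin> Om" for x
      proof -
        have "D\<psi> x = 0" using K that by blast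
        then show ?thesis by simp
      qed
    qed simp
    then show ?thesis by (simp add: L2_inner_def integral_test_gradient_zero[OF test])
  qed
  then show ?thesis
    by (subst has_weak_gradient_iff[OF Om L2_const[OF Om] L2_const[OF Om]]) (simp add: L2_inner_def)
qed

lemma H1_const:
  fixes Om :: "'a::euclidean_space set"
  assumes Om: "open Om" "bounded Om"
  shows "(\<lambda>x. c) \<in> H1 Om" and "AE x in lebesgue_on Om. weak_gradient Om (\<lambda>x. c) x = 0"
  using H1I[OF L2_const L2_const has_weak_gradient_const] weak_gradient_eq[OF Om L2_const L2_const has_weak_gradient_const]
    Om by blast+

lemma measure_open_pos:
  fixes Om :: "'a::euclidean_space set"
  assumes "open Om" "bounded Om" "Om \<noteq> {}"
  shows "0 < measure lebesgue Om"
proof -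
  have "emeasure lborel Om < \<infinity>" "0 < emeasure lborel Om"
    using emeasure_bounded_finite[OF assms(2)] emeasure_open_pos[OF assms(1,3)] by auto
  then have "0 < measure lborel Om"
    by (metis emeasure_eq_ennreal_measure ennreal_less_zero_iff infinity_ennreal_def order_less_irrefl)
  then show ?thesis using assms(1) by (simp add: measure_completion)
qed

lemma average_zero_iff:
  fixes Om :: "'a::euclidean_space set"
  assumes "open Om" "bounded Om" "Om \<noteq> {}"
  shows "average Om u = 0 \<longleftrightarrow> L2_inner Om u (\<lambda>x. 1) = 0"
  using measure_open_pos[OF assms] by (simp add: average_def L2_inner_def)

text \<open>
  Among all constants the mean approximates a function best in \<open>L\<^sup>2\<close>. Therefore a function with mean
  zero is no larger than its distance to the constant \<open>c\<close> of \<open>poincare_on\<close>.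
\<close>

lemma poincare_inequality:
  fixes Om :: "'a::euclidean_space set"
  assumes dom: "lipschitz_domain Om"
  shows "\<exists>C\<ge>0. \<forall>u\<in>H1 Om. L2_inner Om u (\<lambda>x. 1) = 0 \<longrightarrow>
    L2_inner Om u u \<le> C * L2_inner Om (weak_gradient Om u) (weak_gradient Om u)"
proof -
  have Om: "open Om" "bounded Om" using dom by (auto simp: lipschitz_domain_def)
  have [measurable]: "Om \<in> sets borel" using Om(1) by simp
  obtain C where C: "0 \<le> C" and bound: "\<And>U G. borel_weak_gradient Om U G \<Longrightarrow>
      \<exists>c. deviation Om U c \<le> ennreal (C * square_norm G)"
    using poincare_on_lipschitz_domain[OF dom] unfolding poincare_on_def by auto
  have "L2_inner Om u u \<le> C * L2_inner Om (weak_gradient Om u) (weak_gradient Om u)"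
    if u: "u \<in> H1 Om" and mean: "L2_inner Om u (\<lambda>x. 1) = 0" for u
  proof -
    obtain U G where wg: "borel_weak_gradient Om U G" and L: "U \<in> L2 Om" "G \<in> L2 Om"
      and zero: "\<forall>x. x \<notin> Om \<longrightarrow> G x = 0"
      and eq: "AE x in lebesgue_on Om. u x = U x" "AE x in lebesgue_on Om. weak_gradient Om u x = G x"
      by (rule borel_weak_gradient_of_weak_gradient[OF Om H1_L2[OF u] weak_gradient_L2[OF u]
          has_weak_gradient_weak_gradient[OF u]])
    have [measurable]: "U \<in> borel_measurable borel" "G \<in> borel_measurable borel"
      using wg by (auto simp: borel_weak_gradient_def)
    obtain c where c: "deviation Om U c \<le> ennreal (C * square_norm G)"
      using bound[OF wg] by blast
    have G_eq: "square_norm G = L2_inner Om (weak_gradient Om u) (weak_gradient Om u)"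
    proof -
      have "square_norm G = L2_inner Om G G"
        unfolding L2_inner_def power2_norm_eq_inner
        by (rule integral_lebesgue_on_eq_lborel(1)[symmetric, OF Om(1)]) (auto simp: zero)
      also have "\<dots> = L2_inner Om (weak_gradient Om u) (weak_gradient Om u)"
        using eq(2) L weak_gradient_L2[OF u] by (intro L2_inner_cong_AE) auto
      finally show ?thesis .
    qed
    let ?v = "\<lambda>x. u x + (- c) *\<^sub>R 1"
    have v_L2: "?v \<in> L2 Om" using H1_L2[OF u] by (intro L2_add L2_const[OF Om])
    have "L2_inner Om ?v ?v = L2_inner Om (\<lambda>x. U x - c) (\<lambda>x. U x - c)"
      using eq(1) v_L2 L2_diff[OF L(1) L2_const[OF Om]] by (intro L2_inner_cong_AE) auto
    also have "\<dots> = (\<integral>x. indicator Om x *\<^sub>R (U x - c)\<^sup>2 \<partial>lborel)"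
    proof -
      have "\<dots> = (\<integral>x. indicator Om x *\<^sub>R (U x - c)\<^sup>2 \<partial>lebesgue)"
        unfolding L2_inner_def using Om(1)
        by (subst integral_restrict_space) (auto simp: power2_eq_square)
      then show ?thesis by (simp add: integral_completion)
    qed
    also have "\<dots> \<le> C * L2_inner Om (weak_gradient Om u) (weak_gradient Om u)"
    proof -
      have "ennreal (indicator Om x *\<^sub>R (U x - c)\<^sup>2) = ennreal ((U x - c)\<^sup>2) * indicator Om x" for x
        by (simp add: indicator_def)
      then have "(\<integral>x. indicator Om x *\<^sub>R (U x - c)\<^sup>2 \<partial>lborel)
          = enn2real (deviation Om U c)"
        by (subst integral_eq_nn_integral) auto
      also have "\<dots> \<le> C * square_norm G"
        using c C by (intro enn2real_leI) auto
      finally show ?thesis by (simp only: G_eq)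
    qed
    finally have "L2_inner Om ?v ?v \<le> C * L2_inner Om (weak_gradient Om u) (weak_gradient Om u)" .
    moreover have "L2_inner Om ?v ?v = L2_inner Om u u + 2 * (- c) * L2_inner Om u (\<lambda>x. 1) + (- c)\<^sup>2 * L2_inner Om (\<lambda>x. 1::real) (\<lambda>x. 1)"
      by (rule L2_inner_expand[OF H1_L2[OF u] L2_const[OF Om]])
    ultimately show ?thesis
      using mean zero_le_power2[of c] mult_nonneg_nonneg[OF zero_le_power2 L2_inner_self_nonneg, of c Om "\<lambda>x. 1::real"]
      by simp
  qed
  with C show ?thesis by blast
qed

section \<open>The Neumann problem\<close>

definition dirichlet :: "'a::euclidean_space set \<Rightarrow> ('a \<Rightarrow> real) \<Rightarrow> ('a \<Rightarrow> real) \<Rightarrow> real" where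
  "dirichlet Om u v = L2_inner Om (weak_gradient Om u) (weak_gradient Om v)"

lemma neumann_laplacian_eq: "neumann_laplacian Om u v = - dirichlet Om u v"
  by (simp add: neumann_laplacian_def dirichlet_def)

lemma dirichlet_commute: "dirichlet Om u v = dirichlet Om v u"
  by (simp add: dirichlet_def L2_inner_commute)

lemma dirichlet_nonneg: "0 \<le> dirichlet Om u u"
  by (simp add: dirichlet_def L2_inner_self_nonneg)

lemma dirichlet_Cauchy_Schwarz:
  assumes "u \<in> H1 Om" "v \<in> H1 Om"
  shows "(dirichlet Om u v)\<^sup>2 \<le> dirichlet Om u u * dirichlet Om v v"
  unfolding dirichlet_def using assms by (intro L2_Cauchy_Schwarz_square weak_gradient_L2)

lemma dirichlet_combine_left:
  assumes Om: "open Om" "bounded Om" and uv: "u \<in> H1 Om" "v \<in> H1 Om" "w \<in> H1 Om"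
  shows "dirichlet Om (\<lambda>x. u x + c * v x) w = dirichlet Om u w + c * dirichlet Om v w"
proof -
  note g = uv[THEN weak_gradient_L2]
  have "dirichlet Om (\<lambda>x. u x + c * v x) w
      = L2_inner Om (\<lambda>x. weak_gradient Om u x + c *\<^sub>R weak_gradient Om v x) (weak_gradient Om w)"
    unfolding dirichlet_def
    using H1_combine(2)[OF Om uv(1,2)] weak_gradient_L2[OF H1_combine(1)[OF Om uv(1,2)]]
      L2_add[OF g(1) L2_scaleR[OF g(2)]] g(3)
    by (intro L2_inner_cong_AE) auto
  also have "\<dots> = dirichlet Om u w + c * dirichlet Om v w"
    by (simp add: dirichlet_def L2_inner_add_left[OF g(1) L2_scaleR[OF g(2)] g(3)] L2_inner_scaleR_left)
  finally show ?thesis .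
qed

lemma dirichlet_combine_right:
  assumes "open Om" "bounded Om" "u \<in> H1 Om" "v \<in> H1 Om" "w \<in> H1 Om"
  shows "dirichlet Om w (\<lambda>x. u x + c * v x) = dirichlet Om w u + c * dirichlet Om w v"
  using dirichlet_combine_left[OF assms] by (simp add: dirichlet_commute)

lemma dirichlet_const:
  assumes Om: "open Om" "bounded Om" and u: "u \<in> H1 Om"
  shows "dirichlet Om u (\<lambda>x. c) = 0"
proof -
  have "dirichlet Om u (\<lambda>x. c) = L2_inner Om (weak_gradient Om u) (\<lambda>x. 0)"
    unfolding dirichlet_def
    using H1_const[OF Om, of c] weak_gradient_L2[OF u] L2_const[OF Om] weak_gradient_L2[OF H1_const(1)[OF Om, of c]]
    by (intro L2_inner_cong_AE) auto
  then show ?thesis by (simp add: L2_inner_def)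
qed

lemma L2_inner_combine_left:
  fixes u v w :: "'a::euclidean_space \<Rightarrow> real"
  assumes "u \<in> L2 Om" "v \<in> L2 Om" "w \<in> L2 Om"
  shows "L2_inner Om (\<lambda>x. u x + c * v x) w = L2_inner Om u w + c * L2_inner Om v w"
  by (simp add: L2_inner_add_left[OF assms(1) L2_mult[OF assms(2)] assms(3)] L2_inner_mult_left)

lemma L2_inner_combine_right:
  fixes u v w :: "'a::euclidean_space \<Rightarrow> real"
  assumes "u \<in> L2 Om" "v \<in> L2 Om" "w \<in> L2 Om"
  shows "L2_inner Om w (\<lambda>x. u x + c * v x) = L2_inner Om w u + c * L2_inner Om w v"
  using L2_inner_combine_left[OF assms] by (simp add: L2_inner_commute)

lemma double_le_add_of_square_le_mult:
  fixes a b t :: real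
  assumes "t\<^sup>2 \<le> a * b" "0 \<le> a" "0 \<le> b"
  shows "2 * t \<le> a + b"
proof (rule power2_le_imp_le)
  have "(2 * t)\<^sup>2 \<le> 4 * (a * b)" using assms(1) by (simp add: power_mult_distrib)
  also have "\<dots> \<le> (a + b)\<^sup>2" using zero_le_power2[of "a - b"] by (simp add: power2_eq_square algebra_simps)
  finally show "(2 * t)\<^sup>2 \<le> (a + b)\<^sup>2" .
qed (use assms in simp)

lemma L2_norm_less:
  assumes "L2_inner Om u u < e\<^sup>2" "0 < e"
  shows "L2_norm Om u < e"
  using assms by (intro power2_less_imp_less[of _ e]) (simp_all add: L2_norm_square)

text \<open>
  The direct method for \<open>J z = \<parallel>\<nabla>z\<parallel>\<^sup>2 - 2 (v, z)\<close> on functions of mean zero. By the parallelogram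
  identity the gradients of a minimizing sequence are Cauchy, and by the Poincare inequality so are the
  functions. The Euler equation is the limit of the approximate minimality of the members of the
  sequence. It extends to all of \<open>H1 Om\<close> because both sides vanish on constants.
\<close>

lemma neumann_problem_solvable:
  fixes Om :: "'a::euclidean_space set"
  assumes dom: "lipschitz_domain Om" and v: "v \<in> L2 Om" and v_mean: "L2_inner Om v (\<lambda>x. 1) = 0"
  shows "\<exists>w\<in>H1 Om. L2_inner Om w (\<lambda>x. 1) = 0 \<and> (\<forall>z\<in>H1 Om. dirichlet Om w z = L2_inner Om v z)"
proof -
  have Om: "open Om" "bounded Om" and ne: "Om \<noteq> {}" using dom by (auto simp: lipschitz_domain_def)
  obtain C where C: "0 \<le> C" and poincare: "\<And>u. u \<in> H1 Om \<Longrightarrow> L2_inner Om u (\<lambda>x. 1) = 0 \<Longrightarrow>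
      L2_inner Om u u \<le> C * dirichlet Om u u"
    using poincare_inequality[OF dom] unfolding dirichlet_def by blast
  have one: "(\<lambda>x::'a. 1::real) \<in> L2 Om" by (rule L2_const[OF Om])
  define S where "S = {z \<in> H1 Om. L2_inner Om z (\<lambda>x. 1) = 0}"
  have S_H1: "z \<in> H1 Om" and S_L2: "z \<in> L2 Om" if "z \<in> S" for z
    using that H1_L2 by (auto simp: S_def)
  have S_combine: "(\<lambda>x. z x + c * z' x) \<in> S" if "z \<in> S" "z' \<in> S" for z z' c
    using that H1_combine(1)[OF Om] one by (auto simp: S_def L2_inner_combine_left H1_L2)
  define J where "J z = dirichlet Om z z - 2 * L2_inner Om v z" for z
  have J_combine: "J (\<lambda>x. z x + t * z' x)
      = J z + 2 * t * (dirichlet Om z z' - L2_inner Om v z') + t\<^sup>2 * dirichlet Om z' z'"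
    if "z \<in> S" "z' \<in> S" for z z' t
    using that S_H1 S_L2 v H1_combine(1)[OF Om]
    by (simp add: J_def dirichlet_combine_left[OF Om] dirichlet_combine_right[OF Om] L2_inner_combine_right
        dirichlet_commute[of Om z' z] power2_eq_square algebra_simps)
  have J_lower: "- (C * L2_inner Om v v) \<le> J z" if z: "z \<in> S" for z
  proof -
    have "(L2_inner Om v z)\<^sup>2 \<le> L2_inner Om v v * L2_inner Om z z"
      by (rule L2_Cauchy_Schwarz_square[OF v S_L2[OF z]])
    also have "\<dots> \<le> L2_inner Om v v * (C * dirichlet Om z z)"
      using z poincare by (intro mult_left_mono L2_inner_self_nonneg) (auto simp: S_def)
    finally have "(L2_inner Om v z)\<^sup>2 \<le> (C * L2_inner Om v v) * dirichlet Om z z"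
      by (simp add: mult_ac)
    then have "2 * L2_inner Om v z \<le> C * L2_inner Om v v + dirichlet Om z z"
      using C by (intro double_le_add_of_square_le_mult mult_nonneg_nonneg L2_inner_self_nonneg dirichlet_nonneg)
    then show ?thesis by (simp add: J_def)
  qed
  have zero_S: "(\<lambda>x. 0) \<in> S" using H1_const(1)[OF Om] by (simp add: S_def L2_inner_def)
  define m where "m = Inf (J ` S)"
  have bdd: "bdd_below (J ` S)" using J_lower by (auto intro!: bdd_belowI)
  have m_le: "m \<le> J z" if "z \<in> S" for z
    unfolding m_def using that bdd by (intro cInf_lower) auto
  have "\<exists>z\<in>S. J z < m + 1 / Suc n" for n
    using cInf_lessD[of "J ` S" "m + 1 / Suc n"] zero_S unfolding m_def by auto
  then obtain z where z: "\<And>n. z n \<in> S" and Jz: "\<And>n. J (z n) < m + 1 / Suc n"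
    by metis
  have z_H1: "z n \<in> H1 Om" and z_L2: "z n \<in> L2 Om" and g_L2: "weak_gradient Om (z n) \<in> L2 Om" for n
    using S_H1[OF z] S_L2[OF z] weak_gradient_L2 by auto
  let ?diff = "\<lambda>k l x. z k x + (- 1) * z l x"
  let ?E = "\<lambda>k l. dirichlet Om (?diff k l) (?diff k l)"
  let ?grad_diff = "\<lambda>k l x. weak_gradient Om (z k) x - weak_gradient Om (z l) x"
  have diff_S: "?diff k l \<in> S" for k l by (rule S_combine[OF z z])
  have diff_bound: "?E k l \<le> 2 * (1 / Suc k + 1 / Suc l)" for k l
  proof -
    \<comment> \<open>The midpoint of \<open>z l\<close> and \<open>z k\<close>.\<close>
    let ?mid = "\<lambda>x. z l x + (1 / 2) * ?diff k l x"
    have "m \<le> J ?mid" by (intro m_le S_combine z diff_S)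
    moreover have "J ?mid = J (z l) + (dirichlet Om (z l) (?diff k l) - L2_inner Om v (?diff k l))
        + ?E k l / 4"
      using J_combine[OF z[of l] diff_S[of k l], of "1/2"] by (simp add: power2_eq_square)
    moreover have "J (z k) = J (z l)
        + 2 * (dirichlet Om (z l) (?diff k l) - L2_inner Om v (?diff k l)) + ?E k l"
      using J_combine[OF z[of l] diff_S[of k l], of 1] by simp
    ultimately show ?thesis using Jz[of k] Jz[of l] by argo
  qed
  have cauchy_bound: "\<exists>N. \<forall>k\<ge>N. \<forall>l\<ge>N. (C + 1) * ?E k l < e\<^sup>2"
    if "0 < e" for e
  proof -
    obtain N :: nat where N: "4 * (C + 1) / e\<^sup>2 < N" using reals_Archimedean2 by blast
    have "(C + 1) * ?E k l < e\<^sup>2" if "N \<le> k" "N \<le> l" for k l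
    proof -
      have "1 / real (Suc k) \<le> 1 / Suc N" "1 / real (Suc l) \<le> 1 / Suc N"
        using that by (auto intro!: divide_left_mono)
      then have "2 * (1 / real (Suc k) + 1 / real (Suc l)) \<le> 4 * (1 / Suc N)" by argo
      with diff_bound[of k l] have "?E k l \<le> 4 * (1 / Suc N)" by (rule order_trans)
      then have "(C + 1) * ?E k l \<le> (C + 1) * (4 * (1 / Suc N))"
        using C by (intro mult_left_mono) auto
      also have "\<dots> < e\<^sup>2"
      proof -
        have "4 * (C + 1) < real N * e\<^sup>2" using N \<open>0 < e\<close> by (simp add: divide_less_eq)
        also have "\<dots> \<le> real (Suc N) * e\<^sup>2" by (intro mult_right_mono) auto
        finally show ?thesis by (simp add: divide_less_eq mult_ac)
      qed
      finally show ?thesis .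
    qed
    then show ?thesis by blast
  qed
  have "\<exists>N. \<forall>k\<ge>N. \<forall>l\<ge>N. L2_norm Om (\<lambda>x. z k x - z l x) < e" if "0 < e" for e
  proof -
    obtain N where N: "\<And>k l. N \<le> k \<Longrightarrow> N \<le> l \<Longrightarrow> (C + 1) * ?E k l < e\<^sup>2"
      using cauchy_bound[OF \<open>0 < e\<close>] by blast
    have "L2_norm Om (\<lambda>x. z k x - z l x) < e" if "N \<le> k" "N \<le> l" for k l
    proof (rule L2_norm_less[OF _ \<open>0 < e\<close>])
      have "L2_inner Om (?diff k l) (?diff k l) \<le> C * ?E k l"
        using diff_S[of k l] by (intro poincare) (auto simp: S_def)
      also have "\<dots> \<le> (C + 1) * ?E k l"
        by (intro mult_right_mono dirichlet_nonneg) simp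
      finally show "L2_inner Om (\<lambda>x. z k x - z l x) (\<lambda>x. z k x - z l x) < e\<^sup>2"
        using N[OF that] by simp
    qed
    then show ?thesis by blast
  qed
  from L2_cauchy_converges[OF Om z_L2 this]
  obtain w where w: "w \<in> L2 Om" "(\<lambda>n. L2_norm Om (\<lambda>x. z n x - w x)) \<longlonglongrightarrow> 0" by blast
  have "\<exists>N. \<forall>k\<ge>N. \<forall>l\<ge>N. L2_norm Om (?grad_diff k l) < e"
    if "0 < e" for e
  proof -
    obtain N where N: "\<And>k l. N \<le> k \<Longrightarrow> N \<le> l \<Longrightarrow> (C + 1) * ?E k l < e\<^sup>2"
      using cauchy_bound[OF \<open>0 < e\<close>] by blast
    have "L2_norm Om (?grad_diff k l) < e"
      if "N \<le> k" "N \<le> l" for k l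
    proof (rule L2_norm_less[OF _ \<open>0 < e\<close>])
      have "L2_inner Om (?grad_diff k l)
            (?grad_diff k l)
          = ?E k l"
        unfolding dirichlet_def
        using H1_combine(2)[OF Om z_H1[of k] z_H1[of l], of "-1"] L2_diff[OF g_L2[of k] g_L2[of l]]
          weak_gradient_L2[OF S_H1[OF diff_S[of k l]]]
        by (intro L2_inner_cong_AE) auto
      also have "\<dots> \<le> (C + 1) * ?E k l"
        using C mult_right_mono[of 1 "C + 1", OF _ dirichlet_nonneg] by simp
      also have "\<dots> < e\<^sup>2" by (rule N[OF that])
      finally show "L2_inner Om (?grad_diff k l)
            (?grad_diff k l) < e\<^sup>2" .
    qed
    then show ?thesis by blast
  qed
  from L2_cauchy_converges[OF Om g_L2 this]
  obtain G where G: "G \<in> L2 Om" "(\<lambda>n. L2_norm Om (\<lambda>x. weak_gradient Om (z n) x - G x)) \<longlonglongrightarrow> 0" by blast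
  note lim_w = L2_inner_tendsto[OF z_L2 w(1) _ w(2)]
  note lim_G = L2_inner_tendsto[OF g_L2 G(1) _ G(2)]
  have wG: "has_weak_gradient Om w G"
    unfolding has_weak_gradient_iff[OF Om w(1) G(1)]
  proof (intro allI impI)
    fix \<psi> D\<psi> e assume test: "test_function Om \<psi> D\<psi>"
    note L = L2_inner_const[OF test_function_L2(2)[OF Om test]] L2_scaleR_const[OF test_function_L2(1)[OF Om test]]
    have "L2_inner Om (z n) (\<lambda>x. D\<psi> x \<bullet> e) = - L2_inner Om (weak_gradient Om (z n)) (\<lambda>x. \<psi> x *\<^sub>R e)" for n
      using has_weak_gradient_weak_gradient[OF z_H1[of n]] test
      unfolding has_weak_gradient_iff[OF Om z_L2 g_L2] by blast
    with lim_w[OF L(1)[of e]]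
    have "(\<lambda>n. - L2_inner Om (weak_gradient Om (z n)) (\<lambda>x. \<psi> x *\<^sub>R e)) \<longlonglongrightarrow> L2_inner Om w (\<lambda>x. D\<psi> x \<bullet> e)"
      by (simp only:)
    with tendsto_minus[OF lim_G[OF L(2)[of e]]]
    show "L2_inner Om w (\<lambda>x. D\<psi> x \<bullet> e) = - L2_inner Om G (\<lambda>x. \<psi> x *\<^sub>R e)"
      by (intro LIMSEQ_unique)
  qed
  have w_H1: "w \<in> H1 Om" by (rule H1I[OF w(1) G(1) wG])
  have w_mean: "L2_inner Om w (\<lambda>x. 1) = 0"
    using lim_w[OF one] z by (simp add: S_def LIMSEQ_const_iff)
  have w_dirichlet: "dirichlet Om w y = L2_inner Om G (weak_gradient Om y)" if "y \<in> H1 Om" for y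
    unfolding dirichlet_def
    using weak_gradient_eq[OF Om w(1) G(1) wG] weak_gradient_L2[OF w_H1] G(1) weak_gradient_L2[OF that]
    by (intro L2_inner_cong_AE) auto
  have euler_S: "dirichlet Om w y = L2_inner Om v y" if y: "y \<in> S" for y
  proof -
    have "0 \<le> 0 + 2 * t * (L2_inner Om G (weak_gradient Om y) - L2_inner Om v y) + t\<^sup>2 * dirichlet Om y y" for t
    proof (rule LIMSEQ_le_const)
      show "(\<lambda>n. 1 / Suc n + 2 * t * (L2_inner Om (weak_gradient Om (z n)) (weak_gradient Om y) - L2_inner Om v y)
            + t\<^sup>2 * dirichlet Om y y)
          \<longlonglongrightarrow> 0 + 2 * t * (L2_inner Om G (weak_gradient Om y) - L2_inner Om v y) + t\<^sup>2 * dirichlet Om y y"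
        by (intro tendsto_intros lim_G weak_gradient_L2 S_H1 y
            LIMSEQ_inverse_real_of_nat[unfolded inverse_eq_divide])
      show "\<exists>N. \<forall>n\<ge>N. 0 \<le> 1 / Suc n
          + 2 * t * (L2_inner Om (weak_gradient Om (z n)) (weak_gradient Om y) - L2_inner Om v y)
          + t\<^sup>2 * dirichlet Om y y"
      proof (intro exI allI impI)
        fix n :: nat assume "0 \<le> n"
        have "m \<le> J (\<lambda>x. z n x + t * y x)" by (intro m_le S_combine z y)
        then show "0 \<le> 1 / Suc n
            + 2 * t * (L2_inner Om (weak_gradient Om (z n)) (weak_gradient Om y) - L2_inner Om v y)
            + t\<^sup>2 * dirichlet Om y y"
          using Jz[of n] unfolding J_combine[OF z y] dirichlet_def[of Om "z n" y] by linarith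
      qed
    qed
    then have "(L2_inner Om G (weak_gradient Om y) - L2_inner Om v y)\<^sup>2 \<le> 0 * dirichlet Om y y"
      by (intro nonneg_quadratic_discriminant dirichlet_nonneg) auto
    then show ?thesis using w_dirichlet[OF S_H1[OF y]] by simp
  qed
  have "dirichlet Om w y = L2_inner Om v y" if y: "y \<in> H1 Om" for y
  proof -
    define c where "c = - (L2_inner Om y (\<lambda>x. 1) / L2_inner Om (\<lambda>x. 1::real) (\<lambda>x. 1))"
    have pos: "0 < L2_inner Om (\<lambda>x. 1::real) (\<lambda>x. 1)"
      using measure_open_pos[OF Om ne] by (simp add: L2_inner_def measure_restrict_space Om(1))
    have "(\<lambda>x. y x + c * 1) \<in> S"
      unfolding S_def using H1_combine(1)[OF Om y H1_const(1)[OF Om], of c 1] pos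
        L2_inner_combine_left[OF H1_L2[OF y] one one, of c]
      by (simp add: c_def)
    from euler_S[OF this] show ?thesis
      using dirichlet_combine_right[OF Om y H1_const(1)[OF Om, of 1] w_H1, of c] dirichlet_const[OF Om w_H1, of 1]
        L2_inner_combine_right[OF H1_L2[OF y] one v, of c] v_mean
      by simp
  qed
  with w_H1 w_mean show ?thesis by blast
qed

lemma neg_inv_laplacian:
  assumes dom: "lipschitz_domain Om" and v: "v \<in> L2 Om" "L2_inner Om v (\<lambda>x. 1) = 0"
  shows "neg_inv_laplacian Om v \<in> H1 Om"
    and "z \<in> H1 Om \<Longrightarrow> dirichlet Om (neg_inv_laplacian Om v) z = L2_inner Om v z"
proof -
  have Om: "open Om" "bounded Om" "Om \<noteq> {}" using dom by (auto simp: lipschitz_domain_def)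
  let ?P = "\<lambda>w. w \<in> H1 Om \<inter> L2_0 Om \<and> (\<forall>z \<in> H1 Om. - neumann_laplacian Om w z = L2_inner Om v z)"
  have "\<exists>w. ?P w"
    using neumann_problem_solvable[OF dom v]
    by (auto simp: L2_0_def average_zero_iff[OF Om] H1_L2 neumann_laplacian_eq)
  then have "?P (neg_inv_laplacian Om v)"
    unfolding neg_inv_laplacian_def by (rule someI_ex)
  then show "neg_inv_laplacian Om v \<in> H1 Om"
      "z \<in> H1 Om \<Longrightarrow> dirichlet Om (neg_inv_laplacian Om v) z = L2_inner Om v z"
    by (auto simp: neumann_laplacian_eq)
qed

section \<open>The energy estimate\<close>

lemma second_order_taylor:
  fixes F f :: "real \<Rightarrow> real"
  assumes F: "\<And>s. (F has_real_derivative f s) (at s)" and f: "\<And>s. f differentiable (at s)"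
    and L: "\<And>s. \<bar>deriv f s\<bar> \<le> L"
  shows "\<bar>F y - F x - f x * (y - x)\<bar> \<le> L / 2 * (y - x)\<^sup>2"
proof (cases "y = x")
  case False
  define D where "D m = (if m = 0 then F else if m = 1 then f else deriv f)" for m :: nat
  have "(D m has_real_derivative D (Suc m) t) (at t)" if "m < 2" for m t
  proof -
    consider "m = 0" | "m = 1" using \<open>m < 2\<close> by linarith
    then show ?thesis
      using F DERIV_deriv_iff_real_differentiable f by cases (auto simp: D_def)
  qed
  then have "\<exists>t. (if y < x then y < t \<and> t < x else x < t \<and> t < y) \<and>
      F y = (\<Sum>m<2. D m x / fact m * (y - x) ^ m) + D 2 t / fact 2 * (y - x) ^ 2"
    using False by (intro Taylor[of 2 D F "min x y" "max x y"]) (auto simp: D_def)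
  then obtain t where "F y = (\<Sum>m<2. D m x / fact m * (y - x) ^ m) + D 2 t / fact 2 * (y - x) ^ 2"
    by blast
  then have "F y - F x - f x * (y - x) = deriv f t / 2 * (y - x)\<^sup>2"
    by (simp add: D_def numeral_2_eq_2)
  moreover have "\<bar>deriv f t / 2 * (y - x)\<^sup>2\<bar> \<le> L / 2 * (y - x)\<^sup>2"
    using L[of t] by (simp add: abs_mult mult_right_mono)
  ultimately show ?thesis by (simp only:)
qed simp

lemma linear_growth:
  fixes f :: "real \<Rightarrow> real"
  assumes f: "\<And>s. f differentiable (at s)" and L: "\<And>s. \<bar>deriv f s\<bar> \<le> L"
  shows "\<bar>f s\<bar> \<le> \<bar>f 0\<bar> + L * \<bar>s\<bar>"
proof -
  have "norm (f s - f 0) \<le> L * norm (s - 0)"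
    using f L DERIV_deriv_iff_real_differentiable
    by (intro field_differentiable_bound[of UNIV f "deriv f"]) auto
  then show ?thesis by simp
qed

lemma L2_abs: "u \<in> L2 Om \<Longrightarrow> (\<lambda>x. \<bar>u x :: real\<bar>) \<in> L2 Om"
  by (auto simp: L2_def intro: borel_measurable_abs)

lemma L2_compose_linear_growth:
  fixes u :: "'a::euclidean_space \<Rightarrow> real"
  assumes Om: "open Om" "bounded Om" and u: "u \<in> L2 Om"
    and f: "continuous_on UNIV f" "\<And>s. \<bar>f s\<bar> \<le> a + b * \<bar>s\<bar>"
  shows "(\<lambda>x. f (u x)) \<in> L2 Om"
proof (rule L2_norm_bound_mult[of "\<lambda>x. a + b * \<bar>u x\<bar>" _ _ 1])
  show "(\<lambda>x. a + b * \<bar>u x\<bar>) \<in> L2 Om" by (intro L2_add[OF L2_const[OF Om] L2_mult[OF L2_abs[OF u]]])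
  show "(\<lambda>x. f (u x)) \<in> borel_measurable (lebesgue_on Om)"
    using borel_measurable_continuous_onI[OF f(1)] L2_measurable[OF u] by measurable
  show "norm (f (u x)) \<le> norm (a + b * \<bar>u x\<bar>) * 1" for x using f(2)[of "u x"] by simp
qed

lemma integrable_compose_quadratic_growth:
  fixes u :: "'a::euclidean_space \<Rightarrow> real"
  assumes Om: "open Om" "bounded Om" and u: "u \<in> L2 Om"
    and F: "continuous_on UNIV F" "\<And>s. \<bar>F s\<bar> \<le> a + b * \<bar>s\<bar> + c * s\<^sup>2"
  shows "integrable (lebesgue_on Om) (\<lambda>x. F (u x))"
proof (rule Bochner_Integration.integrable_bound)
  have "integrable (lebesgue_on Om) (\<lambda>x. a)" by (rule L2_integrable[OF Om L2_const[OF Om]])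
  moreover have "integrable (lebesgue_on Om) (\<lambda>x. \<bar>u x\<bar>)" by (rule L2_integrable[OF Om L2_abs[OF u]])
  moreover have "integrable (lebesgue_on Om) (\<lambda>x. (u x)\<^sup>2)" using L2_integrable_square[OF u] by simp
  ultimately show "integrable (lebesgue_on Om) (\<lambda>x. a + b * \<bar>u x\<bar> + c * (u x)\<^sup>2)"
    by (intro Bochner_Integration.integrable_add integrable_mult_right)
  show "(\<lambda>x. F (u x)) \<in> borel_measurable (lebesgue_on Om)"
    using borel_measurable_continuous_onI[OF F(1)] L2_measurable[OF u] by measurable
  show "AE x in lebesgue_on Om. norm (F (u x)) \<le> norm (a + b * \<bar>u x\<bar> + c * (u x)\<^sup>2)"
    using order_trans[OF F(2) abs_ge_self] by (intro AE_I2) simp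
qed

text \<open>
  The estimate as a fact about real numbers. Here \<open>x\<close>, \<open>y\<close> and \<open>c\<close> are the squares and the product
  of \<open>D = \<phi>\<^sup>n\<^sup>+\<^sup>1 - \<phi>\<^sup>n\<close> and \<open>d = \<phi>\<^sup>n - \<phi>\<^sup>n\<^sup>-\<^sup>1\<close> in the negative norm; \<open>P\<close>, \<open>Q\<close>, \<open>X\<close> are the
  squared gradient norms of \<open>\<phi>\<^sup>n\<^sup>+\<^sup>1\<close>, \<open>\<phi>\<^sup>n\<close>, \<open>D\<close>; \<open>\<delta>\<close>, \<open>e\<close>, \<open>s\<close> are the squared \<open>L\<^sup>2\<close> norms
  of \<open>D\<close>, \<open>d\<close>, \<open>D - d\<close>; \<open>I\<close> and \<open>K\<close> are the integrals of the potential at \<open>\<phi>\<^sup>n\<^sup>+\<^sup>1\<close> and \<open>\<phi>\<^sup>n\<close>;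
  \<open>M\<close> and \<open>W\<close> are the products of \<open>\<mu>\<^sup>n\<^sup>+\<^sup>1\<close> and of \<open>f(2\<phi>\<^sup>n - \<phi>\<^sup>n\<^sup>-\<^sup>1)\<close> with \<open>D\<close>. The square root
  term is absorbed by parts of \<open>x\<close> and \<open>X\<close>, through the interpolation inequality.
\<close>

lemma energy_balance:
  fixes \<epsilon> \<gamma> \<tau> A B L \<alpha>\<^sub>1 \<alpha>\<^sub>2 :: real
  assumes pos: "0 < \<epsilon>" "0 < \<gamma>" "0 < \<tau>" and A: "0 \<le> A" and \<alpha>: "0 \<le> \<alpha>\<^sub>1" "0 < \<alpha>\<^sub>2"
    and mass: "(3 * x - c) / (2 * \<tau>) = - \<gamma> * M"
    and potential: "M = \<epsilon> * ((P - Q + X) / 2) + 1 / \<epsilon> * W + A * \<tau> * X + B * ((\<delta> - e + s) / 2)"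
    and taylor: "I - K \<le> W + L / 2 * (s + e)"
    and interpolation: "\<delta>\<^sup>2 \<le> x * X" and nonneg: "0 \<le> x" "0 \<le> X" "0 \<le> \<delta>"
  shows "\<epsilon> / 2 * P + 1 / \<epsilon> * I + 1 / (4 * \<tau> * \<gamma>) * x + (L / (2 * \<epsilon>) + B / 2) * \<delta>
    \<le> \<epsilon> / 2 * Q + 1 / \<epsilon> * K + 1 / (4 * \<tau> * \<gamma>) * y + (L / (2 * \<epsilon>) + B / 2) * e
      - 1 / (4 * \<tau> * \<gamma>) * (x - 2 * c + y)
      - (1 - \<alpha>\<^sub>1) * (\<epsilon> / 2) * X
      - (1 - \<alpha>\<^sub>2) * (1 / (\<tau> * \<gamma>)) * x
      - (2 * sqrt (\<alpha>\<^sub>2 / \<gamma> * (A + \<alpha>\<^sub>1 * \<epsilon> / (2 * \<tau>))) - L / (2 * \<epsilon>)) * \<delta>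
      - (B / 2 - L / (2 * \<epsilon>)) * s"
proof -
  define T where "T = 1 / (\<tau> * \<gamma>)"
  define V where "V = 1 / \<epsilon>"
  define R where "R = sqrt (\<alpha>\<^sub>2 / \<gamma> * (A + \<alpha>\<^sub>1 * \<epsilon> / (2 * \<tau>)))"
  have T: "0 < T" and V: "0 < V" using pos by (simp_all add: T_def V_def)
  have M: "M = - (T * (3 * x - c) / 2)"
    using mass pos by (simp add: T_def field_simps)
  have R2: "R\<^sup>2 = (\<alpha>\<^sub>2 * T) * (A * \<tau> + \<alpha>\<^sub>1 * \<epsilon> / 2)"
    using pos A \<alpha> by (simp add: R_def T_def field_simps)
  have "(R * \<delta>)\<^sup>2 = R\<^sup>2 * \<delta>\<^sup>2" by (rule power_mult_distrib)
  also have "\<dots> \<le> R\<^sup>2 * (x * X)" using interpolation by (intro mult_left_mono) auto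
  also have "\<dots> = (\<alpha>\<^sub>2 * T * x) * ((A * \<tau> + \<alpha>\<^sub>1 * \<epsilon> / 2) * X)" by (simp add: R2 mult_ac)
  finally have amgm: "2 * (R * \<delta>) \<le> \<alpha>\<^sub>2 * T * x + (A * \<tau> + \<alpha>\<^sub>1 * \<epsilon> / 2) * X"
    using pos A \<alpha> T nonneg by (intro double_le_add_of_square_le_mult) auto
  have potential_bound: "V * (I - K) \<le> V * (W + L / 2 * (s + e))"
    using taylor V by (intro mult_left_mono) auto
  have coeffs: "1 / (4 * \<tau> * \<gamma>) = T / 4" "1 / (\<tau> * \<gamma>) = T" "1 / \<epsilon> = V" "L / (2 * \<epsilon>) = L * V / 2"
    by (simp_all add: T_def V_def)
  have balance: "- (T * (3 * x - c) / 2)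
      = \<epsilon> * ((P - Q + X) / 2) + V * W + A * \<tau> * X + B * ((\<delta> - e + s) / 2)"
    using potential M by (simp add: V_def)
  show ?thesis
    unfolding R_def[symmetric] coeffs
    using amgm potential_bound balance
    by (simp add: algebra_simps add_divide_distrib diff_divide_distrib)
qed

lemma H1_diff:
  assumes "open Om" "bounded Om" "u \<in> H1 Om" "v \<in> H1 Om"
  shows "(\<lambda>x. u x - v x) \<in> H1 Om"
  using H1_combine(1)[OF assms, of "-1"] by simp

lemma dirichlet_diff_left:
  assumes "open Om" "bounded Om" "u \<in> H1 Om" "v \<in> H1 Om" "w \<in> H1 Om"
  shows "dirichlet Om (\<lambda>x. u x - v x) w = dirichlet Om u w - dirichlet Om v w"
  using dirichlet_combine_left[OF assms, of "-1"] by simp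

lemma dirichlet_diff_right:
  assumes "open Om" "bounded Om" "u \<in> H1 Om" "v \<in> H1 Om" "w \<in> H1 Om"
  shows "dirichlet Om w (\<lambda>x. u x - v x) = dirichlet Om w u - dirichlet Om w v"
  using dirichlet_combine_right[OF assms, of "-1"] by simp

lemma neg_norm_square:
  assumes "lipschitz_domain Om" "v \<in> L2 Om" "L2_inner Om v (\<lambda>x. 1) = 0"
  shows "(neg_norm Om v)\<^sup>2 = dirichlet Om (neg_inv_laplacian Om v) (neg_inv_laplacian Om v)"
    and "(neg_norm Om v)\<^sup>2 = L2_inner Om v (neg_inv_laplacian Om v)"
proof -
  have "L2_inner Om v (neg_inv_laplacian Om v) = dirichlet Om (neg_inv_laplacian Om v) (neg_inv_laplacian Om v)"
    using neg_inv_laplacian[OF assms] by simp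
  then show "(neg_norm Om v)\<^sup>2 = dirichlet Om (neg_inv_laplacian Om v) (neg_inv_laplacian Om v)"
      "(neg_norm Om v)\<^sup>2 = L2_inner Om v (neg_inv_laplacian Om v)"
    by (simp_all add: neg_norm_def dirichlet_nonneg)
qed

lemma neg_inv_laplacian_symmetric:
  assumes "lipschitz_domain Om" "u \<in> L2 Om" "L2_inner Om u (\<lambda>x. 1) = 0" "v \<in> L2 Om" "L2_inner Om v (\<lambda>x. 1) = 0"
  shows "L2_inner Om u (neg_inv_laplacian Om v) = L2_inner Om v (neg_inv_laplacian Om u)"
  using neg_inv_laplacian[OF assms(1-3)] neg_inv_laplacian[OF assms(1,4,5)] dirichlet_commute by metis

text \<open>
  Since \<open>neg_inv_laplacian\<close> chooses a representative, it is not linear as a map of functions; the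
  polarization identity is derived from the symmetry of the form instead.
\<close>

lemma neg_norm_diff_square:
  assumes dom: "lipschitz_domain Om"
    and u: "u \<in> L2 Om" "L2_inner Om u (\<lambda>x. 1) = 0" and v: "v \<in> L2 Om" "L2_inner Om v (\<lambda>x. 1) = 0"
  shows "(neg_norm Om (\<lambda>x. u x - v x))\<^sup>2
    = (neg_norm Om u)\<^sup>2 - 2 * L2_inner Om v (neg_inv_laplacian Om u) + (neg_norm Om v)\<^sup>2"
proof -
  have Om: "open Om" "bounded Om" using dom by (auto simp: lipschitz_domain_def)
  let ?d = "\<lambda>x. u x - v x"
  have d: "?d \<in> L2 Om" "L2_inner Om ?d (\<lambda>x. 1) = 0"
    using L2_diff[OF u(1) v(1)] L2_inner_diff_left[OF u(1) v(1) L2_const[OF Om, of "1::real"]] u(2) v(2)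
    by simp_all
  have N: "neg_inv_laplacian Om w \<in> L2 Om" if "w \<in> L2 Om" "L2_inner Om w (\<lambda>x. 1) = 0" for w
    using neg_inv_laplacian(1)[OF dom that] by (rule H1_L2)
  have "(neg_norm Om ?d)\<^sup>2 = L2_inner Om ?d (neg_inv_laplacian Om ?d)" by (rule neg_norm_square(2)[OF dom d])
  also have "\<dots> = L2_inner Om u (neg_inv_laplacian Om ?d) - L2_inner Om v (neg_inv_laplacian Om ?d)"
    by (rule L2_inner_diff_left[OF u(1) v(1) N[OF d]])
  also have "L2_inner Om u (neg_inv_laplacian Om ?d) = L2_inner Om ?d (neg_inv_laplacian Om u)"
    by (rule neg_inv_laplacian_symmetric[OF dom u d])
  also have "\<dots> = L2_inner Om u (neg_inv_laplacian Om u) - L2_inner Om v (neg_inv_laplacian Om u)"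
    by (rule L2_inner_diff_left[OF u(1) v(1) N[OF u]])
  also have "L2_inner Om v (neg_inv_laplacian Om ?d) = L2_inner Om ?d (neg_inv_laplacian Om v)"
    by (rule neg_inv_laplacian_symmetric[OF dom v d])
  also have "\<dots> = L2_inner Om u (neg_inv_laplacian Om v) - L2_inner Om v (neg_inv_laplacian Om v)"
    by (rule L2_inner_diff_left[OF u(1) v(1) N[OF v]])
  also have "L2_inner Om u (neg_inv_laplacian Om v) = L2_inner Om v (neg_inv_laplacian Om u)"
    by (rule neg_inv_laplacian_symmetric[OF dom u v])
  finally show ?thesis
    by (simp add: neg_norm_square(2)[OF dom u] neg_norm_square(2)[OF dom v])
qed

lemma energy_eq:
  assumes "open Om" "bounded Om" "u \<in> H1 Om" and F: "integrable (lebesgue_on Om) (\<lambda>x. F (u x))"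
  shows "energy Om F \<epsilon> u = \<epsilon> / 2 * dirichlet Om u u + 1 / \<epsilon> * (\<integral>x. F (u x) \<partial>lebesgue_on Om)"
proof -
  have "energy Om F \<epsilon> u = (\<integral>x. \<epsilon> / 2 * (norm (weak_gradient Om u x))\<^sup>2 \<partial>lebesgue_on Om)
      + (\<integral>x. 1 / \<epsilon> * F (u x) \<partial>lebesgue_on Om)"
    unfolding energy_def
    by (intro Bochner_Integration.integral_add integrable_mult_right F L2_integrable_square
        weak_gradient_L2 assms(3))
  also have "(\<integral>x. \<epsilon> / 2 * (norm (weak_gradient Om u x))\<^sup>2 \<partial>lebesgue_on Om) = \<epsilon> / 2 * dirichlet Om u u"
    by (simp only: integral_mult_right_zero dirichlet_def L2_inner_def power2_norm_eq_inner)
  also have "(\<integral>x. 1 / \<epsilon> * F (u x) \<partial>lebesgue_on Om) = 1 / \<epsilon> * (\<integral>x. F (u x) \<partial>lebesgue_on Om)"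
    by (simp only: integral_mult_right_zero)
  finally show ?thesis .
qed

text \<open>
  Testing the first equation with the constant 1 gives \<open>3a\<^sub>n\<^sub>+\<^sub>1 - 4a\<^sub>n + a\<^sub>n\<^sub>-\<^sub>1 = 0\<close> for the integrals
  \<open>a\<^sub>k\<close> of \<open>\<phi> k\<close>.
\<close>

lemma sl_bdf2_step_mass:
  assumes dom: "lipschitz_domain Om" and \<tau>: "0 < \<tau>"
    and H1: "\<phi> (n + 1) \<in> H1 Om" "\<phi> n \<in> H1 Om" "\<phi> (n - 1) \<in> H1 Om" "\<mu> (n + 1) \<in> H1 Om"
    and step: "sl_bdf2_step Om f \<epsilon> \<gamma> \<tau> A B \<phi> \<mu> n"
    and mean: "L2_inner Om (\<phi> n) (\<lambda>x. 1) = a" "L2_inner Om (\<phi> (n - 1)) (\<lambda>x. 1) = a"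
  shows "L2_inner Om (\<phi> (n + 1)) (\<lambda>x. 1) = a"
proof -
  have Om: "open Om" "bounded Om" using dom by (auto simp: lipschitz_domain_def)
  note L = H1(1-3)[THEN H1_L2]
  have one: "(\<lambda>x. 1::real) \<in> L2 Om" by (rule L2_const[OF Om])
  let ?b = "\<lambda>x. 3 * \<phi> (n + 1) x - 4 * \<phi> n x + \<phi> (n - 1) x"
  have "L2_inner Om (\<lambda>x. ?b x / (2 * \<tau>)) (\<lambda>x. 1) = 0"
    using step H1_const(1)[OF Om, of 1] dirichlet_const[OF Om H1(4)]
    by (simp add: sl_bdf2_step_def neumann_laplacian_eq)
  moreover have "L2_inner Om (\<lambda>x. ?b x / (2 * \<tau>)) (\<lambda>x. 1) = 1 / (2 * \<tau>) * L2_inner Om ?b (\<lambda>x. 1)"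
    using L2_inner_mult_left[of Om "1 / (2 * \<tau>)" ?b "\<lambda>x. 1"] by simp
  moreover have "L2_inner Om ?b (\<lambda>x. 1) = 3 * L2_inner Om (\<phi> (n + 1)) (\<lambda>x. 1) - 4 * a + a"
    using L2_inner_add_left[OF L2_diff[OF L2_mult[OF L(1), of 3] L2_mult[OF L(2), of 4]] L(3) one]
      L2_inner_diff_left[OF L2_mult[OF L(1), of 3] L2_mult[OF L(2), of 4] one] mean
    by (simp add: L2_inner_mult_left)
  ultimately show ?thesis using \<tau> by simp
qed

text \<open>
  Both values of \<open>F\<close> are expanded about \<open>h\<close>: the first-order terms of the difference combine to
  \<open>f h * (p - q)\<close>, and the two remainders are bounded separately.
\<close>

lemma potential_difference:
  fixes p q h :: "'a::euclidean_space \<Rightarrow> real" and F f :: "real \<Rightarrow> real"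
  assumes Om: "open Om" "bounded Om" and L2: "p \<in> L2 Om" "q \<in> L2 Om" "h \<in> L2 Om"
    and F: "\<And>s. (F has_real_derivative f s) (at s)" and f: "\<And>s. f differentiable (at s)"
    and bound: "\<And>s. \<bar>deriv f s\<bar> \<le> L"
  shows "integrable (lebesgue_on Om) (\<lambda>x. F (p x))"
    and "(\<lambda>x. f (h x)) \<in> L2 Om"
    and "(\<integral>x. F (p x) \<partial>lebesgue_on Om) - (\<integral>x. F (q x) \<partial>lebesgue_on Om)
      \<le> L2_inner Om (\<lambda>x. f (h x)) (\<lambda>x. p x - q x)
        + L / 2 * (L2_inner Om (\<lambda>x. p x - h x) (\<lambda>x. p x - h x) + L2_inner Om (\<lambda>x. q x - h x) (\<lambda>x. q x - h x))"
      (is "?Fp - ?Fq \<le> ?rhs")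
proof -
  have F_cont: "continuous_on UNIV F"
    using F DERIV_isCont by (intro continuous_at_imp_continuous_on) blast
  have f_cont: "continuous_on UNIV f"
    using f differentiable_imp_continuous_within by (intro continuous_at_imp_continuous_on) blast
  have F_growth: "\<bar>F s\<bar> \<le> \<bar>F 0\<bar> + \<bar>f 0\<bar> * \<bar>s\<bar> + L / 2 * s\<^sup>2" for s
  proof -
    have "\<bar>F s - F 0 - f 0 * s\<bar> \<le> L / 2 * s\<^sup>2" using second_order_taylor[OF F f bound, of s 0] by simp
    then show ?thesis unfolding abs_mult[symmetric] by linarith
  qed
  have int: "integrable (lebesgue_on Om) (\<lambda>x. F (u x))" if "u \<in> L2 Om" for u :: "'a \<Rightarrow> real"
    by (rule integrable_compose_quadratic_growth[OF Om that F_cont F_growth])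
  show "integrable (lebesgue_on Om) (\<lambda>x. F (p x))" by (rule int[OF L2(1)])
  show fh: "(\<lambda>x. f (h x)) \<in> L2 Om"
    by (rule L2_compose_linear_growth[OF Om L2(3) f_cont linear_growth[OF f bound]])
  have i1: "integrable (lebesgue_on Om) (\<lambda>x. f (h x) * (p x - q x))"
    using L2_integrable_inner[OF fh L2_diff[OF L2(1,2)]] by simp
  have i2: "integrable (lebesgue_on Om) (\<lambda>x. (p x - h x) * (p x - h x))"
    using L2_integrable_inner[OF L2_diff[OF L2(1,3)] L2_diff[OF L2(1,3)]] by simp
  have i3: "integrable (lebesgue_on Om) (\<lambda>x. (q x - h x) * (q x - h x))"
    using L2_integrable_inner[OF L2_diff[OF L2(2,3)] L2_diff[OF L2(2,3)]] by simp
  have "(\<integral>x. F (p x) - F (q x) \<partial>lebesgue_on Om)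
      \<le> (\<integral>x. f (h x) * (p x - q x) + L / 2 * ((p x - h x) * (p x - h x) + (q x - h x) * (q x - h x)) \<partial>lebesgue_on Om)"
  proof (rule integral_mono)
    fix x
    have "\<bar>F (p x) - F (h x) - f (h x) * (p x - h x)\<bar> \<le> L / 2 * (p x - h x)\<^sup>2"
      "\<bar>F (q x) - F (h x) - f (h x) * (q x - h x)\<bar> \<le> L / 2 * (q x - h x)\<^sup>2"
      by (rule second_order_taylor[OF F f bound])+
    moreover have "f (h x) * (p x - q x) = f (h x) * (p x - h x) - f (h x) * (q x - h x)"
      by (simp add: algebra_simps)
    moreover have "L / 2 * ((p x - h x) * (p x - h x) + (q x - h x) * (q x - h x))
        = L / 2 * (p x - h x)\<^sup>2 + L / 2 * (q x - h x)\<^sup>2"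
      by (simp add: power2_eq_square distrib_left)
    ultimately show "F (p x) - F (q x)
        \<le> f (h x) * (p x - q x) + L / 2 * ((p x - h x) * (p x - h x) + (q x - h x) * (q x - h x))"
      by linarith
  qed (intro Bochner_Integration.integrable_add Bochner_Integration.integrable_diff integrable_mult_right int L2 i1 i2 i3)+
  also have "\<dots> = ?rhs"
    using i1 i2 i3 by (simp add: L2_inner_def)
  finally show "?Fp - ?Fq \<le> ?rhs"
    by (simp add: int L2)
qed

theorem theorem2:
  fixes \<Omega> :: "'a::euclidean_space set"
    and F f :: "real \<Rightarrow> real"
    and \<epsilon> \<gamma> \<tau> A B L \<alpha>\<^sub>1 \<alpha>\<^sub>2 m\<^sub>0 :: real
    and N :: nat
    and \<phi> \<mu> :: "nat \<Rightarrow> 'a \<Rightarrow> real"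
  assumes dim: "DIM('a) = 2 \<or> DIM('a) = 3"
    and domain: "lipschitz_domain \<Omega>"
    and potential: "\<And>s. (F has_real_derivative f s) (at s)"
    and f_diff: "\<And>s. f differentiable (at s)"
    and f_bound: "\<And>s. \<bar>deriv f s\<bar> \<le> L"
    and L_nonneg: "0 \<le> L"
    and params_pos: "0 < \<epsilon>" "0 < \<gamma>" "0 < \<tau>"
    and AB_nonneg: "0 \<le> A" "0 \<le> B"
    and mass: "average \<Omega> (\<phi> 1) = m\<^sub>0" "average \<Omega> (\<phi> 0) = m\<^sub>0"
    and \<phi>_H1: "\<And>k. k \<le> N + 1 \<Longrightarrow> \<phi> k \<in> H1 \<Omega>"
    and \<mu>_H1: "\<And>k. 2 \<le> k \<Longrightarrow> k \<le> N + 1 \<Longrightarrow> \<mu> k \<in> H1 \<Omega>"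
    and scheme: "\<And>n. 1 \<le> n \<Longrightarrow> n \<le> N \<Longrightarrow> sl_bdf2_step \<Omega> f \<epsilon> \<gamma> \<tau> A B \<phi> \<mu> n"
    and B_cond: "B \<ge> L / \<epsilon>"
    and A_cond: "A \<ge> \<gamma> / \<alpha>\<^sub>2 * (L\<^sup>2 / (16 * \<epsilon>\<^sup>2)) - \<alpha>\<^sub>1 * (\<epsilon> / (2 * \<tau>))"
    and \<alpha>_cond: "0 \<le> \<alpha>\<^sub>1" "\<alpha>\<^sub>1 \<le> 1" "0 < \<alpha>\<^sub>2" "\<alpha>\<^sub>2 \<le> 1"
  shows "\<forall>n. 1 \<le> n \<and> n \<le> N \<longrightarrow>
    energy_B \<Omega> F \<epsilon> \<gamma> \<tau> L B \<phi> (n + 1)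
      \<le> energy_B \<Omega> F \<epsilon> \<gamma> \<tau> L B \<phi> n
        - 1 / (4 * \<tau> * \<gamma>) * (neg_norm \<Omega> (delta_tt \<phi> (n + 1)))\<^sup>2
        - (1 - \<alpha>\<^sub>1) * (\<epsilon> / 2) * (L2_norm \<Omega> (weak_gradient \<Omega> (delta_t \<phi> (n + 1))))\<^sup>2
        - (1 - \<alpha>\<^sub>2) * (1 / (\<tau> * \<gamma>)) * (neg_norm \<Omega> (delta_t \<phi> (n + 1)))\<^sup>2
        - (2 * sqrt (\<alpha>\<^sub>2 / \<gamma> * (A + \<alpha>\<^sub>1 * \<epsilon> / (2 * \<tau>))) - L / (2 * \<epsilon>))
            * (L2_norm \<Omega> (delta_t \<phi> (n + 1)))\<^sup>2
        - (B / 2 - L / (2 * \<epsilon>)) * (L2_norm \<Omega> (delta_tt \<phi> (n + 1)))\<^sup>2"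
proof (intro allI impI, elim conjE, goal_cases)
  case n: (1 n)
  have \<Omega>: "open \<Omega>" "bounded \<Omega>" "\<Omega> \<noteq> {}" using domain by (auto simp: lipschitz_domain_def)
  have one: "(\<lambda>x::'a. 1::real) \<in> L2 \<Omega>" by (rule L2_const[OF \<Omega>(1,2)])
  define a where "a = m\<^sub>0 * measure lebesgue \<Omega>"
  have mean: "L2_inner \<Omega> (\<phi> k) (\<lambda>x. 1) = a" if "k \<le> N + 1" for k
    using that
  proof (induction k rule: less_induct)
    case (less k)
    have base: "L2_inner \<Omega> u (\<lambda>x. 1) = a" if "average \<Omega> u = m\<^sub>0" for u
      using that measure_open_pos[OF \<Omega>] by (simp add: average_def L2_inner_def a_def field_simps)
    consider "k = 0" | "k = 1" | "2 \<le> k" by linarith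
    then show ?case
    proof cases
      case 3
      define j where "j = k - 1"
      have j: "k = j + 1" "1 \<le> j" "j \<le> N" using 3 less.prems by (auto simp: j_def)
      show ?thesis
        unfolding j(1)
      proof (rule sl_bdf2_step_mass[OF domain params_pos(3)])
        show "sl_bdf2_step \<Omega> f \<epsilon> \<gamma> \<tau> A B \<phi> \<mu> j" using scheme j by simp
        show "L2_inner \<Omega> (\<phi> j) (\<lambda>x. 1) = a" "L2_inner \<Omega> (\<phi> (j - 1)) (\<lambda>x. 1) = a"
          using less.IH[of j] less.IH[of "j - 1"] j by auto
      qed (use j in \<open>auto intro!: \<phi>_H1 \<mu>_H1\<close>)
    qed (use base mass in auto)
  qed
  define p q r where "p = \<phi> (n + 1)" and "q = \<phi> n" and "r = \<phi> (n - 1)"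
  define D d S where "D = delta_t \<phi> (n + 1)" and "d = delta_t \<phi> n" and "S = delta_tt \<phi> (n + 1)"
  have D: "D = (\<lambda>x. p x - q x)" and d: "d = (\<lambda>x. q x - r x)"
    by (simp_all add: D_def d_def delta_t_def p_def q_def r_def)
  have S: "S = (\<lambda>x. D x - d x)"
    by (simp add: S_def delta_tt_def D d p_def q_def r_def fun_eq_iff)
  have H1: "p \<in> H1 \<Omega>" "q \<in> H1 \<Omega>" "r \<in> H1 \<Omega>" "\<mu> (n + 1) \<in> H1 \<Omega>"
    using n by (auto simp: p_def q_def r_def intro!: \<phi>_H1 \<mu>_H1)
  have D_H1: "D \<in> H1 \<Omega>" and d_H1: "d \<in> H1 \<Omega>"
    unfolding D d by (intro H1_diff \<Omega> H1)+
  note L2 = H1(1-3)[THEN H1_L2]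
  have D_L2: "D \<in> L2 \<Omega>" and d_L2: "d \<in> L2 \<Omega>" using D_H1 d_H1 by (auto intro: H1_L2)
  have S_L2: "S \<in> L2 \<Omega>" unfolding S by (rule L2_diff[OF D_L2 d_L2])
  have D_mean: "L2_inner \<Omega> D (\<lambda>x. 1) = 0" and d_mean: "L2_inner \<Omega> d (\<lambda>x. 1) = 0"
    using n L2_inner_diff_left[OF L2(1,2) one] L2_inner_diff_left[OF L2(2,3) one]
      mean[of "n + 1"] mean[of n] mean[of "n - 1"]
    by (simp_all add: D d p_def q_def r_def)
  define w where "w = neg_inv_laplacian \<Omega> D"
  have w_H1: "w \<in> H1 \<Omega>" and w_weak: "\<And>z. z \<in> H1 \<Omega> \<Longrightarrow> dirichlet \<Omega> w z = L2_inner \<Omega> D z"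
    unfolding w_def using neg_inv_laplacian[OF domain D_L2 D_mean] by auto
  define h where "h x = 2 * q x - r x" for x
  have h_L2: "h \<in> L2 \<Omega>"
    unfolding h_def by (intro L2_diff L2_mult L2)
  have step1: "L2_inner \<Omega> (\<lambda>x. (3 * p x - 4 * q x + r x) / (2 * \<tau>)) w = - \<gamma> * dirichlet \<Omega> (\<mu> (n + 1)) w"
    using scheme[OF n] w_H1 by (simp add: sl_bdf2_step_def neumann_laplacian_eq p_def q_def r_def)
  have step2: "L2_inner \<Omega> (\<mu> (n + 1)) D = \<epsilon> * dirichlet \<Omega> p D + 1 / \<epsilon> * L2_inner \<Omega> (\<lambda>x. f (h x)) D
      + A * \<tau> * dirichlet \<Omega> D D + B * L2_inner \<Omega> S D"
    using scheme[OF n] D_H1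
    by (simp add: sl_bdf2_step_def neumann_laplacian_eq p_def q_def r_def D_def S_def h_def)
  have mass_balance: "(3 * (neg_norm \<Omega> D)\<^sup>2 - L2_inner \<Omega> d w) / (2 * \<tau>) = - \<gamma> * L2_inner \<Omega> (\<mu> (n + 1)) D"
  proof -
    have "(\<lambda>x. (3 * p x - 4 * q x + r x) / (2 * \<tau>)) = (\<lambda>x. 1 / (2 * \<tau>) * (3 * D x - d x))"
      by (simp add: D d fun_eq_iff)
    then have "L2_inner \<Omega> (\<lambda>x. (3 * p x - 4 * q x + r x) / (2 * \<tau>)) w
        = 1 / (2 * \<tau>) * (3 * L2_inner \<Omega> D w - L2_inner \<Omega> d w)"
      using L2_inner_mult_left[of \<Omega> "1 / (2 * \<tau>)" "\<lambda>x. 3 * D x - d x" w]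
        L2_inner_diff_left[OF L2_mult[OF D_L2, of 3] d_L2 H1_L2[OF w_H1]]
      by (simp add: L2_inner_mult_left)
    moreover have "dirichlet \<Omega> (\<mu> (n + 1)) w = L2_inner \<Omega> (\<mu> (n + 1)) D"
      using w_weak[OF H1(4)] by (simp add: dirichlet_commute L2_inner_commute)
    ultimately show ?thesis
      using step1 neg_norm_square(2)[OF domain D_L2 D_mean] by (simp add: w_def)
  qed
  have dirichlet_pD: "dirichlet \<Omega> p D = (dirichlet \<Omega> p p - dirichlet \<Omega> q q + dirichlet \<Omega> D D) / 2"
  proof -
    have "dirichlet \<Omega> D D = dirichlet \<Omega> p D - dirichlet \<Omega> q D" "dirichlet \<Omega> p D = dirichlet \<Omega> p p - dirichlet \<Omega> p q"
      "dirichlet \<Omega> q D = dirichlet \<Omega> q p - dirichlet \<Omega> q q"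
      using dirichlet_diff_left[OF \<Omega>(1,2) H1(1,2) D_H1] dirichlet_diff_right[OF \<Omega>(1,2) H1(1,2) H1(1)]
        dirichlet_diff_right[OF \<Omega>(1,2) H1(1,2) H1(2)] by (simp_all add: D)
    then show ?thesis using dirichlet_commute[of \<Omega> p q] by simp
  qed
  have SD: "L2_inner \<Omega> S D = (L2_inner \<Omega> D D - L2_inner \<Omega> d d + L2_inner \<Omega> S S) / 2"
  proof -
    have "L2_inner \<Omega> S S = L2_inner \<Omega> S D - L2_inner \<Omega> S d" "L2_inner \<Omega> S D = L2_inner \<Omega> D D - L2_inner \<Omega> d D"
      "L2_inner \<Omega> S d = L2_inner \<Omega> D d - L2_inner \<Omega> d d"
      using L2_inner_diff_right[OF D_L2 d_L2 S_L2] L2_inner_diff_left[OF D_L2 d_L2 D_L2]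
        L2_inner_diff_left[OF D_L2 d_L2 d_L2] by (simp_all add: S)
    then show ?thesis using L2_inner_commute[of \<Omega> D d] by simp
  qed
  note potential_le = potential_difference[OF \<Omega>(1,2) _ _ h_L2 potential f_diff f_bound]
  have Fp: "integrable (lebesgue_on \<Omega>) (\<lambda>x. F (p x))" and Fq: "integrable (lebesgue_on \<Omega>) (\<lambda>x. F (q x))"
    using potential_le(1) L2 by blast+
  have taylor: "(\<integral>x. F (p x) \<partial>lebesgue_on \<Omega>) - (\<integral>x. F (q x) \<partial>lebesgue_on \<Omega>)
      \<le> L2_inner \<Omega> (\<lambda>x. f (h x)) D + L / 2 * (L2_inner \<Omega> S S + L2_inner \<Omega> d d)"
  proof -
    have "(\<lambda>x. p x - h x) = S" by (simp add: S D d h_def fun_eq_iff)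
    moreover have "L2_inner \<Omega> (\<lambda>x. q x - h x) (\<lambda>x. q x - h x) = L2_inner \<Omega> d d"
      by (simp add: L2_inner_def d h_def algebra_simps)
    ultimately show ?thesis using potential_le(3)[OF L2(1,2)] by (simp add: D)
  qed
  have interpolation: "(L2_inner \<Omega> D D)\<^sup>2 \<le> (neg_norm \<Omega> D)\<^sup>2 * dirichlet \<Omega> D D"
    using dirichlet_Cauchy_Schwarz[OF w_H1 D_H1] w_weak[OF D_H1] neg_norm_square(1)[OF domain D_L2 D_mean]
    by (simp add: w_def)
  have "energy_B \<Omega> F \<epsilon> \<gamma> \<tau> L B \<phi> (n + 1)
      = \<epsilon> / 2 * dirichlet \<Omega> p p + 1 / \<epsilon> * (\<integral>x. F (p x) \<partial>lebesgue_on \<Omega>)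
        + 1 / (4 * \<tau> * \<gamma>) * (neg_norm \<Omega> D)\<^sup>2 + (L / (2 * \<epsilon>) + B / 2) * L2_inner \<Omega> D D"
    using energy_eq[of \<Omega> p F, OF \<Omega>(1,2) H1(1) Fp]
    by (simp add: energy_B_def p_def D_def L2_norm_square)
  moreover have "energy_B \<Omega> F \<epsilon> \<gamma> \<tau> L B \<phi> n
      = \<epsilon> / 2 * dirichlet \<Omega> q q + 1 / \<epsilon> * (\<integral>x. F (q x) \<partial>lebesgue_on \<Omega>)
        + 1 / (4 * \<tau> * \<gamma>) * (neg_norm \<Omega> d)\<^sup>2 + (L / (2 * \<epsilon>) + B / 2) * L2_inner \<Omega> d d"
    using energy_eq[of \<Omega> q F, OF \<Omega>(1,2) H1(2) Fq]
    by (simp add: energy_B_def q_def d_def L2_norm_square)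
  moreover have "(neg_norm \<Omega> S)\<^sup>2 = (neg_norm \<Omega> D)\<^sup>2 - 2 * L2_inner \<Omega> d w + (neg_norm \<Omega> d)\<^sup>2"
    unfolding S w_def by (rule neg_norm_diff_square[OF domain D_L2 D_mean d_L2 d_mean])
  moreover note energy_balance[OF params_pos AB_nonneg(1) \<alpha>_cond(1,3) mass_balance
      step2[unfolded dirichlet_pD SD] taylor interpolation zero_le_power2 dirichlet_nonneg L2_inner_self_nonneg,
      of "(neg_norm \<Omega> d)\<^sup>2"]
  ultimately show ?case
    unfolding L2_norm_square D_def[symmetric] S_def[symmetric] dirichlet_def[symmetric]
    by (simp only:)
qed

end
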